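(* Fix $\delta>0$. Then for all $h>0$, all $E=E(h)>0$ (which may depend on $h$), all $\varepsilon\in(0,1]$, and both choices of sign $\pm$, $$\big\|(|x|+1)^{-\frac{1+\delta}{2}}(P(h)-E\pm i\varepsilon)^{-1}(|x|+1)^{-\frac{1+\delta}{2}}\big\|_{L^2(\mathbb R)\to L^2(\mathbb R)}\le\Big(\frac{C(V,E,h,\delta)}{E}\Big)^{1/2},$$ where $$C(V,E,h,\delta)= e^{C_1(V,E,h,\delta)}\Big(\frac{4}{h^2}+\frac{2}{h}+\frac{1}{Eh^2}\big(2+2E+\tfrac{\|V\|^2}{h^2}\big)^2\Big)e^{C_1(V,E,h,\delta)},\qquad C_1(V,E,h,\delta)=2\delta^{-1}+E^{-1/2}h^{-1}\|V\|.$$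
   Context: For each $h>0$, $V=V(x;h)$ is a real, finite signed Borel measure on $\mathbb R$, which may depend on $h$. $|V|=V^++V^-$ is its total variation measure ($\{V^+,V^-\}$ the Jordan decomposition) and $\|V\|=|V|(\mathbb R)$. Each $u\in H^1(\mathbb R)$ has a unique bounded continuous representative $u_c$; the product of $u$ and $V$ is the complex Borel measure $u_cV$, and one defines, in the sense of distributions on $\mathbb R$, $$Pu=P(h)u=-h^2\partial_x^2u+u_cV .$$ The domain of $P$ is $\mathcal D=\{u\in H^1(\mathbb R): u'\in L^\infty(\mathbb R),\ Pu\in L^2(\mathbb R)\}$; with this domain $P$ is self-adjoint on $L^2(\mathbb R)$. The expressions $(|x|+1)^{-(1+\delta)/2}$ act as multiplication operators. *)

theory Defs
  imports "HOL-Analysis.Analysis"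
begin

section \<open>Finite signed Borel measures on the line\<close>

text \<open>A signed measure is a countably additive real-valued set function; only its values on Borel
  sets matter. Finiteness is automatic, since the values are real numbers.\<close>

definition finite_signed_borel_measure :: "(real set \<Rightarrow> real) \<Rightarrow> bool" where
  "finite_signed_borel_measure V \<longleftrightarrow>
     V {} = 0 \<and>
     (\<forall>A :: nat \<Rightarrow> real set. range A \<subseteq> sets borel \<longrightarrow> disjoint_family A \<longrightarrow>
        (\<lambda>n. V (A n)) sums V (\<Union>n. A n))"

definition is_jordan_decomposition ::
    "(real set \<Rightarrow> real) \<Rightarrow> real measure \<times> real measure \<Rightarrow> bool" where
  "is_jordan_decomposition V = (\<lambda>(M, N).
     sets M = sets borel \<and> sets N = sets borel \<and> finite_measure M \<and> finite_measure N \<and>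
     (\<exists>S \<in> sets borel. emeasure N S = 0 \<and> emeasure M (- S) = 0) \<and>
     (\<forall>A \<in> sets borel. V A = measure M A - measure N A))"

definition jordan_decomposition :: "(real set \<Rightarrow> real) \<Rightarrow> real measure \<times> real measure" where
  "jordan_decomposition V = (THE MN. is_jordan_decomposition V MN)"

definition pos_part :: "(real set \<Rightarrow> real) \<Rightarrow> real measure" where
  "pos_part V = fst (jordan_decomposition V)"

definition neg_part :: "(real set \<Rightarrow> real) \<Rightarrow> real measure" where
  "neg_part V = snd (jordan_decomposition V)"

definition total_variation :: "(real set \<Rightarrow> real) \<Rightarrow> real set \<Rightarrow> real" where
  "total_variation V A = measure (pos_part V) A + measure (neg_part V) A"

definition tv_norm :: "(real set \<Rightarrow> real) \<Rightarrow> real" where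
  "tv_norm V = total_variation V UNIV"

definition signed_integral :: "(real set \<Rightarrow> real) \<Rightarrow> (real \<Rightarrow> complex) \<Rightarrow> complex" where
  "signed_integral V f = (LINT x|pos_part V. f x) - (LINT x|neg_part V. f x)"


section \<open>The spaces \<open>L\<^sup>2\<close>, \<open>L\<^sup>\<infinity>\<close> and \<open>H\<^sup>1\<close> on the line\<close>

text \<open>Elements are functions. Those that agree almost everywhere represent the same
  vector, so identities between vectors are stated with \<open>AE\<close>.\<close>

definition L2 :: "(real \<Rightarrow> complex) set" where
  "L2 = {f \<in> borel_measurable lborel. integrable lborel (\<lambda>x. (norm (f x))\<^sup>2)}"

definition L2_norm :: "(real \<Rightarrow> complex) \<Rightarrow> real" where
  "L2_norm f = sqrt (LINT x|lborel. (norm (f x))\<^sup>2)"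

definition Linf :: "(real \<Rightarrow> complex) set" where
  "Linf = {f \<in> borel_measurable lborel. \<exists>M. AE x in lborel. norm (f x) \<le> M}"

definition vderiv :: "(real \<Rightarrow> complex) \<Rightarrow> real \<Rightarrow> complex" where
  "vderiv f x = vector_derivative f (at x)"

definition test_function :: "(real \<Rightarrow> complex) \<Rightarrow> bool" where
  "test_function \<phi> \<longleftrightarrow>
     (\<forall>n x. (vderiv ^^ n) \<phi> differentiable (at x)) \<and> compact (closure {x. \<phi> x \<noteq> 0})"

definition weak_derivative :: "(real \<Rightarrow> complex) \<Rightarrow> (real \<Rightarrow> complex) \<Rightarrow> bool" where
  "weak_derivative u g \<longleftrightarrow>
     (\<forall>\<phi>. test_function \<phi> \<longrightarrow>
        (LINT x|lborel. u x * vderiv \<phi> x) = - (LINT x|lborel. g x * \<phi> x))"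

definition H1 :: "(real \<Rightarrow> complex) set" where
  "H1 = {u \<in> L2. \<exists>g \<in> L2. weak_derivative u g}"

definition cont_rep :: "(real \<Rightarrow> complex) \<Rightarrow> real \<Rightarrow> complex" where
  "cont_rep u = (THE v. continuous_on UNIV v \<and> bounded (range v) \<and> (AE x in lborel. v x = u x))"


section \<open>The Schroedinger operator with measure potential\<close>

text \<open>The distribution \<open>- h\<^sup>2 u'' + u\<^sub>c V\<close>, evaluated at a test function.\<close>

definition schroedinger_distribution ::
    "real \<Rightarrow> (real set \<Rightarrow> real) \<Rightarrow> (real \<Rightarrow> complex) \<Rightarrow> (real \<Rightarrow> complex) \<Rightarrow> complex" where
  "schroedinger_distribution h V u \<phi> =
     - (complex_of_real h)\<^sup>2 * (LINT x|lborel. u x * vderiv (vderiv \<phi>) x)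
     + signed_integral V (\<lambda>x. cont_rep u x * \<phi> x)"

definition represented_by :: "((real \<Rightarrow> complex) \<Rightarrow> complex) \<Rightarrow> (real \<Rightarrow> complex) \<Rightarrow> bool" where
  "represented_by T g \<longleftrightarrow> (\<forall>\<phi>. test_function \<phi> \<longrightarrow> T \<phi> = (LINT x|lborel. g x * \<phi> x))"

definition schroedinger_domain :: "real \<Rightarrow> (real set \<Rightarrow> real) \<Rightarrow> (real \<Rightarrow> complex) set" where
  "schroedinger_domain h V =
     {u \<in> H1. (\<exists>g \<in> Linf. weak_derivative u g) \<and>
              (\<exists>g \<in> L2. represented_by (schroedinger_distribution h V u) g)}"

text \<open>The chosen function is determined up to null sets for \<open>u\<close> in the domain.\<close>

definition schroedinger ::
    "real \<Rightarrow> (real set \<Rightarrow> real) \<Rightarrow> (real \<Rightarrow> complex) \<Rightarrow> real \<Rightarrow> complex" where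
  "schroedinger h V u = (SOME g. g \<in> L2 \<and> represented_by (schroedinger_distribution h V u) g)"


section \<open>Operators on \<open>L\<^sup>2\<close>\<close>

definition mult_op :: "(real \<Rightarrow> real) \<Rightarrow> (real \<Rightarrow> complex) \<Rightarrow> real \<Rightarrow> complex" where
  "mult_op w f x = complex_of_real (w x) * f x"

text \<open>Extended-real valued, so that an upper bound by a real number includes boundedness; it is
  also infinite if the operator does not map \<open>L\<^sup>2\<close> to itself.\<close>

definition L2_opnorm :: "((real \<Rightarrow> complex) \<Rightarrow> real \<Rightarrow> complex) \<Rightarrow> ereal" where
  "L2_opnorm T =
     (SUP f \<in> {f \<in> L2. L2_norm f \<le> 1}. if T f \<in> L2 then ereal (L2_norm (T f)) else \<infinity>)"

definition L2_inverse ::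
    "(real \<Rightarrow> complex) set \<Rightarrow> ((real \<Rightarrow> complex) \<Rightarrow> real \<Rightarrow> complex) \<Rightarrow>
     (real \<Rightarrow> complex) \<Rightarrow> real \<Rightarrow> complex" where
  "L2_inverse D A f = (SOME u. u \<in> D \<and> (AE x in lborel. A u x = f x))"

text \<open>The operator \<open>A\<close> with domain \<open>D\<close> is a bijection onto \<open>L\<^sup>2\<close> (modulo null sets) with bounded
  inverse.\<close>

definition L2_boundedly_invertible ::
    "(real \<Rightarrow> complex) set \<Rightarrow> ((real \<Rightarrow> complex) \<Rightarrow> real \<Rightarrow> complex) \<Rightarrow> bool" where
  "L2_boundedly_invertible D A \<longleftrightarrow>
     (\<forall>u \<in> D. A u \<in> L2) \<and>
     (\<forall>f \<in> L2. \<exists>u \<in> D. AE x in lborel. A u x = f x) \<and>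
     (\<forall>u \<in> D. \<forall>v \<in> D. (AE x in lborel. A u x = A v x) \<longrightarrow> (AE x in lborel. u x = v x)) \<and>
     L2_opnorm (L2_inverse D A) < \<infinity>"

definition resolvent_weight :: "real \<Rightarrow> real \<Rightarrow> real" where
  "resolvent_weight \<delta> x = (\<bar>x\<bar> + 1) powr (- ((1 + \<delta>) / 2))"


section \<open>The constants\<close>

definition C1 :: "(real set \<Rightarrow> real) \<Rightarrow> real \<Rightarrow> real \<Rightarrow> real \<Rightarrow> real" where
  "C1 V E h \<delta> = 2 * inverse \<delta> + E powr (- (1 / 2)) * inverse h * tv_norm V"

definition C_const :: "(real set \<Rightarrow> real) \<Rightarrow> real \<Rightarrow> real \<Rightarrow> real \<Rightarrow> real" where
  "C_const V E h \<delta> =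
     exp (C1 V E h \<delta>) *
     (4 / h\<^sup>2 + 2 / h + 1 / (E * h\<^sup>2) * (2 + 2 * E + (tv_norm V)\<^sup>2 / h\<^sup>2)\<^sup>2) *
     exp (C1 V E h \<delta>)"

end

theory Submission
  imports Defs
begin

text \<open>Put \<open>z = E \<minusplus> i \<epsilon>\<close> and choose \<open>a\<close> with positive real part and \<open>h\<^sup>2 a\<^sup>2 = - z\<close>, so that
  \<open>exp (- a |x|) / (2 h\<^sup>2 a)\<close> is the Green function of \<open>- h\<^sup>2 \<partial>\<^sup>2 - z\<close>. Then \<open>(P - z) u = f\<close> is equivalent
  to the integral equation \<open>u + G (u V) = G f\<close> for bounded continuous \<open>u\<close>, and everything follows
  from a bound \<open>sup |u| \<le> K \<integral> |f|\<close> whose constant depends on \<open>V\<close> only through \<open>\<parallel>V\<parallel>\<close>: uniqueness, existence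
  (by the method of continuity along \<open>t V\<close>, \<open>0 \<le> t \<le> 1\<close>), and the weighted estimate, because
  the squared weight has integral \<open>2 / \<delta>\<close>.

  If \<open>V\<close> is a continuous integrable function, the bound is Gronwall's inequality for the energy
  \<open>h\<^sup>2 |u'|\<^sup>2 + E |u|\<^sup>2\<close>, where the term coming from \<open>\<epsilon>\<close> is absorbed by the real and imaginary parts of
  the identity obtained by pairing the equation with \<open>u\<close>. Since the constant only sees
  \<open>\<parallel>V\<parallel>\<close>, and mollifying \<open>V\<close> changes \<open>G (u V)\<close> by a uniformly small amount for each fixed \<open>u\<close>, the bound
  passes to measures, and no calculus for functions of bounded variation is needed.\<close>

section \<open>The Jordan decomposition of a signed measure\<close>

text \<open>For a measure potential \<open>u'\<close> has jumps, so the energy is not absolutely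
  continuous. The route around this keeps the solution \<open>u\<close> and replaces only the
  potential: \<open>u\<close> then solves the regularised equation up to a uniform defect \<eta>,
  and no convergence of regularised solutions has to be shown. The a priori bound must therefore
  hold for approximate solutions. The exact potential \<open>w\<close> close to \<open>u\<close>
  solves an ODE with source \<open>f - v (u - w)\<close>, whose L1 norm exceeds that of
  \<open>f\<close> by at most \<open>T \<eta>\<close>; this is the origin of the factor
  \<open>1 + K T\<close>. The same stability with \<open>f = 0\<close> is the lower bound that the
  method of continuity needs, uniform in \<open>t\<close> because the mass of \<open>t V\<close> is
  at most that of \<open>V\<close>.

  The weight is used twice, once to pass from L2 to L1 and once to pass from bounded functions to
  L2, each time at the cost \<open>sqrt (2 / \<delta>)\<close>. The weighted norm is thus at most
  \<open>K * (2 / \<delta>)\<close>. The stated constant dominates this since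
  \<open>2 t <= exp t\<close> for \<open>t = 2 / \<delta>\<close>, which accounts for the summand
  \<open>2 / \<delta>\<close> in the exponent \<open>C1\<close>; the other summand is the Gronwall
  exponent.\<close>

lemma signed_sums:
  assumes "finite_signed_borel_measure V" "\<And>n::nat. A n \<in> sets borel" "disjoint_family A"
  shows "(\<lambda>n. V (A n)) sums V (\<Union>n. A n)"
  using assms unfolding finite_signed_borel_measure_def by blast

lemma signed_empty: "finite_signed_borel_measure V \<Longrightarrow> V {} = 0"
  by (simp add: finite_signed_borel_measure_def)

lemma signed_Un:
  assumes V: "finite_signed_borel_measure V" and AB: "A \<in> sets borel" "B \<in> sets borel" "A \<inter> B = {}"
  shows "V (A \<union> B) = V A + V B"
proof -
  have "(\<lambda>n. V (binaryset A B n)) sums V (\<Union>n. binaryset A B n)"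
    using AB by (intro signed_sums[OF V])
      (auto simp: binaryset_def disjoint_family_on_def)
  moreover have "(\<lambda>n. V (binaryset A B n)) sums (V A + V B)"
    using binaryset_sums[of V A B] signed_empty[OF V] by simp
  ultimately show ?thesis
    by (auto dest: sums_unique2 simp: UN_binaryset_eq)
qed

lemma signed_Diff:
  assumes V: "finite_signed_borel_measure V" and AB: "A \<in> sets borel" "B \<in> sets borel" "B \<subseteq> A"
  shows "V (A - B) = V A - V B"
proof -
  have "(A - B) \<inter> B = {}" "(A - B) \<union> B = A" using AB by auto
  then show ?thesis using signed_Un[OF V, of "A - B" B] AB by auto
qed

definition positive_set :: "(real set \<Rightarrow> real) \<Rightarrow> real set \<Rightarrow> bool" where
  "positive_set V P \<longleftrightarrow> P \<in> sets borel \<and> (\<forall>A \<in> sets borel. A \<subseteq> P \<longrightarrow> 0 \<le> V A)"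

text \<open>The infimum of \<open>V\<close> over the subsets of \<open>D\<close> could be minus
  infinity, hence the cap at \<open>-1\<close>: either some subset has value at most
  \<open>-1\<close>, or the infimum is finite, and a set below half of it exists (the empty set if
  the infimum is 0). Halving avoids the question whether the infimum is attained.\<close>

lemma exists_half_minimal:
  fixes V :: "real set \<Rightarrow> real"
  assumes V: "finite_signed_borel_measure V"
  shows "\<exists>B \<in> sets borel. B \<subseteq> D \<and> (\<forall>C \<in> sets borel. C \<subseteq> D \<longrightarrow> V B \<le> max (V C / 2) (- 1))"
proof (cases "\<exists>B \<in> sets borel. B \<subseteq> D \<and> V B \<le> - 1")
  case True
  then show ?thesis by (meson max.coboundedI2)
next
  case False
  define S where "S = V ` {C \<in> sets borel. C \<subseteq> D}"
  have bdd: "bdd_below S"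
    using False by (intro bdd_belowI[of _ "-1"]) (force simp: S_def not_le)
  have "0 \<in> S" unfolding S_def using signed_empty[OF V] by force
  then have le0: "Inf S \<le> 0" using bdd by (rule cInf_lower)
  have low: "Inf S \<le> V C" if "C \<in> sets borel" "C \<subseteq> D" for C
    using that bdd by (intro cInf_lower) (auto simp: S_def)
  show ?thesis
  proof (cases "Inf S = 0")
    case True
    then have "V {} \<le> max (V C / 2) (- 1)" if "C \<in> sets borel" "C \<subseteq> D" for C
      using low[OF that] signed_empty[OF V] by linarith
    then show ?thesis by (intro bexI[of _ "{}"]) auto
  next
    case False
    then have "Inf S < Inf S / 2" using le0 by auto
    then obtain y where "y \<in> S" "y < Inf S / 2"
      using \<open>0 \<in> S\<close> cInf_lessD by (metis empty_iff)
    then obtain B where B: "B \<in> sets borel" "B \<subseteq> D" "V B < Inf S / 2" by (auto simp: S_def)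
    show ?thesis
    proof (intro bexI[of _ B] conjI ballI impI)
      fix C :: "real set" assume "C \<in> sets borel" "C \<subseteq> D"
      then have "Inf S / 2 \<le> V C / 2" using low by auto
      then show "V B \<le> max (V C / 2) (- 1)" using B by linarith
    qed (use B in auto)
  qed
qed

text \<open>Half-minimal sets are removed from \<open>A\<close> again and again. They are disjoint,
  so their values form a convergent series and tend to 0; a subset of the remainder with negative
  value would keep them below a fixed negative number.\<close>

lemma exists_positive_subset:
  assumes V: "finite_signed_borel_measure V" and A: "A \<in> sets borel"
  shows "\<exists>P \<subseteq> A. positive_set V P \<and> V A \<le> V P"
proof -
  obtain \<beta> where \<beta>: "\<And>D. \<beta> D \<in> sets borel" "\<And>D. \<beta> D \<subseteq> D"
    "\<And>D C. C \<in> sets borel \<Longrightarrow> C \<subseteq> D \<Longrightarrow> V (\<beta> D) \<le> max (V C / 2) (- 1)"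
    using exists_half_minimal[OF V] by metis
  define D where "D = rec_nat A (\<lambda>_ D. D - \<beta> D)"
  have D0: "D 0 = A" and DS: "D (Suc n) = D n - \<beta> (D n)" for n by (auto simp: D_def)
  define B where "B n = \<beta> (D n)" for n
  have Dmono: "D n \<subseteq> D m" if "m \<le> n" for m n
    using that by (induction rule: dec_induct) (auto simp: DS)
  have Bm: "B n \<in> sets borel" for n by (simp add: B_def \<beta>)
  have BD: "B n \<subseteq> D n" for n by (simp add: B_def \<beta>)
  have disj: "disjoint_family B"
  proof -
    have "B m \<inter> B n = {}" if "m < n" for m n
      using Dmono[of "Suc m" n] BD[of n] that by (auto simp: DS B_def)
    then show ?thesis unfolding disjoint_family_on_def by (metis inf_commute nat_neq_iff)
  qed
  define P where "P = A - (\<Union>n. B n)"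
  have Pm: "P \<in> sets borel" unfolding P_def using A Bm by auto
  have PD: "P \<subseteq> D n" for n
    by (induction n) (auto simp: P_def D0 DS B_def)
  have sums: "(\<lambda>n. V (B n)) sums V (\<Union>n. B n)" by (rule signed_sums[OF V Bm disj])
  have UB: "(\<Union>n. B n) \<subseteq> A" using BD Dmono[of 0] D0 by blast
  \<comment> \<open>The empty set as competitor turns the bound into
    \<open>max 0 (- 1) = 0\<close>.\<close>
  have B0: "V (B n) \<le> 0" for n using \<beta>(3)[of "{}" "D n"] signed_empty[OF V] by (simp add: B_def)
  have "V (\<Union>n. B n) \<le> 0" using sums_le[OF _ sums sums_zero] B0 by simp
  then have "V A \<le> V P" unfolding P_def using signed_Diff[OF V A _ UB] Bm by auto
  moreover have "0 \<le> V C" if C: "C \<in> sets borel" "C \<subseteq> P" for C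
  proof (rule ccontr)
    assume neg: "\<not> 0 \<le> V C"
    have "V (B n) \<le> max (V C / 2) (- 1)" for n
      unfolding B_def by (intro \<beta>(3) C(1)) (use C PD in blast)
    moreover have "(\<lambda>n. V (B n)) \<longlonglongrightarrow> 0" using sums by (simp add: summable_LIMSEQ_zero sums_summable)
    ultimately have "0 \<le> max (V C / 2) (- 1)" by (intro LIMSEQ_le_const2) auto
    then show False using neg by auto
  qed
  ultimately show ?thesis using Pm by (intro exI[of _ P]) (auto simp: positive_set_def P_def)
qed

lemma positive_set_UN:
  assumes V: "finite_signed_borel_measure V" and P: "\<And>n::nat. positive_set V (P n)"
  shows "positive_set V (\<Union>n. P n)"
  unfolding positive_set_def
proof (intro conjI ballI impI)
  have Pm: "P n \<in> sets borel" for n using P by (simp add: positive_set_def)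
  show "(\<Union>n. P n) \<in> sets borel" using Pm by auto
  fix A :: "real set" assume A: "A \<in> sets borel" "A \<subseteq> (\<Union>n. P n)"
  have dm: "disjointed P n \<in> sets borel" for n
    using sets.range_disjointed_sets[of P borel] Pm by auto
  have "(\<lambda>n. V (A \<inter> disjointed P n)) sums V (\<Union>n. A \<inter> disjointed P n)"
    using dm A disjoint_family_disjointed[of P]
    by (intro signed_sums[OF V]) (auto simp: disjoint_family_on_def, blast)
  moreover have "(\<Union>n. A \<inter> disjointed P n) = A"
    using A UN_disjointed_eq[of P] by blast
  moreover have "0 \<le> V (A \<inter> disjointed P n)" for n
    using P[of n] dm A(1) disjointed_subset[of P n]
    unfolding positive_set_def by (meson inf.coboundedI2 sets.Int)
  ultimately show "0 \<le> V A" using sums_le[OF _ sums_zero] by metis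
qed

text \<open>The supremum of \<open>V\<close> over positive sets is attained by a countable union
  \<open>Q\<close>. A positive set outside \<open>Q\<close> has value at most 0, since adding it to
  \<open>Q\<close> would otherwise exceed the supremum; \<open>exists_positive_subset\<close>
  carries this over to every Borel set outside \<open>Q\<close>.\<close>

theorem Hahn_decomposition_signed:
  assumes V: "finite_signed_borel_measure V"
  obtains P where "positive_set V P" "\<And>A. A \<in> sets borel \<Longrightarrow> A \<inter> P = {} \<Longrightarrow> V A \<le> 0"
proof -
  define S where "S = V ` {P. positive_set V P}"
  have mono: "V P \<le> V Q" if "positive_set V Q" "P \<in> sets borel" "P \<subseteq> Q" for P Q
  proof -
    have "0 \<le> V (Q - P)" using that by (auto simp: positive_set_def)
    then show ?thesis using signed_Diff[OF V, of Q P] that by (auto simp: positive_set_def)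
  qed
  have S0: "S \<noteq> {}"
  proof -
    have "positive_set V {}" using signed_empty[OF V] by (auto simp: positive_set_def)
    then show ?thesis by (auto simp: S_def)
  qed
  \<comment> \<open>Otherwise a countable union of positive sets would have a real value above every
    \<open>n\<close>.\<close>
  have bdd: "bdd_above S"
  proof (rule ccontr)
    assume "\<not> bdd_above S"
    then have "\<exists>P. positive_set V P \<and> real n < V P" for n :: nat
      unfolding S_def bdd_above_def by (force simp: not_le)
    then have "\<exists>P. \<forall>n. positive_set V (P n) \<and> real n < V (P n)" by (intro choice allI)
    then obtain P where P: "\<And>n. positive_set V (P n)" "\<And>n. real n < V (P n)" by blast
    have "real n < V (\<Union>n. P n)" for n
    proof -
      have "V (P n) \<le> V (\<Union>n. P n)"
        using P(1)[of n] by (intro mono positive_set_UN[OF V P(1)]) (auto simp: positive_set_def)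
      with P(2)[of n] show ?thesis by (rule less_le_trans)
    qed
    moreover obtain n where "V (\<Union>n. P n) < real n" using reals_Archimedean2 by blast
    ultimately show False by (meson less_asym)
  qed
  have "\<exists>P. positive_set V P \<and> Sup S - inverse (Suc n) < V P" for n :: nat
    using less_cSupE[OF _ S0, of "Sup S - inverse (Suc n)"] unfolding S_def by auto
  then have "\<exists>P. \<forall>n::nat. positive_set V (P n) \<and> Sup S - inverse (Suc n) < V (P n)"
    by (intro choice allI)
  then obtain P where P: "\<And>n. positive_set V (P n)" "\<And>n. Sup S - inverse (Suc n) < V (P n)" by blast
  define Q where "Q = (\<Union>n. P n)"
  have Q: "positive_set V Q" unfolding Q_def by (rule positive_set_UN[OF V P(1)])
  have "Sup S - inverse (Suc n) \<le> V Q" for n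
  proof -
    have "V (P n) \<le> V Q" using P(1)[of n] by (intro mono Q) (auto simp: Q_def positive_set_def)
    with P(2)[of n] show ?thesis by simp
  qed
  then have "Sup S \<le> V Q"
  proof -
    have "(\<lambda>n. Sup S - inverse (real (Suc n))) \<longlonglongrightarrow> Sup S - 0"
      by (intro tendsto_intros LIMSEQ_inverse_real_of_nat)
    then show ?thesis using \<open>\<And>n. Sup S - inverse (Suc n) \<le> V Q\<close> by (intro LIMSEQ_le_const2) auto
  qed
  show ?thesis
  proof (rule that[OF Q])
    fix A :: "real set" assume A: "A \<in> sets borel" "A \<inter> Q = {}"
    obtain R where R: "R \<subseteq> A" "positive_set V R" "V A \<le> V R"
      using exists_positive_subset[OF V A(1)] by blast
    \<comment> \<open>A union of two sets, written as a countable one to fit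
      \<open>positive_set_UN\<close>.\<close>
    have "positive_set V (\<Union>n::nat. if n = 0 then Q else R)"
      by (rule positive_set_UN[OF V]) (use Q R in auto)
    also have "(\<Union>n::nat. if n = 0 then Q else R) = Q \<union> R" by (auto split: if_splits)
    finally have "V (Q \<union> R) \<le> Sup S" using bdd by (intro cSup_upper) (auto simp: S_def)
    moreover have "V (Q \<union> R) = V Q + V R"
      using Q R A by (intro signed_Un[OF V]) (auto simp: positive_set_def)
    ultimately show "V A \<le> 0" using R \<open>Sup S \<le> V Q\<close> by linarith
  qed
qed

lemma measure_of_signed:
  fixes f :: "real set \<Rightarrow> real"
  assumes "f {} = 0" and nn: "\<And>A. A \<in> sets borel \<Longrightarrow> 0 \<le> f A"
    and sums: "\<And>A::nat \<Rightarrow> real set. (\<And>n. A n \<in> sets borel) \<Longrightarrow> disjoint_family A \<Longrightarrow>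
                 (\<lambda>n. f (A n)) sums f (\<Union>n. A n)"
  shows "\<exists>M. sets M = sets borel \<and> finite_measure M \<and> (\<forall>A \<in> sets borel. measure M A = f A)"
proof -
  define M where "M = measure_of UNIV (sets borel) (\<lambda>A. ennreal (f A))"
  have sM: "sets M = sets borel"
    unfolding M_def using sets.sigma_sets_eq[of "borel :: real measure"] by simp
  have em: "emeasure M A = ennreal (f A)" if "A \<in> sets borel" for A
  proof (rule emeasure_measure_of[OF M_def])
    show "positive (sets M) (\<lambda>A. ennreal (f A))" using assms by (simp add: positive_def)
    show "countably_additive (sets M) (\<lambda>A. ennreal (f A))"
      unfolding countably_additive_def sM
    proof (intro allI impI)
      fix A :: "nat \<Rightarrow> real set" assume A: "range A \<subseteq> sets borel" "disjoint_family A"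
      have s: "(\<lambda>n. f (A n)) sums f (\<Union>n. A n)" using A by (intro sums) auto
      show "(\<Sum>i. ennreal (f (A i))) = ennreal (f (\<Union> (range A)))"
        using s A by (subst suminf_ennreal2) (auto intro!: nn simp: sums_iff)
    qed
  qed (use that sM in auto)
  have "space M = UNIV" by (simp add: M_def)
  then have "finite_measure M" using em[of UNIV] by (intro finite_measureI) simp
  moreover have "measure M A = f A" if "A \<in> sets borel" for A
    using em[OF that] nn[OF that] by (simp add: measure_def)
  ultimately show ?thesis using sM by blast
qed

lemma jordan_decomposition_exists:
  assumes V: "finite_signed_borel_measure V"
  shows "\<exists>MN. is_jordan_decomposition V MN"
proof -
  obtain P where P: "positive_set V P" and neg: "\<And>A. A \<in> sets borel \<Longrightarrow> A \<inter> P = {} \<Longrightarrow> V A \<le> 0"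
    using Hahn_decomposition_signed[OF V] by blast
  have Pm: "P \<in> sets borel" using P by (simp add: positive_set_def)
  have "\<exists>M. sets M = sets borel \<and> finite_measure M \<and> (\<forall>A \<in> sets borel. measure M A = V (A \<inter> P))"
  proof (rule measure_of_signed[of "\<lambda>A. V (A \<inter> P)"])
    show "0 \<le> V (A \<inter> P)" if "A \<in> sets borel" for A using P that Pm by (auto simp: positive_set_def)
    fix A :: "nat \<Rightarrow> real set" assume A: "\<And>n. A n \<in> sets borel" "disjoint_family A"
    have "(\<lambda>n. V (A n \<inter> P)) sums V (\<Union>n. A n \<inter> P)"
      using A Pm by (intro signed_sums[OF V]) (auto simp: disjoint_family_on_def)
    then show "(\<lambda>n. V (A n \<inter> P)) sums V ((\<Union>n. A n) \<inter> P)" by (simp add: Int_UN_distrib2)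
  qed (simp add: signed_empty[OF V])
  then obtain M where M: "sets M = sets borel" "finite_measure M"
    "\<And>A. A \<in> sets borel \<Longrightarrow> measure M A = V (A \<inter> P)" by blast
  have "\<exists>N. sets N = sets borel \<and> finite_measure N \<and> (\<forall>A \<in> sets borel. measure N A = - V (A \<inter> - P))"
  proof (rule measure_of_signed[of "\<lambda>A. - V (A \<inter> - P)"])
    show "0 \<le> - V (A \<inter> - P)" if "A \<in> sets borel" for A using neg[of "A \<inter> - P"] that Pm by auto
    fix A :: "nat \<Rightarrow> real set" assume A: "\<And>n. A n \<in> sets borel" "disjoint_family A"
    have "(\<lambda>n. V (A n \<inter> - P)) sums V (\<Union>n. A n \<inter> - P)"
      using A Pm by (intro signed_sums[OF V]) (auto simp: disjoint_family_on_def)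
    then show "(\<lambda>n. - V (A n \<inter> - P)) sums - V ((\<Union>n. A n) \<inter> - P)"
      by (intro sums_minus) (simp add: Int_UN_distrib2)
  qed (simp add: signed_empty[OF V])
  then obtain N where N: "sets N = sets borel" "finite_measure N"
    "\<And>A. A \<in> sets borel \<Longrightarrow> measure N A = - V (A \<inter> - P)" by blast
  have "measure N P = 0" using N(3)[OF Pm] signed_empty[OF V] by simp
  then have "emeasure N P = 0" using N(2) by (simp add: finite_measure.emeasure_eq_measure)
  moreover have "measure M (- P) = 0" using M(3)[of "- P"] Pm signed_empty[OF V] by simp
  then have "emeasure M (- P) = 0" using M(2) by (simp add: finite_measure.emeasure_eq_measure)
  moreover have "V A = measure M A - measure N A" if "A \<in> sets borel" for A
  proof -
    have "V A = V (A \<inter> P \<union> A \<inter> - P)" by (rule arg_cong[of _ _ V]) auto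
    also have "\<dots> = V (A \<inter> P) + V (A \<inter> - P)" using that Pm by (intro signed_Un[OF V]) auto
    finally show ?thesis using M N that by simp
  qed
  ultimately show ?thesis
    unfolding is_jordan_decomposition_def using M(1,2) N(1,2) Pm
    by (intro exI[of _ "(M, N)"]) (unfold prod.case, blast)
qed

text \<open>On a set \<open>S\<close> that carries \<open>M\<close> and is null for
  \<open>N\<close>, both measures can be read off from \<open>V\<close> alone, which makes two
  decompositions comparable.\<close>

lemma jordan_decomposition_parts:
  assumes J: "is_jordan_decomposition V (M, N)"
  obtains S where "S \<in> sets borel"
    "\<And>A. A \<in> sets borel \<Longrightarrow> measure M A = V (A \<inter> S)" "\<And>A. A \<in> sets borel \<Longrightarrow> measure N A = - V (A - S)"
    "\<And>A. A \<in> sets borel \<Longrightarrow> 0 \<le> V (A \<inter> S)" "\<And>A. A \<in> sets borel \<Longrightarrow> V (A - S) \<le> 0"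
proof -
  obtain S where S: "S \<in> sets borel" "emeasure N S = 0" "emeasure M (- S) = 0"
    and sets: "sets M = sets borel" "sets N = sets borel" and fin: "finite_measure M" "finite_measure N"
    and V: "\<And>A. A \<in> sets borel \<Longrightarrow> V A = measure M A - measure N A"
    using J unfolding is_jordan_decomposition_def by auto
  interpret M: finite_measure M by fact
  interpret N: finite_measure N by fact
  have N0: "measure N (A \<inter> S) = 0" if "A \<in> sets borel" for A
    using S(2) emeasure_mono[of "A \<inter> S" S N] S(1) sets by (simp add: measure_def)
  have M0: "measure M (A - S) = 0" if "A \<in> sets borel" for A
    using S(3) emeasure_mono[of "A - S" "- S" M] S(1) sets by (force simp: measure_def)
  have MA: "measure M A = measure M (A \<inter> S)" if "A \<in> sets borel" for A
    using M.finite_measure_Union[of "A \<inter> S" "A - S"] M0[OF that] that S(1) sets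
    by (auto simp: Int_Diff_Un)
  have NA: "measure N A = measure N (A - S)" if "A \<in> sets borel" for A
    using N.finite_measure_Union[of "A \<inter> S" "A - S"] N0[OF that] that S(1) sets
    by (auto simp: Int_Diff_Un)
  show ?thesis
  proof (rule that[OF S(1)])
    fix A :: "real set" assume A: "A \<in> sets borel"
    show "measure M A = V (A \<inter> S)" using V[of "A \<inter> S"] N0[OF A] MA[OF A] A S(1) by simp
    show "measure N A = - V (A - S)" using V[of "A - S"] M0[OF A] NA[OF A] A S(1) by simp
    show "0 \<le> V (A \<inter> S)" using V[of "A \<inter> S"] N0[OF A] A S(1) by simp
    show "V (A - S) \<le> 0" using V[of "A - S"] M0[OF A] A S(1) by simp
  qed
qed

text \<open>\<open>jordan_decomposition\<close> is a definite description, so uniqueness is required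
  as equality of measures. Two carriers \<open>S\<close> and \<open>T\<close> differ only by sets on
  which \<open>V\<close> vanishes: a Borel subset of \<open>S - T\<close> has value at least 0
  because of \<open>S\<close> and at most 0 because of \<open>T\<close>.\<close>

lemma jordan_decomposition_unique:
  assumes V: "finite_signed_borel_measure V"
    and J: "is_jordan_decomposition V (M, N)" "is_jordan_decomposition V (M', N')"
  shows "M = M' \<and> N = N'"
proof -
  obtain S where S: "S \<in> sets borel"
    "\<And>A. A \<in> sets borel \<Longrightarrow> measure M A = V (A \<inter> S)" "\<And>A. A \<in> sets borel \<Longrightarrow> measure N A = - V (A - S)"
    "\<And>A. A \<in> sets borel \<Longrightarrow> 0 \<le> V (A \<inter> S)" "\<And>A. A \<in> sets borel \<Longrightarrow> V (A - S) \<le> 0"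
    using jordan_decomposition_parts[OF J(1)] by blast
  obtain T where T: "T \<in> sets borel"
    "\<And>A. A \<in> sets borel \<Longrightarrow> measure M' A = V (A \<inter> T)" "\<And>A. A \<in> sets borel \<Longrightarrow> measure N' A = - V (A - T)"
    "\<And>A. A \<in> sets borel \<Longrightarrow> 0 \<le> V (A \<inter> T)" "\<And>A. A \<in> sets borel \<Longrightarrow> V (A - T) \<le> 0"
    using jordan_decomposition_parts[OF J(2)] by blast
  have st: "sets M = sets borel" "sets N = sets borel" "sets M' = sets borel" "sets N' = sets borel"
    "finite_measure M" "finite_measure N" "finite_measure M'" "finite_measure N'"
    using J unfolding is_jordan_decomposition_def by auto
  have eq: "V (A \<inter> S) = V (A \<inter> T) \<and> V (A - S) = V (A - T)" if A: "A \<in> sets borel" for A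
  proof -
    have "(A - T) \<inter> S = A \<inter> S - T" "(A - S) \<inter> T = A \<inter> T - S" by blast+
    then have z: "V (A \<inter> S - T) = 0" and z': "V (A \<inter> T - S) = 0"
      using S(4)[of "A - T"] T(5)[of "A \<inter> S"] S(5)[of "A \<inter> T"] T(4)[of "A - S"] S(1) T(1) A
      by force+
    have a: "V (A \<inter> S) = V (A \<inter> S \<inter> T) + V (A \<inter> S - T)"
    proof -
      have "A \<inter> S = A \<inter> S \<inter> T \<union> (A \<inter> S - T)" by blast
      then show ?thesis using signed_Un[OF V, of "A \<inter> S \<inter> T" "A \<inter> S - T"] S(1) T(1) A by auto
    qed
    have b: "V (A \<inter> T) = V (A \<inter> S \<inter> T) + V (A \<inter> T - S)"
    proof -
      have "A \<inter> T = A \<inter> S \<inter> T \<union> (A \<inter> T - S)" "A \<inter> S \<inter> T \<inter> (A \<inter> T - S) = {}" by blast+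
      then show ?thesis using signed_Un[OF V, of "A \<inter> S \<inter> T" "A \<inter> T - S"] S(1) T(1) A by auto
    qed
    have "V (A \<inter> S) = V (A \<inter> T)" using a b z z' by simp
    moreover have "V (A - S) = V A - V (A \<inter> S)" "V (A - T) = V A - V (A \<inter> T)"
      using signed_Diff[OF V, of A "A \<inter> S"] signed_Diff[OF V, of A "A \<inter> T"] A S(1) T(1)
      by (auto simp: Diff_Int)
    ultimately show ?thesis by simp
  qed
  have "emeasure M A = emeasure M' A" "emeasure N A = emeasure N' A" if "A \<in> sets borel" for A
    using S(2,3)[OF that] T(2,3)[OF that] eq[OF that]
    by (simp_all add: finite_measure.emeasure_eq_measure[OF st(5)] finite_measure.emeasure_eq_measure[OF st(6)]
      finite_measure.emeasure_eq_measure[OF st(7)] finite_measure.emeasure_eq_measure[OF st(8)])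
  then show ?thesis using st(1-4) by (intro conjI measure_eqI) simp_all
qed

lemma is_jordan_decomposition_parts:
  assumes V: "finite_signed_borel_measure V"
  shows "is_jordan_decomposition V (pos_part V, neg_part V)"
proof -
  obtain M N where J: "is_jordan_decomposition V (M, N)"
    using jordan_decomposition_exists[OF V] by (metis surj_pair)
  have "jordan_decomposition V = (M, N)"
    unfolding jordan_decomposition_def
  proof (rule the_equality)
    show "is_jordan_decomposition V (M, N)" by (rule J)
    fix MN assume "is_jordan_decomposition V MN"
    then show "MN = (M, N)"
      using jordan_decomposition_unique[OF V _ J, of "fst MN" "snd MN"] by (simp add: prod_eq_iff)
  qed
  then show ?thesis using J by (simp add: pos_part_def neg_part_def)
qed

lemma
  assumes V: "finite_signed_borel_measure V"
  shows sets_pos_part: "sets (pos_part V) = sets borel"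
    and sets_neg_part: "sets (neg_part V) = sets borel"
    and finite_measure_pos_part: "finite_measure (pos_part V)"
    and finite_measure_neg_part: "finite_measure (neg_part V)"
  using is_jordan_decomposition_parts[OF V] by (auto simp: is_jordan_decomposition_def)

section \<open>Absolutely continuous functions\<close>

text \<open>Local absolute continuity with density \<open>q\<close>, expressed by the fundamental
  theorem on compact intervals instead of pointwise derivatives. In this form the density may be
  changed on null sets, and the calculus below rests on Fubini's theorem.\<close>

definition ac_deriv :: "(real \<Rightarrow> 'a::{real_normed_field, euclidean_space}) \<Rightarrow> (real \<Rightarrow> 'a) \<Rightarrow> bool" where
  "ac_deriv u q \<longleftrightarrow> (\<forall>s t. set_integrable lborel {s..t} q) \<and>
     (\<forall>s t. s \<le> t \<longrightarrow> (LINT x:{s..t}|lborel. q x) = u t - u s)"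

lemma ac_derivD:
  assumes "ac_deriv u q"
  shows "set_integrable lborel {s..t} q" "s \<le> t \<Longrightarrow> (LINT x:{s..t}|lborel. q x) = u t - u s"
  using assms by (auto simp: ac_deriv_def)

lemma ac_deriv_continuous:
  assumes "ac_deriv u q"
  shows "continuous_on UNIV u"
proof -
  have *: "continuous_on {- R..R} u" for R
  proof (cases "- R \<le> R")
    case True
    have int: "q integrable_on {- R..R}"
      using ac_derivD(1)[OF assms] by (rule set_borel_integral_eq_integral)
    have eq: "u x = u (- R) + integral {- R..x} q" if "x \<in> {- R..R}" for x
    proof -
      have "(LINT y:{- R..x}|lborel. q y) = integral {- R..x} q"
        by (intro set_borel_integral_eq_integral ac_derivD(1)[OF assms])
      then show ?thesis using ac_derivD(2)[OF assms, of "- R" x] that by simp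
    qed
    have "continuous_on {- R..R} (\<lambda>x. u (- R) + integral {- R..x} q)"
      by (intro continuous_intros indefinite_integral_continuous_1 int)
    then show ?thesis by (rule continuous_on_eq) (rule eq[symmetric])
  qed auto
  have "isCont u x" for x
    using *[of "\<bar>x\<bar> + 1"] by (rule continuous_on_interior) auto
  then show ?thesis by (simp add: continuous_at_imp_continuous_on)
qed

lemma ac_deriv_measurable:
  assumes "ac_deriv u q"
  shows "u \<in> borel_measurable borel"
  using ac_deriv_continuous[OF assms] by (rule borel_measurable_continuous_onI)

lemma set_integrable_mult_continuous:
  fixes q w :: "real \<Rightarrow> 'a::{real_normed_field, euclidean_space}"
  assumes q: "set_integrable lborel {s..t} q" and w: "continuous_on UNIV w"
  shows "set_integrable lborel {s..t} (\<lambda>x. q x * w x)"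
proof -
  have "compact (w ` {s..t})"
    by (intro compact_continuous_image continuous_on_subset[OF w]) auto
  then have "bounded (w ` {s..t})" by (rule compact_imp_bounded)
  then obtain B where B: "\<And>x. x \<in> {s..t} \<Longrightarrow> norm (w x) \<le> B"
    by (meson bounded_iff imageI)
  have [measurable]: "w \<in> borel_measurable borel" by (intro borel_measurable_continuous_onI w)
  have "integrable lborel (\<lambda>x. B *\<^sub>R (indicator {s..t} x *\<^sub>R q x))"
    using q by (intro integrable_scaleR_right) (auto simp: set_integrable_def)
  moreover have "(\<lambda>x. (indicator {s..t} x *\<^sub>R q x) * w x) \<in> borel_measurable lborel"
    using q unfolding set_integrable_def by measurable
  ultimately have "integrable lborel (\<lambda>x. (indicator {s..t} x *\<^sub>R q x) * w x)"
  proof (rule Bochner_Integration.integrable_bound, intro AE_I2)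
    fix x
    show "norm ((indicator {s..t} x *\<^sub>R q x) * w x) \<le> norm (B *\<^sub>R (indicator {s..t} x *\<^sub>R q x))"
    proof (cases "x \<in> {s..t}")
      case True
      then have "norm (q x) * norm (w x) \<le> norm (q x) * \<bar>B\<bar>"
        using B[of x] by (intro mult_left_mono) auto
      then show ?thesis using True by (simp add: norm_mult mult.commute)
    qed auto
  qed
  then show ?thesis by (simp add: set_integrable_def)
qed

text \<open>Leibniz rule by Fubini: \<open>(u t - u s) * (w t - w s)\<close> is the integral of
  \<open>Q x * R y\<close> over the square, and the triangles on the two sides of the diagonal
  integrate to the two terms of the rule, up to contributions of the constants \<open>w s\<close>
  and \<open>u s\<close>.\<close>

lemma ac_deriv_mult:
  fixes u w :: "real \<Rightarrow> 'a::{real_normed_field, euclidean_space}"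
  assumes u: "ac_deriv u q" and w: "ac_deriv w r"
  shows "ac_deriv (\<lambda>x. u x * w x) (\<lambda>x. q x * w x + u x * r x)"
proof -
  note cu = ac_deriv_continuous[OF u] and cw = ac_deriv_continuous[OF w]
  have i1: "set_integrable lborel {s..t} (\<lambda>x. q x * w x)" for s t
    by (intro set_integrable_mult_continuous ac_derivD(1)[OF u] cw)
  have i2: "set_integrable lborel {s..t} (\<lambda>x. u x * r x)" for s t
    using set_integrable_mult_continuous[OF ac_derivD(1)[OF w] cu] by (simp add: mult.commute)
  have "(LINT x:{s..t}|lborel. q x * w x + u x * r x) = u t * w t - u s * w s" if st: "s \<le> t" for s t
  proof -
    define Q where "Q x = indicator {s..t} x *\<^sub>R q x" for x
    define R where "R x = indicator {s..t} x *\<^sub>R r x" for x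
    have iQ: "integrable lborel Q" and iR: "integrable lborel R"
      using ac_derivD(1)[OF u] ac_derivD(1)[OF w] by (auto simp: Q_def[abs_def] R_def[abs_def] set_integrable_def)
    have [measurable]: "Q \<in> borel_measurable borel" "R \<in> borel_measurable borel"
      using borel_measurable_integrable[OF iQ] borel_measurable_integrable[OF iR] by simp_all
    have prodint: "integrable (lborel \<Otimes>\<^sub>M lborel) (\<lambda>(x, y). Q x * R y)"
      using iQ iR by (intro lborel_pair.Fubini_integrable) (auto simp: norm_mult)
    have upper: "integrable (lborel \<Otimes>\<^sub>M lborel) (\<lambda>(x, y). indicator {y. y \<le> x} y *\<^sub>R (Q x * R y))"
      by (rule Bochner_Integration.integrable_bound[OF prodint])
         (auto simp: indicator_def intro!: measurable_If)
    have lower: "integrable (lborel \<Otimes>\<^sub>M lborel) (\<lambda>(x, y). indicator {x. x < y} x *\<^sub>R (Q x * R y))"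
      by (rule Bochner_Integration.integrable_bound[OF prodint])
         (auto simp: indicator_def intro!: measurable_If)
    \<comment> \<open>The strict inequality, which keeps the two triangles disjoint, costs only the
      null set \<open>{y}\<close>.\<close>
    have Qt: "(LBINT x. indicator {x. x < y} x *\<^sub>R Q x) = u y - u s" if "y \<in> {s..t}" for y
    proof -
      have "(LBINT x. indicator {x. x < y} x *\<^sub>R Q x) = (LBINT x. indicator {s..y} x *\<^sub>R q x)"
      proof (rule integral_cong_AE)
        show "AE x in lborel. indicator {x. x < y} x *\<^sub>R Q x = indicator {s..y} x *\<^sub>R q x"
          by (rule AE_mp[OF AE_lborel_singleton[of y]]) (use that in \<open>auto simp: Q_def indicator_def\<close>)
        show "(\<lambda>x. indicator {s..y} x *\<^sub>R q x) \<in> borel_measurable lborel"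
          using ac_derivD(1)[OF u, of s y] by (auto simp: set_integrable_def)
      qed simp
      then show ?thesis using ac_derivD(2)[OF u, of s y] that by (simp add: set_lebesgue_integral_def)
    qed
    have Rt: "(LBINT y. indicator {y. y \<le> x} y *\<^sub>R R y) = w x - w s" if "x \<in> {s..t}" for x
    proof -
      have "(LBINT y. indicator {y. y \<le> x} y *\<^sub>R R y) = (LBINT y. indicator {s..x} y *\<^sub>R r y)"
        using that by (intro Bochner_Integration.integral_cong) (auto simp: R_def indicator_def)
      then show ?thesis using ac_derivD(2)[OF w, of s x] that by (simp add: set_lebesgue_integral_def)
    qed
    have Qi: "(LBINT x. Q x) = u t - u s" and Ri: "(LBINT x. R x) = w t - w s"
      using ac_derivD(2)[OF u st] ac_derivD(2)[OF w st] by (simp_all add: Q_def R_def set_lebesgue_integral_def)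
    have "(u t - u s) * (w t - w s) = (LBINT x. (LBINT y. Q x * R y))"
      by (simp add: Qi Ri)
    also have "\<dots> = (\<integral>p. (\<lambda>(x, y). Q x * R y) p \<partial>(lborel \<Otimes>\<^sub>M lborel))"
      using lborel_pair.integral_fst'[OF prodint] by simp
    also have "\<dots> = (\<integral>p. (\<lambda>(x, y). indicator {y. y \<le> x} y *\<^sub>R (Q x * R y)) p +
         (\<lambda>(x, y). indicator {x. x < y} x *\<^sub>R (Q x * R y)) p \<partial>(lborel \<Otimes>\<^sub>M lborel))"
      by (intro Bochner_Integration.integral_cong) (auto simp: indicator_def)
    also have "\<dots> = (\<integral>p. (\<lambda>(x, y). indicator {y. y \<le> x} y *\<^sub>R (Q x * R y)) p \<partial>(lborel \<Otimes>\<^sub>M lborel)) +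
         (\<integral>p. (\<lambda>(x, y). indicator {x. x < y} x *\<^sub>R (Q x * R y)) p \<partial>(lborel \<Otimes>\<^sub>M lborel))"
      by (intro Bochner_Integration.integral_add upper lower)
    also have "(\<integral>p. (\<lambda>(x, y). indicator {y. y \<le> x} y *\<^sub>R (Q x * R y)) p \<partial>(lborel \<Otimes>\<^sub>M lborel)) =
        (LBINT x. (LBINT y. indicator {y. y \<le> x} y *\<^sub>R (Q x * R y)))"
      using lborel_pair.integral_fst'[OF upper] by simp
    also have "\<dots> = (LBINT x. Q x * (w x - w s))"
    proof (intro Bochner_Integration.integral_cong refl)
      fix x
      have "(LBINT y. indicator {y. y \<le> x} y *\<^sub>R (Q x * R y))
          = Q x * (LBINT y. indicator {y. y \<le> x} y *\<^sub>R R y)"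
        by (subst integral_mult_right_zero[symmetric]) (simp add: algebra_simps)
      also have "\<dots> = Q x * (w x - w s)" using Rt[of x] by (cases "x \<in> {s..t}") (auto simp: Q_def)
      finally show "(LBINT y. indicator {y. y \<le> x} y *\<^sub>R (Q x * R y)) = Q x * (w x - w s)" .
    qed
    also have "(\<integral>p. (\<lambda>(x, y). indicator {x. x < y} x *\<^sub>R (Q x * R y)) p \<partial>(lborel \<Otimes>\<^sub>M lborel)) =
        (LBINT y. (LBINT x. indicator {x. x < y} x *\<^sub>R (Q x * R y)))"
      using lborel_pair.integral_snd[OF lower] by simp
    also have "\<dots> = (LBINT y. (u y - u s) * R y)"
    proof (intro Bochner_Integration.integral_cong refl)
      fix y
      have "(LBINT x. indicator {x. x < y} x *\<^sub>R (Q x * R y))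
          = (LBINT x. indicator {x. x < y} x *\<^sub>R Q x) * R y"
        by (subst integral_mult_left_zero[symmetric]) (simp add: algebra_simps)
      also have "\<dots> = (u y - u s) * R y" using Qt[of y] by (cases "y \<in> {s..t}") (auto simp: R_def)
      finally show "(LBINT x. indicator {x. x < y} x *\<^sub>R (Q x * R y)) = (u y - u s) * R y" .
    qed
    finally have eq: "(u t - u s) * (w t - w s) = (LBINT x. Q x * (w x - w s)) + (LBINT y. (u y - u s) * R y)" .
    have j1: "integrable lborel (\<lambda>x. Q x * w x)" and j2: "integrable lborel (\<lambda>x. u x * R x)"
      using i1[of s t] i2[of s t] by (auto simp: set_integrable_def Q_def R_def)
    have "(LINT x:{s..t}|lborel. q x * w x + u x * r x) = (LBINT x. Q x * w x + u x * R x)"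
      unfolding set_lebesgue_integral_def
      by (intro Bochner_Integration.integral_cong) (auto simp: Q_def R_def scaleR_add_right)
    also have "\<dots> = (LBINT x. Q x * w x) + (LBINT x. u x * R x)"
      using j1 j2 by simp
    also have "(LBINT x. Q x * w x) = (LBINT x. Q x * (w x - w s)) + (u t - u s) * w s"
      using j1 iQ by (simp add: right_diff_distrib Qi)
    also have "(LBINT x. u x * R x) = (LBINT x. (u x - u s) * R x) + u s * (w t - w s)"
      using j2 iR by (simp add: left_diff_distrib Ri)
    finally have "(LINT x:{s..t}|lborel. q x * w x + u x * r x) = ((LBINT x. Q x * (w x - w s)) +
        (LBINT x. (u x - u s) * R x)) + (u t - u s) * w s + u s * (w t - w s)" by simp
    then show ?thesis unfolding eq[symmetric] by (simp add: algebra_simps)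
  qed
  then show ?thesis using i1 i2 by (auto simp: ac_deriv_def intro: set_integral_add)
qed

lemma ac_deriv_add:
  assumes "ac_deriv u q" "ac_deriv w r"
  shows "ac_deriv (\<lambda>x. u x + w x) (\<lambda>x. q x + r x)"
  using assms by (auto simp: ac_deriv_def set_integral_add)

lemma ac_deriv_bounded_linear:
  assumes "bounded_linear T" "ac_deriv u q"
  shows "ac_deriv (\<lambda>x. T (u x)) (\<lambda>x. T (q x))"
proof -
  interpret bounded_linear T by fact
  show ?thesis
    unfolding ac_deriv_def
  proof (intro conjI allI impI)
    fix s t :: real
    have int: "integrable lborel (\<lambda>x. indicator {s..t} x *\<^sub>R q x)"
      using ac_derivD(1)[OF assms(2)] by (simp add: set_integrable_def)
    show "set_integrable lborel {s..t} (\<lambda>x. T (q x))"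
      using integrable_bounded_linear[OF assms(1) int] by (simp add: set_integrable_def scaleR)
    assume "s \<le> t"
    show "(LINT x:{s..t}|lborel. T (q x)) = T (u t) - T (u s)"
      using integral_bounded_linear[OF assms(1) int] ac_derivD(2)[OF assms(2) \<open>s \<le> t\<close>]
      by (simp add: set_lebesgue_integral_def scaleR diff)
  qed
qed

lemma ac_deriv_C1:
  assumes "\<And>x. (u has_vector_derivative q x) (at x)" "continuous_on UNIV q"
  shows "ac_deriv u q"
  unfolding ac_deriv_def
proof (intro conjI allI impI)
  fix s t :: real
  show "set_integrable lborel {s..t} q"
    by (rule borel_integrable_atLeastAtMost') (rule continuous_on_subset[OF assms(2)], simp)
  assume "s \<le> t"
  then show "(LINT x:{s..t}|lborel. q x) = u t - u s"
    unfolding set_lebesgue_integral_def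
    using assms continuous_on_subset[OF assms(2)]
    by (intro integral_FTC_atLeastAtMost) (blast intro: has_vector_derivative_at_within)+
qed

text \<open>Lets a density be exchanged for an absolutely continuous version of it, so that a second
  derivative can be taken.\<close>

lemma ac_deriv_cong_AE:
  assumes "ac_deriv u q" "AE x in lborel. q x = r x" "r \<in> borel_measurable borel"
  shows "ac_deriv u r"
proof -
  have ae: "AE x in lborel. indicator {s..t} x *\<^sub>R q x = indicator {s..t} x *\<^sub>R r x" for s t
    using assms(2) by eventually_elim simp
  have m: "(\<lambda>x. indicator {s..t} x *\<^sub>R r x) \<in> borel_measurable lborel" for s t using assms(3) by measurable
  have q: "integrable lborel (\<lambda>x. indicator {s..t} x *\<^sub>R q x)" for s t
    using ac_derivD(1)[OF assms(1)] by (simp add: set_integrable_def)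
  show ?thesis unfolding ac_deriv_def set_integrable_def set_lebesgue_integral_def
  proof (intro conjI allI impI)
    fix s t :: real
    show "integrable lborel (\<lambda>x. indicator {s..t} x *\<^sub>R r x)"
      by (rule iffD1[OF integrable_cong_AE[OF borel_measurable_integrable[OF q] m ae] q])
    assume "s \<le> t"
    then show "(LBINT x. indicator {s..t} x *\<^sub>R r x) = u t - u s"
      using integral_cong_AE[OF borel_measurable_integrable[OF q] m ae] ac_derivD(2)[OF assms(1)]
      by (simp add: set_lebesgue_integral_def)
  qed
qed

lemma ac_deriv_of_integral:
  fixes q :: "real \<Rightarrow> 'a::{real_normed_field, euclidean_space}"
  assumes "\<And>s t. set_integrable lborel {s..t} q"
  shows "\<exists>u. ac_deriv u q \<and> u 0 = 0"
proof -
  define u where "u x = (if 0 \<le> x then (LINT y:{0..x}|lborel. q y) else - (LINT y:{x..0}|lborel. q y))" for x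
  have H: "(LINT y:{s..t}|lborel. q y) = integral {s..t} q" "q integrable_on {s..t}" for s t
    using set_borel_integral_eq_integral[OF assms] by auto
  have "u t - u s = (LINT x:{s..t}|lborel. q x)" if "s \<le> t" for s t
    using that Henstock_Kurzweil_Integration.integral_combine[of 0 s t q]
      Henstock_Kurzweil_Integration.integral_combine[of s 0 t q]
      Henstock_Kurzweil_Integration.integral_combine[of s t 0 q]
    by (auto simp: u_def H algebra_simps)
  moreover have "u 0 = 0" using H(1)[of 0 0] by (simp add: u_def)
  ultimately show ?thesis using assms unfolding ac_deriv_def by (intro exI[of _ u]) auto
qed

lemma ac_deriv_has_vector_derivative:
  assumes "ac_deriv u q" "continuous_on UNIV q"
  shows "(u has_vector_derivative q x) (at x)"
proof -
  have eq: "u y = u (x - 1) + integral {x - 1..y} q" if "y \<in> {x - 1..x + 1}" for y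
    using ac_derivD(2)[OF assms(1), of "x - 1" y] that
      set_borel_integral_eq_integral(2)[OF ac_derivD(1)[OF assms(1)], of "x - 1" y] by simp
  have "((\<lambda>y. integral {x - 1..y} q) has_vector_derivative q x) (at x within {x - 1..x + 1})"
    using continuous_on_subset[OF assms(2)] by (intro integral_has_vector_derivative) auto
  then have "((\<lambda>y. u (x - 1) + integral {x - 1..y} q) has_vector_derivative q x) (at x within {x - 1..x + 1})"
    by (auto intro!: derivative_eq_intros)
  then have "(u has_vector_derivative q x) (at x within {x - 1..x + 1})"
    by (rule has_vector_derivative_transform_within[OF _ zero_less_one]) (simp_all add: eq[symmetric])
  then show ?thesis by (subst (asm) at_within_Icc_at) auto
qed

section \<open>The a priori bound for integrable potentials\<close>

text \<open>An integrable function need not tend to 0 at infinity. It is still small at some pair of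
  opposite points arbitrarily far out, which is enough to drop boundary terms; otherwise its
  symmetrisation would stay above \<eta> on a half-line.\<close>

lemma integrable_vanishing_frequently:
  fixes \<phi> :: "real \<Rightarrow> real"
  assumes int: "integrable lborel \<phi>" and nn: "\<And>x. 0 \<le> \<phi> x" and "0 < \<eta>"
  shows "\<exists>y>R. \<phi> y + \<phi> (- y) < \<eta>"
proof (rule ccontr)
  assume "\<not> ?thesis"
  then have ge: "\<eta> \<le> \<phi> y + \<phi> (- y)" if "R < y" for y using that by (meson not_le)
  define \<psi> where "\<psi> y = \<phi> y + \<phi> (- y)" for y
  have int\<psi>: "integrable lborel \<psi>"
    using int lborel_integrable_real_affine[OF int, of "- 1" 0] by (simp add: \<psi>_def[abs_def])
  have "real n * \<eta> \<le> (LBINT y. \<psi> y)" for n :: nat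
  proof -
    have "real n * \<eta> = (LBINT y. indicator {R<..R + real n} y * \<eta>)" by simp
    also have "\<dots> \<le> (LBINT y. \<psi> y)"
    proof (rule integral_mono[OF _ int\<psi>])
      show "integrable lborel (\<lambda>y. indicator {R<..R + real n} y * \<eta>)"
        by (intro integrable_mult_left integrable_real_indicator) auto
      show "indicator {R<..R + real n} y * \<eta> \<le> \<psi> y" for y
        using ge[of y] nn[of y] nn[of "- y"] by (auto simp: \<psi>_def indicator_def)
    qed
    finally show ?thesis .
  qed
  moreover obtain n :: nat where "(LBINT y. \<psi> y) < real n * \<eta>"
    using reals_Archimedean3[OF \<open>0 < \<eta>\<close>] by blast
  ultimately show False by (meson not_le)
qed

text \<open>The integrals from \<open>- y n\<close> to \<open>y n\<close> are boundary terms that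
  tend to 0, and by dominated convergence they tend to the integral over the line.\<close>

lemma ac_deriv_integral_eq_0:
  assumes ac: "ac_deriv P g" and int: "integrable lborel g"
    and van: "\<And>\<eta> R. 0 < \<eta> \<Longrightarrow> \<exists>y>R. norm (P y) + norm (P (- y)) < \<eta>"
  shows "(LBINT x. g x) = 0"
proof -
  have "\<exists>y>real n. norm (P y) + norm (P (- y)) < inverse (real (Suc n))" for n
    by (rule van) simp
  then have "\<exists>y. \<forall>n. real n < y n \<and> norm (P (y n)) + norm (P (- y n)) < inverse (real (Suc n))"
    by (intro choice allI) blast
  then obtain y where y: "\<And>n. real n < y n" "\<And>n. norm (P (y n)) + norm (P (- y n)) < inverse (real (Suc n))"
    by blast
  have y0: "- y n \<le> y n" for n using y(1)[of n] by (simp add: less_le_trans order_less_imp_le)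
  have "(\<lambda>n. \<integral>x. indicator {- y n..y n} x *\<^sub>R g x \<partial>lborel) \<longlonglongrightarrow> (LBINT x. g x)"
  proof (rule integral_dominated_convergence[where w = "\<lambda>x. norm (g x)"])
    show "AE x in lborel. (\<lambda>n. indicator {- y n..y n} x *\<^sub>R g x) \<longlonglongrightarrow> g x"
    proof (rule AE_I2)
      fix x
      obtain N where N: "\<bar>x\<bar> < real N" using reals_Archimedean2 by blast
      have "indicator {- y n..y n} x *\<^sub>R g x = g x" if "n \<ge> N" for n
      proof -
        have "\<bar>x\<bar> < y n" using N y(1)[of n] that by (meson less_trans of_nat_le_iff order_less_le_trans)
        then show ?thesis by (auto simp: indicator_def)
      qed
      then show "(\<lambda>n. indicator {- y n..y n} x *\<^sub>R g x) \<longlonglongrightarrow> g x"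
        by (intro tendsto_eventually) (auto simp: eventually_sequentially)
    qed
  qed (use int in \<open>auto simp: indicator_def\<close>)
  moreover have "(LBINT x. indicator {- y n..y n} x *\<^sub>R g x) = P (y n) - P (- y n)" for n
    using ac_derivD(2)[OF ac y0] by (simp add: set_lebesgue_integral_def)
  moreover have "(\<lambda>n. P (y n) - P (- y n)) \<longlonglongrightarrow> 0"
  proof (rule Lim_null_comparison[OF _ LIMSEQ_inverse_real_of_nat])
    show "\<forall>\<^sub>F n in sequentially. norm (P (y n) - P (- y n)) \<le> inverse (real (Suc n))"
    proof (intro always_eventually allI)
      show "norm (P (y n) - P (- y n)) \<le> inverse (real (Suc n))" for n
        using norm_triangle_ineq4[of "P (y n)" "P (- y n)"] y(2)[of n] by linarith
    qed
  qed
  ultimately show ?thesis by (metis (no_types, lifting) LIMSEQ_unique ext)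
qed

lemma set_integral_norm_le:
  fixes g :: "real \<Rightarrow> real"
  assumes "integrable lborel g" "\<And>x. 0 \<le> g x"
  shows "(LINT x:{s..t}|lborel. g x) \<le> (LBINT x. g x)"
  unfolding set_lebesgue_integral_def
  using assms by (intro integral_mono integrable_mult_indicator) (auto simp: indicator_def)

lemma ac_deriv_mono_bound:
  fixes P g D :: "real \<Rightarrow> real"
  assumes ac: "ac_deriv P g" and "s \<le> t" and D: "set_integrable lborel {s..t} D"
    and le: "\<And>x. x \<in> {s..t} \<Longrightarrow> g x \<le> D x"
  shows "P t \<le> P s + (LINT x:{s..t}|lborel. D x)"
proof -
  have "(LINT x:{s..t}|lborel. g x) \<le> (LINT x:{s..t}|lborel. D x)"
    by (rule set_integral_mono[OF ac_derivD(1)[OF ac] D le])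
  then show ?thesis using ac_derivD(2)[OF ac \<open>s \<le> t\<close>] by simp
qed

lemma ac_deriv_uminus:
  assumes "ac_deriv u q"
  shows "ac_deriv (\<lambda>x. - u x) (\<lambda>x. - q x)"
  by (rule ac_deriv_bounded_linear[OF bounded_linear_minus[OF bounded_linear_ident] assms])

lemma ac_deriv_norm_square:
  fixes u q :: "real \<Rightarrow> complex"
  assumes "ac_deriv u q"
  shows "ac_deriv (\<lambda>x. (norm (u x))\<^sup>2) (\<lambda>x. 2 * Re (q x * cnj (u x)))"
proof -
  have "ac_deriv (\<lambda>x. u x * cnj (u x)) (\<lambda>x. q x * cnj (u x) + u x * cnj (q x))"
    by (intro ac_deriv_mult assms ac_deriv_bounded_linear[OF bounded_linear_cnj])
  then have "ac_deriv (\<lambda>x. Re (u x * cnj (u x))) (\<lambda>x. Re (q x * cnj (u x) + u x * cnj (q x)))"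
    by (rule ac_deriv_bounded_linear[OF bounded_linear_Re])
  moreover have "Re (u x * cnj (u x)) = (norm (u x))\<^sup>2" for x
    using complex_mult_cnj[of "u x"] by (simp add: cmod_power2)
  moreover have "Re (q x * cnj (u x) + u x * cnj (q x)) = 2 * Re (q x * cnj (u x))" for x
    by (simp add: algebra_simps)
  ultimately show ?thesis by simp
qed

lemma measurable_cnj [measurable]: "cnj \<in> borel_measurable borel"
  by (intro borel_measurable_continuous_onI continuous_intros)

lemma integrable_norm_mult:
  fixes u q :: "real \<Rightarrow> complex"
  assumes [measurable]: "u \<in> borel_measurable borel" "q \<in> borel_measurable borel"
    and u: "integrable lborel (\<lambda>x. (norm (u x))\<^sup>2)" and q: "integrable lborel (\<lambda>x. (norm (q x))\<^sup>2)"
  shows "integrable lborel (\<lambda>x. norm (u x) * norm (q x))"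
proof (rule Bochner_Integration.integrable_bound[OF Bochner_Integration.integrable_add[OF u q]])
  have "norm (u x) * norm (q x) \<le> (norm (u x))\<^sup>2 + (norm (q x))\<^sup>2" for x
  proof -
    have "0 \<le> norm (u x) * norm (q x)" by simp
    then show ?thesis using sum_squares_bound[of "norm (u x)" "norm (q x)"] by linarith
  qed
  then show "AE x in lborel. norm (norm (u x) * norm (q x)) \<le> norm ((norm (u x))\<^sup>2 + (norm (q x))\<^sup>2)"
    by (intro AE_I2) simp
qed simp

text \<open>Adding the integrals from both ends saves a factor \<open>2\<close>.\<close>

lemma norm_square_le_integral:
  fixes u q :: "real \<Rightarrow> complex"
  assumes ac: "ac_deriv u q" and q[measurable]: "q \<in> borel_measurable borel"
    and u2: "integrable lborel (\<lambda>x. (norm (u x))\<^sup>2)" and q2: "integrable lborel (\<lambda>x. (norm (q x))\<^sup>2)"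
  shows "(norm (u x))\<^sup>2 \<le> (LBINT y. norm (u y) * norm (q y))"
proof (rule field_le_epsilon)
  fix \<eta> :: real assume "0 < \<eta>"
  note [measurable] = ac_deriv_measurable[OF ac]
  note uq = integrable_norm_mult[OF _ q u2 q2]
  define P where "P x = (norm (u x))\<^sup>2" for x
  define g where "g x = 2 * Re (q x * cnj (u x))" for x
  define D where "D x = 2 * (norm (u x) * norm (q x))" for x
  have acP: "ac_deriv P g" unfolding P_def g_def by (rule ac_deriv_norm_square[OF ac])
  have D: "integrable lborel D" unfolding D_def using uq by simp
  have Ds: "set_integrable lborel {s..t} D" for s t
    unfolding set_integrable_def by (rule integrable_mult_indicator[OF _ D]) simp
  have g: "\<bar>g y\<bar> \<le> D y" for y
    using abs_Re_le_cmod[of "q y * cnj (u y)"] by (simp add: g_def D_def norm_mult mult.commute)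
  obtain y where y: "y > \<bar>x\<bar>" "P y + P (- y) < \<eta>"
    using integrable_vanishing_frequently[OF u2 _ \<open>0 < \<eta>\<close>] unfolding P_def by auto
  have "P x \<le> P (- y) + (LINT x:{- y..x}|lborel. D x)"
    by (rule ac_deriv_mono_bound[OF acP _ Ds]) (use y g in \<open>auto simp: abs_le_iff\<close>)
  moreover have "(LINT x:{- y..x}|lborel. D x) + (LINT x:{x..y}|lborel. D x) \<le> (LBINT y. D y)"
  proof -
    obtain w where w: "ac_deriv w D" using ac_deriv_of_integral[OF Ds] by blast
    have "(LINT x:{- y..x}|lborel. D x) + (LINT x:{x..y}|lborel. D x) = (LINT x:{- y..y}|lborel. D x)"
      using y ac_derivD(2)[OF w, of "- y" x] ac_derivD(2)[OF w, of x y] ac_derivD(2)[OF w, of "- y" y] by auto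
    also have "\<dots> \<le> (LBINT y. D y)"
      by (rule set_integral_norm_le[OF D]) (simp add: D_def)
    finally show ?thesis .
  qed
  moreover have "P x \<le> P y + (LINT x:{x..y}|lborel. D x)"
  proof -
    have "P x = P y - (LINT x:{x..y}|lborel. g x)" using ac_derivD(2)[OF acP, of x y] y by auto
    moreover have "(LINT x:{x..y}|lborel. - g x) \<le> (LINT x:{x..y}|lborel. D x)"
      by (rule set_integral_mono[OF ac_derivD(1)[OF ac_deriv_uminus[OF acP]] Ds])
         (use g in \<open>auto simp: abs_le_iff\<close>)
    ultimately show ?thesis by (simp add: set_lebesgue_integral_def)
  qed
  ultimately have "2 * P x \<le> \<eta> + (LBINT y. D y)" using y by linarith
  then show "(norm (u x))\<^sup>2 \<le> (LBINT y. norm (u y) * norm (q y)) + \<eta>"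
    using \<open>0 < \<eta>\<close> by (simp add: P_def D_def)
qed

text \<open>Origin of the factors: the exponential is the Gronwall factor with rate
  \<open>1 / (h * sqrt E)\<close>, the root stems from the part of the energy growth that is
  proportional to \<epsilon>, and one factor \<open>1 / sqrt E\<close> is the price of passing from
  the energy to \<open>u\<close>.\<close>

definition apriori_const :: "real \<Rightarrow> real \<Rightarrow> real \<Rightarrow> real" where
  "apriori_const h E T = exp (T / (h * sqrt E)) * (2 / (h * sqrt E)) * (1 + sqrt ((2 + 2 * E + T\<^sup>2 / h\<^sup>2) / E))"

text \<open>The energy obeys \<open>F' <= \<kappa> |v| F + D\<close>, where \<open>D\<close>
  contains the term \<open>2 \<epsilon> |u| |q|\<close>. Its integral is bounded independently of
  \<epsilon>, because pairing the equation with \<open>u\<close> bounds \<open>\<epsilon> I1\<close>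
  and \<open>\<epsilon> h^2 I2\<close> by multiples of \<open>N = L * s\<close>, and
  \<open>s\<close> is proportional to \<open>sqrt S\<close>. The result is
  \<open>S <= c * sqrt S\<close>, where \<open>sqrt S\<close> cancels.\<close>

theorem a_priori_bound:
  fixes u q f :: "real \<Rightarrow> complex" and v :: "real \<Rightarrow> real"
  assumes h: "0 < h" and E: "0 < E" and z: "Re z = E" "Im z \<noteq> 0" "\<bar>Im z\<bar> \<le> 1"
    and u: "ac_deriv u q"
    and q: "ac_deriv q (\<lambda>x. ((of_real (v x) - z) * u x - f x) / of_real (h\<^sup>2))"
    and u2: "integrable lborel (\<lambda>x. (norm (u x))\<^sup>2)" and q2: "integrable lborel (\<lambda>x. (norm (q x))\<^sup>2)"
    and bu: "\<And>x. norm (u x) \<le> Bu" and bq: "\<And>x. norm (q x) \<le> Bq"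
    and v: "continuous_on UNIV v" "integrable lborel v" "(LBINT x. \<bar>v x\<bar>) \<le> T"
    and f: "integrable lborel f"
  shows "norm (u x) \<le> apriori_const h E T * (LBINT y. norm (f y))"
proof -
  define \<epsilon> where "\<epsilon> = \<bar>Im z\<bar>"
  have eps: "0 < \<epsilon>" "\<epsilon> \<le> 1" using z by (auto simp: \<epsilon>_def)
  have T0: "0 \<le> T" using v(3) by (rule order_trans[rotated]) simp
  note [measurable] = ac_deriv_measurable[OF u] ac_deriv_measurable[OF q]
    borel_measurable_continuous_onI[OF v(1)]
  have [measurable]: "f \<in> borel_measurable borel" using f by simp
  define F where "F x = h\<^sup>2 * (norm (q x))\<^sup>2 + E * (norm (u x))\<^sup>2" for x
  \<comment> \<open>\<open>Bu\<close> and \<open>Bq\<close> make this supremum finite; they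
    disappear from the estimate when \<open>sqrt S\<close> is cancelled.\<close>
  define S where "S = (SUP x. F x)"
  have F0: "0 \<le> F x" for x using E by (simp add: F_def)
  have bdd: "bdd_above (range F)"
  proof (intro bdd_aboveI2)
    show "F x \<le> h\<^sup>2 * Bq\<^sup>2 + E * Bu\<^sup>2" for x
      unfolding F_def using bu[of x] bq[of x] E by (intro add_mono mult_left_mono power_mono) auto
  qed
  have FS: "F x \<le> S" for x unfolding S_def by (rule cSUP_upper[OF _ bdd]) simp
  have S0: "0 \<le> S" using F0[of 0] FS[of 0] by linarith
  define s where "s = sqrt S / sqrt E"
  have us: "norm (u x) \<le> s" for x
  proof -
    have "(sqrt E * norm (u x))\<^sup>2 \<le> S"
      using FS[of x] E by (simp add: F_def power_mult_distrib) (smt (verit) zero_le_power2 mult_nonneg_nonneg)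
    then have "sqrt E * norm (u x) \<le> sqrt S" by (rule real_le_rsqrt)
    then show ?thesis using E by (simp add: s_def field_simps)
  qed
  have qs: "norm (q x) \<le> sqrt S / h" for x
  proof -
    have "(h * norm (q x))\<^sup>2 \<le> S"
      using FS[of x] E by (simp add: F_def power_mult_distrib) (smt (verit) zero_le_power2 mult_nonneg_nonneg)
    then have "h * norm (q x) \<le> sqrt S" by (rule real_le_rsqrt)
    then show ?thesis using h by (simp add: field_simps)
  qed
  have s0: "0 \<le> s" using S0 E by (simp add: s_def)

  \<comment> \<open>The pairing identity and the terms proportional to epsilon\<close>
  define L where "L = (LBINT y. norm (f y))"
  have L0: "0 \<le> L" by (simp add: L_def)
  define N where "N = L * s"
  have N0: "0 \<le> N" using L0 s0 by (simp add: N_def)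
  define I1 where "I1 = (LBINT x. (norm (u x))\<^sup>2)"
  define I2 where "I2 = (LBINT x. (norm (q x))\<^sup>2)"
  have I0: "0 \<le> I1" "0 \<le> I2" by (auto simp: I1_def I2_def)
  note uq = integrable_norm_mult[OF _ _ u2 q2]
  define J where "J = (LBINT x. norm (u x) * norm (q x))"
  \<comment> \<open>With this pointwise bound the potential term costs \<open>T * J\<close>, so that
    only the mass of \<open>v\<close> enters.\<close>
  have uJ: "(norm (u x))\<^sup>2 \<le> J" for x
    unfolding J_def by (rule norm_square_le_integral[OF u _ u2 q2]) simp
  have vi: "integrable lborel (\<lambda>x. \<bar>v x\<bar>)" using v(2) by simp
  have iv: "integrable lborel (\<lambda>x. v x * (norm (u x))\<^sup>2)"
  proof (rule Bochner_Integration.integrable_bound[OF integrable_mult_left[OF vi, of J]])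
    show "AE x in lborel. norm (v x * (norm (u x))\<^sup>2) \<le> norm (\<bar>v x\<bar> * J)"
      using uJ by (intro AE_I2) (auto simp: abs_mult intro!: mult_left_mono order_trans[OF uJ])
  qed simp
  have iff: "integrable lborel (\<lambda>x. norm (f x) * norm (u x))"
  proof (rule Bochner_Integration.integrable_bound[OF integrable_mult_left[OF integrable_norm[OF f], of s]])
    show "AE x in lborel. norm (norm (f x) * norm (u x)) \<le> norm (norm (f x) * s)"
      using us s0 by (intro AE_I2) (auto simp: abs_mult intro!: mult_left_mono)
  qed simp
  have fN: "(LBINT x. norm (f x) * norm (u x)) \<le> N"
  proof -
    have "(LBINT x. norm (f x) * norm (u x)) \<le> (LBINT x. norm (f x) * s)"
      using iff us f by (intro integral_mono) (auto intro!: mult_left_mono)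
    then show ?thesis by (simp add: N_def L_def)
  qed
  have ifu: "integrable lborel (\<lambda>x. f x * cnj (u x))"
    by (rule Bochner_Integration.integrable_bound[OF iff]) (auto simp: norm_mult)
  define A where "A = (LBINT x. v x * (norm (u x))\<^sup>2)"
  define Z where "Z = (LBINT x. f x * cnj (u x))"
  have ZN: "norm Z \<le> N"
  proof -
    have "norm Z \<le> (LBINT x. norm (f x * cnj (u x)))" unfolding Z_def by (rule integral_norm_bound)
    then show ?thesis using fN by (simp add: norm_mult)
  qed
  \<comment> \<open>\<open>G\<close> is the density of \<open>h^2 q cnj u\<close>; that its integral
    vanishes is the pairing identity.\<close>
  define G where "G x = of_real (v x * (norm (u x))\<^sup>2) - z * of_real ((norm (u x))\<^sup>2) - f x * cnj (u x)
      + of_real (h\<^sup>2) * of_real ((norm (q x))\<^sup>2)" for x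
  have "(LBINT x. G x) = 0"
  proof (rule ac_deriv_integral_eq_0)
    have "ac_deriv (\<lambda>x. of_real (h\<^sup>2) * (q x * cnj (u x)))
       (\<lambda>x. of_real (h\<^sup>2) * (((of_real (v x) - z) * u x - f x) / of_real (h\<^sup>2) * cnj (u x) + q x * cnj (q x)))"
      by (intro ac_deriv_bounded_linear[OF bounded_linear_mult_right] ac_deriv_mult q
            ac_deriv_bounded_linear[OF bounded_linear_cnj] u)
    moreover have "of_real (h\<^sup>2) * (((of_real (v x) - z) * u x - f x) / of_real (h\<^sup>2) * cnj (u x) + q x * cnj (q x)) = G x" for x
    proof -
      have "q x * cnj (q x) = of_real ((norm (q x))\<^sup>2)" "u x * cnj (u x) = of_real ((norm (u x))\<^sup>2)"
        by (simp_all only: complex_norm_square)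
      then show ?thesis using h by (simp add: G_def field_simps)
    qed
    ultimately show "ac_deriv (\<lambda>x. of_real (h\<^sup>2) * (q x * cnj (u x))) G" by simp
    show "integrable lborel G"
      unfolding G_def using iv u2 q2 ifu
      by (intro Bochner_Integration.integrable_add Bochner_Integration.integrable_diff integrable_mult_right
          integrable_of_real)
    fix \<eta> R :: real assume eta: "0 < \<eta>"
    have "\<exists>y>R. (\<lambda>x. h\<^sup>2 * (norm (u x) * norm (q x))) y + (\<lambda>x. h\<^sup>2 * (norm (u x) * norm (q x))) (- y) < \<eta>"
      using uq by (intro integrable_vanishing_frequently eta) auto
    then show "\<exists>y>R. norm (of_real (h\<^sup>2) * (q y * cnj (u y))) + norm (of_real (h\<^sup>2) * (q (- y) * cnj (u (- y)))) < \<eta>"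
      by (simp add: norm_mult norm_power mult.commute)
  qed
  moreover have "(LBINT x. G x) = of_real A - z * of_real I1 - Z + of_real (h\<^sup>2) * of_real I2"
  proof -
    have c: "complex_integrable lborel (\<lambda>x. of_real (v x * (norm (u x))\<^sup>2))"
      "complex_integrable lborel (\<lambda>x. z * of_real ((norm (u x))\<^sup>2))"
      "complex_integrable lborel (\<lambda>x. of_real (h\<^sup>2) * of_real ((norm (q x))\<^sup>2))"
      by (intro integrable_mult_right integrable_of_real iv u2 q2)+
    show ?thesis
      unfolding G_def A_def I1_def Z_def I2_def
      by (simp only: c ifu Bochner_Integration.integral_add Bochner_Integration.integral_diff
          Bochner_Integration.integrable_diff integral_mult_right_zero integral_complex_of_real)
  qed
  ultimately have eq: "of_real A - z * of_real I1 - Z + of_real (h\<^sup>2) * of_real I2 = 0" by simp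
  \<comment> \<open>The imaginary part controls \<open>\<epsilon> I1\<close>, and then the real part controls \<open>\<epsilon> h\<^sup>2 I2\<close>.\<close>
  have Imeq: "Im z * I1 = - Im Z" using arg_cong[OF eq, of Im] by simp
  have Reeq: "h\<^sup>2 * I2 = E * I1 + Re Z - A" using arg_cong[OF eq, of Re] z by simp
  have e1: "\<epsilon> * I1 \<le> N"
  proof -
    have "\<epsilon> * I1 = \<bar>Im Z\<bar>" using Imeq I0 by (metis \<epsilon>_def abs_minus abs_mult abs_of_nonneg)
    then show ?thesis using abs_Im_le_cmod[of Z] ZN by linarith
  qed
  have AT: "\<bar>A\<bar> \<le> T * J"
  proof -
    have "\<bar>A\<bar> \<le> (LBINT x. \<bar>v x * (norm (u x))\<^sup>2\<bar>)" unfolding A_def by (rule integral_abs_bound)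
    also have "\<dots> \<le> (LBINT x. \<bar>v x\<bar> * J)"
      using integrable_abs[OF iv] vi uJ by (intro integral_mono) (auto simp: abs_mult intro!: mult_left_mono)
    also have "\<dots> \<le> T * J"
      using v(3) uJ[of 0] by (simp add: mult_right_mono order_trans[OF zero_le_power2])
    finally show ?thesis .
  qed
  \<comment> \<open>AM-GM with free weights, integrated. The premise asks only that the quadratic
    form dominates, so each use can choose its own weights.\<close>
  have young: "c * J \<le> (a * I1 + b * I2) / 2" if "\<And>t r. 2 * c * (t * r) \<le> a * t\<^sup>2 + b * r\<^sup>2" for a b c :: real
  proof -
    have "2 * c * J = (LBINT x. 2 * c * (norm (u x) * norm (q x)))" by (simp add: J_def)
    also have "\<dots> \<le> (LBINT x. a * (norm (u x))\<^sup>2 + b * (norm (q x))\<^sup>2)"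
      using u2 q2 uq that by (intro integral_mono) auto
    also have "\<dots> = a * I1 + b * I2" using u2 q2 by (simp add: I1_def I2_def)
    finally show ?thesis by simp
  qed
  define B where "B = 2 + 2 * E + T\<^sup>2 / h\<^sup>2"
  have Bpos: "0 < B" using E by (simp add: B_def add_pos_nonneg)
  have TJ: "2 * (T * J) \<le> T\<^sup>2 / h\<^sup>2 * I1 + h\<^sup>2 * I2"
  proof -
    have "T * J \<le> (T\<^sup>2 / h\<^sup>2 * I1 + h\<^sup>2 * I2) / 2"
    proof (rule young)
      fix t r :: real
      show "2 * T * (t * r) \<le> T\<^sup>2 / h\<^sup>2 * t\<^sup>2 + h\<^sup>2 * r\<^sup>2"
        using sum_squares_bound[of "T / h * t" "h * r"] h
        by (simp add: power_mult_distrib power_divide mult_ac)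
    qed
    then show ?thesis by simp
  qed
  have e2: "\<epsilon> * (h\<^sup>2 * I2) \<le> B * N"
  proof -
    have "h\<^sup>2 * I2 \<le> E * I1 + N + T * J" using Reeq AT ZN abs_Re_le_cmod[of Z] by linarith
    \<comment> \<open>By \<open>TJ\<close> the right-hand side contains half of
      \<open>h^2 I2\<close>, which is absorbed on the left; this doubles the other terms.\<close>
    then have "h\<^sup>2 * I2 \<le> 2 * E * I1 + 2 * N + T\<^sup>2 / h\<^sup>2 * I1" using TJ by linarith
    then have "\<epsilon> * (h\<^sup>2 * I2) \<le> \<epsilon> * (2 * E * I1 + 2 * N + T\<^sup>2 / h\<^sup>2 * I1)"
      using eps by (intro mult_left_mono) auto
    also have "\<dots> = (2 * E + T\<^sup>2 / h\<^sup>2) * (\<epsilon> * I1) + \<epsilon> * (2 * N)" by (simp add: algebra_simps)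
    \<comment> \<open>Here \<epsilon> is at most 1, and the summands of \<open>B\<close> come
      together: \<open>2 * E + T^2 / h^2\<close> from \<open>I1\<close>, and \<open>2\<close> from
      the source.\<close>
    also have "\<dots> \<le> (2 * E + T\<^sup>2 / h\<^sup>2) * N + 1 * (2 * N)"
      using e1 eps E N0 by (intro add_mono mult_left_mono mult_right_mono) auto
    finally show ?thesis by (simp add: B_def algebra_simps)
  qed
  have eJ: "2 * \<epsilon> * J \<le> 2 * sqrt B / h * N"
  proof -
    \<comment> \<open>The weight that balances the two contributions: \<open>\<gamma> * N\<close>
      and \<open>B * N / (\<gamma> * h^2)\<close> become equal.\<close>
    define \<gamma> where "\<gamma> = sqrt B / h"
    have g: "0 < \<gamma>" using Bpos h by (simp add: \<gamma>_def)
    have "1 * J \<le> (\<gamma> * I1 + inverse \<gamma> * I2) / 2"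
    proof (rule young)
      fix t r :: real
      have "2 * (sqrt \<gamma> * t) * (r / sqrt \<gamma>) \<le> (sqrt \<gamma> * t)\<^sup>2 + (r / sqrt \<gamma>)\<^sup>2" by (rule sum_squares_bound)
      then show "2 * 1 * (t * r) \<le> \<gamma> * t\<^sup>2 + inverse \<gamma> * r\<^sup>2"
        using g by (simp add: power_mult_distrib power_divide field_simps)
    qed
    then have "2 * \<epsilon> * J \<le> \<epsilon> * (\<gamma> * I1 + inverse \<gamma> * I2)"
      using eps by (simp add: mult.assoc)
    also have "\<dots> = \<gamma> * (\<epsilon> * I1) + inverse \<gamma> * (\<epsilon> * (h\<^sup>2 * I2)) / h\<^sup>2"
      using h by (simp add: field_simps)
    also have "\<dots> \<le> \<gamma> * N + inverse \<gamma> * (B * N) / h\<^sup>2"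
      using e1 e2 g by (intro add_mono mult_left_mono divide_right_mono) auto
    also have "inverse \<gamma> * (B * N) / h\<^sup>2 = \<gamma> * N"
    proof -
      have "B = sqrt B * sqrt B" using Bpos by simp
      then have "inverse \<gamma> * (B * N) / h\<^sup>2 = inverse \<gamma> * (sqrt B * sqrt B * N) / h\<^sup>2" by simp
      also have "\<dots> = \<gamma> * N" using h Bpos by (simp add: \<gamma>_def field_simps power2_eq_square)
      finally show ?thesis .
    qed
    finally show ?thesis by (simp add: \<gamma>_def mult_ac)
  qed

  \<comment> \<open>Gronwall's inequality for the energy\<close>
  define \<kappa> where "\<kappa> = 1 / (h * sqrt E)"
  have k0: "0 < \<kappa>" using h E by (simp add: \<kappa>_def)
  define D where "D x = 2 * \<epsilon> * (norm (u x) * norm (q x)) + 2 * (norm (f x) * norm (q x))" for x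
  have ifq: "integrable lborel (\<lambda>x. norm (f x) * norm (q x))"
  proof (rule Bochner_Integration.integrable_bound[OF integrable_mult_left[OF integrable_norm[OF f], of "sqrt S / h"]])
    show "AE x in lborel. norm (norm (f x) * norm (q x)) \<le> norm (norm (f x) * (sqrt S / h))"
    proof (rule AE_I2)
      fix x
      have "norm (f x) * norm (q x) \<le> norm (f x) * (sqrt S / h)" by (rule mult_left_mono[OF qs]) simp
      then show "norm (norm (f x) * norm (q x)) \<le> norm (norm (f x) * (sqrt S / h))"
        using h S0 by (simp add: abs_mult)
    qed
  qed simp
  have D: "integrable lborel D" unfolding D_def using uq ifq by simp
  have D0: "0 \<le> D x" for x using eps by (simp add: D_def)
  have intD: "(LBINT x. D x) \<le> 2 * sqrt B / h * N + 2 * (L * (sqrt S / h))"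
  proof -
    have "(LBINT x. norm (f x) * norm (q x)) \<le> (LBINT x. norm (f x) * (sqrt S / h))"
      using ifq qs f by (intro integral_mono) (auto intro!: mult_left_mono simp del: times_divide_eq_right)
    also have "\<dots> = L * (sqrt S / h)" by (simp add: L_def)
    finally show ?thesis using eJ uq ifq by (simp add: D_def J_def)
  qed
  \<comment> \<open>Since \<open>v\<close> is continuous, this primitive is differentiable
    everywhere and \<open>exp (- \<Lambda>)\<close> is a classical integrating factor.\<close>
  obtain \<Lambda> where \<Lambda>: "ac_deriv \<Lambda> (\<lambda>x. \<kappa> * \<bar>v x\<bar>)"
  proof -
    have "set_integrable lborel {s..t} (\<lambda>x. \<kappa> * \<bar>v x\<bar>)" for s t
      unfolding set_integrable_def by (rule integrable_mult_indicator) (use vi in auto)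
    then show ?thesis using ac_deriv_of_integral that by blast
  qed
  have \<Lambda>le: "\<Lambda> x - \<Lambda> y \<le> \<kappa> * T" and \<Lambda>mono: "\<Lambda> y \<le> \<Lambda> x" if "y \<le> x" for x y
  proof -
    have eq: "\<Lambda> x - \<Lambda> y = (LINT x:{y..x}|lborel. \<kappa> * \<bar>v x\<bar>)" using ac_derivD(2)[OF \<Lambda> that] by simp
    also have "\<dots> \<le> (LBINT x. \<kappa> * \<bar>v x\<bar>)"
      using vi k0 by (intro set_integral_norm_le) auto
    also have "\<dots> \<le> \<kappa> * T" using v(3) k0 by simp
    finally show "\<Lambda> x - \<Lambda> y \<le> \<kappa> * T" .
    have "0 \<le> (LINT x:{y..x}|lborel. \<kappa> * \<bar>v x\<bar>)"
      unfolding set_lebesgue_integral_def using k0 by (intro integral_nonneg_AE) auto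
    then show "\<Lambda> y \<le> \<Lambda> x" using eq by simp
  qed
  define w where "w x = exp (- \<Lambda> x)" for x
  have w: "ac_deriv w (\<lambda>x. - (\<kappa> * \<bar>v x\<bar>) * w x)"
  proof (rule ac_deriv_C1)
    have cv: "continuous_on UNIV (\<lambda>x. \<kappa> * \<bar>v x\<bar>)" by (intro continuous_intros v(1))
    show "(w has_vector_derivative - (\<kappa> * \<bar>v x\<bar>) * w x) (at x)" for x
      unfolding w_def has_real_derivative_iff_has_vector_derivative[symmetric]
      by (rule derivative_eq_intros ac_deriv_has_vector_derivative[OF \<Lambda> cv, folded has_real_derivative_iff_has_vector_derivative] refl)+ simp
    show "continuous_on UNIV (\<lambda>x. - (\<kappa> * \<bar>v x\<bar>) * w x)"
      unfolding w_def by (intro continuous_intros v(1) ac_deriv_continuous[OF \<Lambda>])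
  qed
  define F' where "F' x = h\<^sup>2 * (2 * Re (((of_real (v x) - z) * u x - f x) / of_real (h\<^sup>2) * cnj (q x)))
      + E * (2 * Re (q x * cnj (u x)))" for x
  have FF: "ac_deriv F F'"
    unfolding F_def F'_def
    by (intro ac_deriv_add ac_deriv_bounded_linear[OF bounded_linear_mult_right] ac_deriv_norm_square u q)
  have F'le: "F' x \<le> \<kappa> * \<bar>v x\<bar> * F x + D x" for x
  proof -
    \<comment> \<open>The summand \<open>E |u|^2\<close> of the energy cancels the real part of
      \<open>z\<close>; only the imaginary part, of size \<epsilon>, survives.\<close>
    have "F' x = 2 * Re (((of_real (v x) - \<i> * of_real (Im z)) * u x - f x) * cnj (q x))"
    proof -
      have "h\<^sup>2 * Re (((of_real (v x) - z) * u x - f x) / of_real (h\<^sup>2) * cnj (q x))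
          = Re (of_real (h\<^sup>2) * (((of_real (v x) - z) * u x - f x) / of_real (h\<^sup>2) * cnj (q x)))"
        by (simp only: Re_complex_of_real Im_complex_of_real times_complex.sel mult_zero_left diff_zero)
      also have "of_real (h\<^sup>2) * (((of_real (v x) - z) * u x - f x) / of_real (h\<^sup>2) * cnj (q x))
          = ((of_real (v x) - z) * u x - f x) * cnj (q x)"
        using h by simp
      finally have "h\<^sup>2 * Re (((of_real (v x) - z) * u x - f x) / of_real (h\<^sup>2) * cnj (q x))
          = Re (((of_real (v x) - z) * u x - f x) * cnj (q x))" .
      moreover have "Re (q x * cnj (u x)) = Re (u x * cnj (q x))" by simp
      moreover have "Re (((of_real (v x) - z) * u x - f x) * cnj (q x) + of_real E * (u x * cnj (q x)))
          = Re (((of_real (v x) - z) * u x - f x) * cnj (q x)) + E * Re (u x * cnj (q x))" by simp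
      \<comment> \<open>The arithmetic is done over abstract reals, which protects the complex
        products from being expanded.\<close>
      moreover have "\<And>H R A B C X :: real. H * R = A \<Longrightarrow> C = B \<Longrightarrow> X = A + E * B \<Longrightarrow> H * (2 * R) + E * (2 * C) = 2 * X"
        by (auto simp: algebra_simps)
      ultimately have a: "F' x = 2 * Re (((of_real (v x) - z) * u x - f x) * cnj (q x) + of_real E * (u x * cnj (q x)))"
        unfolding F'_def by blast
      have zeq: "\<i> * of_real (Im z) = z - of_real E" using z(1) by (simp add: complex_eq_iff)
      show ?thesis unfolding a zeq by (rule arg_cong[of _ _ "\<lambda>w. 2 * Re w"]) (simp add: algebra_simps)
    qed
    also have "\<dots> \<le> 2 * (norm ((of_real (v x) - \<i> * of_real (Im z)) * u x - f x) * norm (q x))"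
      using complex_Re_le_cmod[of "((of_real (v x) - \<i> * of_real (Im z)) * u x - f x) * cnj (q x)"]
      by (simp add: norm_mult)
    also have "\<dots> \<le> 2 * (((\<bar>v x\<bar> + \<epsilon>) * norm (u x) + norm (f x)) * norm (q x))"
    proof -
      have "norm ((of_real (v x) - \<i> * of_real (Im z)) * u x - f x)
          \<le> norm (of_real (v x) - \<i> * of_real (Im z)) * norm (u x) + norm (f x)"
        by (metis norm_mult norm_triangle_ineq4)
      also have "norm (of_real (v x) - \<i> * of_real (Im z)) \<le> \<bar>v x\<bar> + \<epsilon>"
        using norm_triangle_ineq4[of "of_real (v x) :: complex" "\<i> * of_real (Im z)"]
        by (simp add: \<epsilon>_def norm_mult)
      finally show ?thesis by (intro mult_left_mono mult_right_mono) (auto simp: mult_right_mono)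
    qed
    also have "\<dots> = \<bar>v x\<bar> * (2 * (norm (u x) * norm (q x))) + D x" by (simp add: D_def algebra_simps)
    \<comment> \<open>AM-GM for \<open>sqrt E |u|\<close> and \<open>h |q|\<close> produces the rate
      \<kappa>.\<close>
    also have "\<dots> \<le> \<bar>v x\<bar> * (\<kappa> * F x) + D x"
    proof -
      have "2 * (sqrt E * norm (u x)) * (h * norm (q x)) \<le> F x"
        using sum_squares_bound[of "sqrt E * norm (u x)" "h * norm (q x)"] E
        by (simp add: F_def power_mult_distrib add.commute)
      then have "2 * (norm (u x) * norm (q x)) \<le> \<kappa> * F x"
        using h E by (simp add: \<kappa>_def field_simps)
      then show ?thesis by (intro add_mono mult_left_mono) auto
    qed
    finally show ?thesis by (simp add: mult_ac)
  qed
  have gronwall: "F x \<le> exp (\<kappa> * T) * (LBINT y. D y)" for x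
  proof -
    \<comment> \<open>Integration from the left end \<open>y\<close>. The integrating factor
      decreases, so in the source term it is replaced by its value at \<open>y\<close>.\<close>
    have key: "F x \<le> exp (\<kappa> * T) * (F y + (LBINT y. D y))" if "y \<le> x" for y
    proof -
      have Dw: "set_integrable lborel {y..x} (\<lambda>t. w y * D t)"
        unfolding set_integrable_def by (rule integrable_mult_indicator) (use D in auto)
      have "F x * w x \<le> F y * w y + (LINT t:{y..x}|lborel. w y * D t)"
      proof (rule ac_deriv_mono_bound[OF ac_deriv_mult[OF FF w] that Dw])
        fix t assume t: "t \<in> {y..x}"
        have "F' t * w t + F t * (- (\<kappa> * \<bar>v t\<bar>) * w t) = (F' t - \<kappa> * \<bar>v t\<bar> * F t) * w t"
          by (simp add: algebra_simps)
        also have "\<dots> \<le> D t * w t" using F'le[of t] by (intro mult_right_mono) (auto simp: w_def)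
        also have "\<dots> \<le> D t * w y" using \<Lambda>mono[of y t] t D0[of t] by (intro mult_left_mono) (auto simp: w_def)
        finally show "F' t * w t + F t * (- (\<kappa> * \<bar>v t\<bar>) * w t) \<le> w y * D t" by (simp add: mult.commute)
      qed
      also have "(LINT t:{y..x}|lborel. w y * D t) \<le> (LBINT t. w y * D t)"
        using D D0 by (intro set_integral_norm_le) (auto simp: w_def)
      finally have "F x * w x \<le> w y * (F y + (LBINT y. D y))" by (simp add: algebra_simps)
      then have "F x \<le> (w y / w x) * (F y + (LBINT y. D y))" by (simp add: w_def field_simps)
      also have "\<dots> \<le> exp (\<kappa> * T) * (F y + (LBINT y. D y))"
      proof (rule mult_right_mono)
        have "w y / w x = exp (\<Lambda> x - \<Lambda> y)" by (simp add: w_def exp_minus exp_diff field_simps)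
        then show "w y / w x \<le> exp (\<kappa> * T)" using \<Lambda>le[OF that] by simp
        show "0 \<le> F y + (LBINT y. D y)" using F0[of y] D0 by (simp add: add_nonneg_nonneg)
      qed
      finally show ?thesis .
    qed
    show ?thesis
    proof (rule field_le_epsilon)
      fix \<eta> :: real assume "0 < \<eta>"
      \<comment> \<open>\<open>F\<close> is integrable, hence small at points \<open>- y\<close>
        arbitrarily far to the left, and the initial value disappears.\<close>
      have "integrable lborel F" unfolding F_def using u2 q2 by simp
      then obtain y where y: "y > \<bar>x\<bar>" "F y + F (- y) < \<eta> / exp (\<kappa> * T)"
        using integrable_vanishing_frequently[of F "\<eta> / exp (\<kappa> * T)" "\<bar>x\<bar>"] F0 \<open>0 < \<eta>\<close> by auto
      then have "F (- y) \<le> \<eta> / exp (\<kappa> * T)" using F0[of y] by linarith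
      then have "exp (\<kappa> * T) * F (- y) \<le> \<eta>" by (simp add: field_simps)
      then show "F x \<le> exp (\<kappa> * T) * (LBINT y. D y) + \<eta>"
        using key[of "- y"] y by (simp add: algebra_simps abs_less_iff)
    qed
  qed
  \<comment> \<open>Both parts of the bound for the integral of \<open>D\<close> are linear in
    \<open>sqrt S\<close>; \<open>c\<close> collects their coefficients.\<close>
  define c where "c = exp (\<kappa> * T) * (2 / h) * (1 + sqrt (B / E)) * L"
  have "F x \<le> c * sqrt S" for x
  proof -
    have "F x \<le> exp (\<kappa> * T) * (2 * sqrt B / h * N + 2 * (L * (sqrt S / h)))"
      using gronwall[of x] intD by (meson exp_ge_zero mult_left_mono order_trans)
    also have "\<dots> = c * sqrt S"
      using h E by (simp add: c_def N_def s_def real_sqrt_divide field_simps)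
    finally show ?thesis .
  qed
  then have "S \<le> c * sqrt S" unfolding S_def by (intro cSUP_least) auto
  have "sqrt S \<le> c"
  proof (cases "S = 0")
    case True
    then show ?thesis using L0 h Bpos E by (simp add: c_def)
  next
    case False
    then have "0 < sqrt S" using S0 by simp
    moreover have "sqrt S * sqrt S \<le> c * sqrt S" using \<open>S \<le> c * sqrt S\<close> S0 by simp
    ultimately show ?thesis by (simp only: mult_le_cancel_right_pos)
  qed
  then have "s \<le> c / sqrt E" using E by (simp add: s_def divide_right_mono)
  also have "c / sqrt E = apriori_const h E T * L"
    using h E by (simp add: c_def apriori_const_def B_def \<kappa>_def)
  finally show ?thesis using us[of x] by (simp add: L_def)
qed

section \<open>Test functions\<close>

definition smooth :: "(real \<Rightarrow> complex) \<Rightarrow> bool" where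
  "smooth f \<longleftrightarrow> (\<forall>n x. (vderiv ^^ n) f differentiable (at x))"

text \<open>Smoothness is a condition on all iterates of \<open>vderiv\<close>, so it suffices to
  exhibit a class of differentiable functions closed under \<open>vderiv\<close>.\<close>

lemma smooth_coinduct:
  assumes "P f" and step: "\<And>f. P f \<Longrightarrow> (\<forall>x. f differentiable (at x)) \<and> P (vderiv f)"
  shows "smooth f"
proof -
  have "P ((vderiv ^^ n) f)" for n
    by (induction n) (use assms in auto)
  then show ?thesis using step by (auto simp: smooth_def)
qed

lemma smooth_vderiv: "smooth f \<Longrightarrow> smooth (vderiv f)"
  unfolding smooth_def by (metis comp_apply funpow_Suc_right)

lemma smooth_has_vector_derivative:
  assumes "smooth f"
  shows "(f has_vector_derivative vderiv f x) (at x)"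
  using assms[unfolded smooth_def, rule_format, of 0 x]
  by (simp add: vderiv_def vector_derivative_works)

lemma vderiv_eqI:
  assumes "\<And>x. (f has_vector_derivative g x) (at x)"
  shows "vderiv f = g"
  using vector_derivative_at[OF assms] by (auto simp: vderiv_def)

lemma smooth_primitive:
  assumes "\<And>x. (f has_vector_derivative g x) (at x)" "smooth g"
  shows "smooth f"
proof (rule smooth_coinduct[where P = "\<lambda>k. smooth k \<or> (\<forall>x. (k has_vector_derivative g x) (at x))"])
  fix k assume "smooth k \<or> (\<forall>x. (k has_vector_derivative g x) (at x))"
  then show "(\<forall>x. k differentiable (at x)) \<and> (smooth (vderiv k) \<or> (\<forall>x. (vderiv k has_vector_derivative g x) (at x)))"
  proof
    assume "smooth k"
    then show ?thesis using smooth_vderiv[of k] smooth_has_vector_derivative[of k]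
      by (meson differentiableI_vector)
  next
    assume k: "\<forall>x. (k has_vector_derivative g x) (at x)"
    then have "vderiv k = g" by (intro vderiv_eqI) auto
    then show ?thesis using assms(2) k by (meson differentiableI_vector)
  qed
qed (use assms in blast)

lemma smooth_linear_combination:
  assumes "smooth f" "smooth g"
  shows "smooth (\<lambda>x. c * f (a * x + b) + d * g x)"
\<comment> \<open>The coefficient \<open>c\<close> must vary within the class, because each
  derivative of the rescaled summand brings out a factor \<open>a\<close>.\<close>
proof (rule smooth_coinduct[where P = "\<lambda>k. \<exists>f g c. smooth f \<and> smooth g \<and> k = (\<lambda>x. c * f (a * x + b) + d * g x)"])
  fix k assume "\<exists>f g c. smooth f \<and> smooth g \<and> k = (\<lambda>x. c * f (a * x + b) + d * g x)"
  then obtain f g c where fg: "smooth f" "smooth g" and k: "k = (\<lambda>x. c * f (a * x + b) + d * g x)" by blast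
  have d: "(k has_vector_derivative (c * of_real a) * vderiv f (a * x + b) + d * vderiv g x) (at x)" for x
  proof -
    have "((\<lambda>x. a * x + b) has_real_derivative a) (at x)" by (auto intro!: derivative_eq_intros)
    then have "((f \<circ> (\<lambda>x. a * x + b)) has_vector_derivative (a *\<^sub>R vderiv f (a * x + b))) (at x)"
      by (intro vector_diff_chain_at smooth_has_vector_derivative fg)
        (simp add: has_real_derivative_iff_has_vector_derivative)
    then have "((\<lambda>x. f (a * x + b)) has_vector_derivative (a *\<^sub>R vderiv f (a * x + b))) (at x)"
      by (simp add: o_def)
    then show ?thesis unfolding k
      by (auto intro!: derivative_eq_intros smooth_has_vector_derivative fg simp: scaleR_conv_of_real)
  qed
  then have "vderiv k = (\<lambda>x. (c * of_real a) * vderiv f (a * x + b) + d * vderiv g x)" by (rule vderiv_eqI)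
  then show "(\<forall>x. k differentiable (at x)) \<and>
      (\<exists>f g c. smooth f \<and> smooth g \<and> vderiv k = (\<lambda>x. c * f (a * x + b) + d * g x))"
    using d smooth_vderiv[OF fg(1)] smooth_vderiv[OF fg(2)] by (meson differentiableI_vector)
qed (use assms in blast)

lemma test_function_iff:
  "test_function \<phi> \<longleftrightarrow> smooth \<phi> \<and> (\<exists>R. \<forall>x. R < \<bar>x\<bar> \<longrightarrow> \<phi> x = 0)"
proof -
  have "bounded {x. \<phi> x \<noteq> 0} \<longleftrightarrow> (\<exists>R. \<forall>x. R < \<bar>x\<bar> \<longrightarrow> \<phi> x = 0)"
  proof
    assume "bounded {x. \<phi> x \<noteq> 0}"
    then obtain R where "\<And>x. \<phi> x \<noteq> 0 \<Longrightarrow> \<bar>x\<bar> \<le> R" by (auto simp: bounded_iff)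
    then show "\<exists>R. \<forall>x. R < \<bar>x\<bar> \<longrightarrow> \<phi> x = 0" by (meson not_le)
  next
    assume "\<exists>R. \<forall>x. R < \<bar>x\<bar> \<longrightarrow> \<phi> x = 0"
    then obtain R where "\<And>x. R < \<bar>x\<bar> \<Longrightarrow> \<phi> x = 0" by blast
    then have "\<bar>x\<bar> \<le> R" if "\<phi> x \<noteq> 0" for x using that by (meson not_le)
    then show "bounded {x. \<phi> x \<noteq> 0}" by (auto simp: bounded_iff)
  qed
  then have "compact (closure {x. \<phi> x \<noteq> 0}) \<longleftrightarrow> (\<exists>R. \<forall>x. R < \<bar>x\<bar> \<longrightarrow> \<phi> x = 0)"
    by (simp only: compact_closure)
  then show ?thesis by (simp add: test_function_def smooth_def)
qed

lemma test_function_vderiv: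
  assumes "test_function \<phi>"
  shows "test_function (vderiv \<phi>)"
proof -
  obtain R where sm: "smooth \<phi>" and R: "\<And>x. R < \<bar>x\<bar> \<Longrightarrow> \<phi> x = 0" using assms by (auto simp: test_function_iff)
  have "vderiv \<phi> x = 0" if "R < \<bar>x\<bar>" for x
  proof -
    have o: "open {y::real. R < \<bar>y\<bar>}" by (intro open_Collect_less continuous_intros)
    have "(\<phi> has_vector_derivative 0) (at x)"
      by (rule has_vector_derivative_transform_within_open[OF has_vector_derivative_const o])
        (simp_all add: that R)
    then show ?thesis by (simp add: vderiv_def vector_derivative_at)
  qed
  then show ?thesis using smooth_vderiv[OF sm] by (auto simp: test_function_iff)
qed

lemma test_function_continuous: "test_function \<phi> \<Longrightarrow> continuous_on UNIV \<phi>"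
  unfolding test_function_iff
  by (meson continuous_at_imp_continuous_on has_vector_derivative_continuous smooth_has_vector_derivative)

text \<open>A single term of the exponential series. With \<open>t = 1 / s\<close> it shows that the
  exponential in \<open>bump\<close> outweighs every power of \<open>1 / s\<close>.\<close>

lemma power_times_exp_minus_le:
  fixes t :: real
  assumes "0 \<le> t"
  shows "t ^ n * exp (- t) \<le> fact n"
proof -
  have "(\<Sum>i\<in>{n}. t ^ i /\<^sub>R fact i) \<le> exp t"
    unfolding exp_def using assms by (intro sum_le_suminf summable_exp_generic) auto
  then show ?thesis by (simp add: exp_minus field_simps)
qed

text \<open>The derivatives of \<open>exp (- 1 / (x (1 - x)))\<close> on the unit interval stay in this family.\<close>

definition bump :: "real poly \<Rightarrow> nat \<Rightarrow> real \<Rightarrow> real" where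
  "bump p k x = (if 0 < x \<and> x < 1
     then poly p x * inverse (x * (1 - x)) ^ k * exp (- inverse (x * (1 - x))) else 0)"

text \<open>With \<open>s = x (1 - x)\<close>, coded as \<open>[:0, 1, -1:]\<close>, and
  \<open>s' = 1 - 2 x\<close>, this is the polynomial factor of the derivative once
  \<open>s ^ (k + 2)\<close> is the common denominator.\<close>

definition bump_deriv_poly :: "real poly \<Rightarrow> nat \<Rightarrow> real poly" where
  "bump_deriv_poly p k = pderiv p * [:0, 1, -1:]\<^sup>2 - smult (real k) (p * [:1, -2:] * [:0, 1, -1:]) + p * [:1, -2:]"

text \<open>Inside the interval this is calculus. At any other \<open>x\<close> the function
  vanishes, and its value at \<open>y\<close> is bounded by a multiple of \<open>|y - x|^2\<close>:
  there \<open>s <= |y - x|\<close>, and the exponential compensates the denominator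
  \<open>s ^ (k + 2)\<close>. So the derivative is 0.\<close>

lemma bump_has_derivative:
  "(bump p k has_real_derivative bump (bump_deriv_poly p k) (k + 2) x) (at x)"
proof (cases "0 < x \<and> x < 1")
  case True
  define s where "s = x * (1 - x)"
  have s: "s > 0" using True by (simp add: s_def)
  have "((\<lambda>x. poly p x * inverse (x * (1 - x)) ^ k * exp (- inverse (x * (1 - x)))) has_real_derivative
     poly (bump_deriv_poly p k) x * inverse s ^ (k + 2) * exp (- inverse s)) (at x)"
  proof -
    have d: "((\<lambda>x. inverse (x * (1 - x))) has_real_derivative - (1 - 2 * x) * inverse s ^ 2) (at x)"
      using s unfolding s_def by (auto intro!: derivative_eq_intros simp: power2_eq_square field_simps)
    \<comment> \<open>For \<open>k = 0\<close> the truncated exponent \<open>k - 1\<close> is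
      harmless because of the factor \<open>real k\<close>.\<close>
    have k: "real k * inverse s ^ (k - 1) * inverse s ^ 2 = real k * inverse s ^ (k + 1)"
      by (cases k) (auto simp: power2_eq_square)
    have S: "poly [:0, 1, -1:] x = s" "poly [:1, -2:] x = 1 - 2 * x" by (simp_all add: s_def algebra_simps)
    have si: "inverse s ^ k = s ^ 2 * inverse s ^ (k + 2)" "inverse s ^ (k + 1) = s * inverse s ^ (k + 2)"
      using s by (auto simp: field_simps power2_eq_square)
    have "((\<lambda>x. poly p x * inverse (x * (1 - x)) ^ k * exp (- inverse (x * (1 - x)))) has_real_derivative
      (poly (pderiv p) x * inverse s ^ k - poly p x * (1 - 2 * x) * (real k * inverse s ^ (k - 1) * inverse s ^ 2)
       + poly p x * (1 - 2 * x) * inverse s ^ (k + 2)) * exp (- inverse s)) (at x)"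
      by (rule DERIV_cong[OF DERIV_mult[OF DERIV_mult[OF poly_DERIV DERIV_power[OF d]]
              DERIV_chain2[OF DERIV_exp DERIV_minus[OF d]]]], unfold s_def[symmetric])
         (simp add: algebra_simps power_add power2_eq_square)
    also have "(poly (pderiv p) x * inverse s ^ k - poly p x * (1 - 2 * x) * (real k * inverse s ^ (k - 1) * inverse s ^ 2)
       + poly p x * (1 - 2 * x) * inverse s ^ (k + 2)) = poly (bump_deriv_poly p k) x * inverse s ^ (k + 2)"
      unfolding k unfolding bump_deriv_poly_def poly_add poly_diff poly_mult poly_smult poly_power S si(1)
      by (subst si(2)) (simp add: algebra_simps)
    finally show ?thesis .
  qed
  then have "(bump p k has_real_derivative poly (bump_deriv_poly p k) x * inverse s ^ (k + 2) * exp (- inverse s)) (at x)"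
    by (rule has_field_derivative_transform_within_open[of _ _ _ "{0<..<1}"]) (use True in \<open>auto simp: bump_def\<close>)
  then show ?thesis using True by (simp add: bump_def s_def)
next
  case False
  obtain C where C: "\<And>y. y \<in> {0..1} \<Longrightarrow> \<bar>poly p y\<bar> \<le> C"
  proof -
    have "bounded (poly p ` {0..1})"
      by (intro compact_imp_bounded compact_continuous_image continuous_intros) auto
    then show ?thesis using that unfolding bounded_iff by (metis imageI real_norm_def)
  qed
  have C0: "0 \<le> C" using C[of 0] by simp
  have le: "\<bar>bump p k y\<bar> \<le> (C * fact (k + 2)) * \<bar>y - x\<bar> ^ 2" for y
  proof (cases "0 < y \<and> y < 1")
    case True
    define s where "s = y * (1 - y)"
    have s: "0 < s" using True by (simp add: s_def)
    have sle: "s \<le> \<bar>y - x\<bar>"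
    proof (cases "x \<le> 0")
      case True
      moreover have "s \<le> y * 1" unfolding s_def using \<open>0 < y \<and> y < 1\<close> by (intro mult_left_mono) auto
      ultimately show ?thesis by linarith
    next
      case False
      moreover have "s \<le> 1 * (1 - y)" unfolding s_def using \<open>0 < y \<and> y < 1\<close> by (intro mult_right_mono) auto
      moreover have "1 \<le> x" using False \<open>\<not> (0 < x \<and> x < 1)\<close> by linarith
      ultimately show ?thesis using \<open>0 < y \<and> y < 1\<close> by auto
    qed
    have "\<bar>bump p k y\<bar> = \<bar>poly p y\<bar> * (inverse s ^ k * exp (- inverse s))"
      using True s by (simp add: bump_def s_def[symmetric] abs_mult)
    also have "inverse s ^ k * exp (- inverse s) = s ^ 2 * (inverse s ^ (k + 2) * exp (- inverse s))"
      using s by (simp add: field_simps power2_eq_square)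
    also have "\<bar>poly p y\<bar> * (s ^ 2 * (inverse s ^ (k + 2) * exp (- inverse s))) \<le> C * (\<bar>y - x\<bar> ^ 2 * fact (k + 2))"
      using C[of y] True s sle C0
      by (intro mult_mono power_mono power_times_exp_minus_le mult_nonneg_nonneg) auto
    finally show ?thesis by (simp add: mult_ac)
  next
    case False
    then have "bump p k y = 0" unfolding bump_def by (rule if_not_P)
    then show ?thesis using C0 by simp
  qed
  have x0: "bump p k x = 0" "bump (bump_deriv_poly p k) (k + 2) x = 0" using False by (auto simp: bump_def)
  have "((\<lambda>y. (bump p k y - bump p k x) / (y - x)) \<longlongrightarrow> 0) (at x)"
  proof (rule Lim_null_comparison)
    show "\<forall>\<^sub>F y in at x. norm ((bump p k y - bump p k x) / (y - x)) \<le> (C * fact (k + 2)) * \<bar>y - x\<bar>"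
    proof (intro always_eventually allI)
      fix y
      show "norm ((bump p k y - bump p k x) / (y - x)) \<le> (C * fact (k + 2)) * \<bar>y - x\<bar>"
      proof (cases "y = x")
        case False
        then have "\<bar>bump p k y\<bar> / \<bar>y - x\<bar> \<le> (C * fact (k + 2)) * \<bar>y - x\<bar> ^ 2 / \<bar>y - x\<bar>"
          by (intro divide_right_mono le) auto
        also have "\<dots> = (C * fact (k + 2)) * \<bar>y - x\<bar>"
        proof -
          have "K * t ^ 2 / t = K * t" if "t \<noteq> 0" for K t :: real using that by (simp add: power2_eq_square)
          then show ?thesis by this (use False in simp)
        qed
        finally show ?thesis by (simp add: x0 abs_divide)
      qed (use C0 in simp)
    qed
    have "((\<lambda>y. (C * fact (k + 2)) * \<bar>y - x\<bar>) \<longlongrightarrow> (C * fact (k + 2)) * \<bar>x - x\<bar>) (at x)"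
      by (intro tendsto_intros)
    then show "((\<lambda>y. (C * fact (k + 2)) * \<bar>y - x\<bar>) \<longlongrightarrow> 0) (at x)" by simp
  qed
  then show ?thesis unfolding x0 by (simp add: has_field_derivative_iff x0)
qed

lemma smooth_bump: "smooth (\<lambda>x. of_real (bump p k x))"
proof (rule smooth_coinduct[where P = "\<lambda>f. \<exists>p k. f = (\<lambda>x. of_real (bump p k x))"])
  fix f :: "real \<Rightarrow> complex" assume "\<exists>p k. f = (\<lambda>x. of_real (bump p k x))"
  then obtain p k where f: "f = (\<lambda>x. of_real (bump p k x))" by blast
  have d: "(f has_vector_derivative of_real (bump (bump_deriv_poly p k) (k + 2) x)) (at x)" for x
    unfolding f by (rule has_vector_derivative_of_real[OF bump_has_derivative])
  then have "vderiv f = (\<lambda>x. of_real (bump (bump_deriv_poly p k) (k + 2) x))" by (rule vderiv_eqI)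
  then show "(\<forall>x. f differentiable (at x)) \<and> (\<exists>p k. vderiv f = (\<lambda>x. of_real (bump p k x)))"
    using d by (meson differentiableI_vector)
qed blast

lemma continuous_bump: "continuous_on S (bump p k)"
  using bump_has_derivative by (meson DERIV_continuous_on has_field_derivative_at_within)

text \<open>The support is placed to the right of 0, so that the primitive is a smooth step, exactly
  0 up to the origin and exactly 1 from 1 on.\<close>

lemma exists_mollifier:
  obtains \<eta> :: "real \<Rightarrow> real"
  where "smooth (\<lambda>x. of_real (\<eta> x))" "\<And>x. 0 \<le> \<eta> x" "\<And>x. x \<notin> {0..1} \<Longrightarrow> \<eta> x = 0"
    "continuous_on UNIV \<eta>" "integrable lborel \<eta>" "(LBINT x. \<eta> x) = 1"
proof -
  define b where "b = bump 1 0"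
  have b0: "0 \<le> b x" and bs: "x \<notin> {0..1} \<Longrightarrow> b x = 0" for x by (auto simp: b_def bump_def)
  have cb: "continuous_on S b" for S unfolding b_def by (rule continuous_bump)
  have "set_integrable lborel {0..1} b" by (rule borel_integrable_atLeastAtMost'[OF cb])
  moreover have "(\<lambda>x. indicator {0..1} x *\<^sub>R b x) = b" using bs by (auto simp: fun_eq_iff indicator_def)
  ultimately have ib: "integrable lborel b" by (simp add: set_integrable_def)
  define c where "c = (LBINT x. b x)"
  have "c \<noteq> 0"
  proof
    assume "c = 0"
    then have "AE x in lborel. b x = 0"
      using integral_nonneg_eq_0_iff_AE[OF ib] b0 by (simp add: c_def)
    then have "AE x in lborel. x \<notin> {0<..<1::real}"
      by eventually_elim (auto simp: b_def bump_def)
    then have "emeasure lborel {0<..<1::real} = 0"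
      by (subst (asm) AE_iff_measurable[of "{0<..<1}"]) auto
    then show False by simp
  qed
  moreover have "0 \<le> c" unfolding c_def using b0 by simp
  ultimately have c: "0 < c" by simp
  show ?thesis
  proof (rule that[of "\<lambda>x. b x / c"])
    have "smooth (\<lambda>x. (1 / of_real c) * of_real (bump 1 0 (1 * x + 0)) + 0 * of_real (bump 1 0 x))"
      by (rule smooth_linear_combination[OF smooth_bump smooth_bump])
    then show "smooth (\<lambda>x. of_real (b x / c))" by (simp add: b_def)
    show "continuous_on UNIV (\<lambda>x. b x / c)" using c by (intro continuous_intros cb) auto
    show "integrable lborel (\<lambda>x. b x / c)" using ib by simp
    show "(LBINT x. b x / c) = 1" using c by (simp add: c_def)
  qed (use b0 bs c in auto)
qed

section \<open>Distributional identities\<close>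

lemma integrable_locally_mult_test:
  assumes d: "\<And>s t. set_integrable lborel {s..t} d" and \<psi>: "test_function \<psi>"
  shows "integrable lborel (\<lambda>x. d x * \<psi> x :: complex)"
proof -
  obtain R where R: "\<And>x. R < \<bar>x\<bar> \<Longrightarrow> \<psi> x = 0" using \<psi> by (auto simp: test_function_iff)
  have "integrable lborel (\<lambda>x. indicator {- R..R} x *\<^sub>R (d x * \<psi> x))"
    using set_integrable_mult_continuous[OF d test_function_continuous[OF \<psi>]] by (simp add: set_integrable_def)
  moreover have "indicator {- R..R} x *\<^sub>R (d x * \<psi> x) = d x * \<psi> x" for x
    using R[of x] by (cases "R < \<bar>x\<bar>") (auto simp: indicator_def)
  ultimately show ?thesis by simp
qed

text \<open>The positive and the negative part are densities of two finite measures that agree on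
  all half-lines and hence coincide; by uniqueness of densities the two parts are equal, so both
  vanish.\<close>

lemma AE_zero_if_integrals_zero:
  fixes r :: "real \<Rightarrow> real"
  assumes r: "integrable lborel r" and z: "\<And>a. (LBINT x. indicator {a<..} x * r x) = 0"
  shows "AE x in lborel. r x = 0"
proof -
  have [measurable]: "r \<in> borel_measurable borel" using r by simp
  define p where "p x = max 0 (r x)" for x
  define n where "n x = max 0 (- r x)" for x
  have [measurable]: "p \<in> borel_measurable borel" "n \<in> borel_measurable borel"
    unfolding p_def n_def by measurable
  have p0: "0 \<le> p x" and n0: "0 \<le> n x" for x by (auto simp: p_def n_def)
  have ip: "integrable lborel p" and "in": "integrable lborel n"
    unfolding p_def n_def using r by auto
  have em: "emeasure (density lborel (\<lambda>x. ennreal (k x))) {a<..} = ennreal (LBINT x. indicator {a<..} x * k x)"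
    if k: "integrable lborel k" "\<And>x. 0 \<le> k x" for k :: "real \<Rightarrow> real" and a
  proof -
    have "emeasure (density lborel (\<lambda>x. ennreal (k x))) {a<..} = (\<integral>\<^sup>+x. ennreal (indicator {a<..} x * k x) \<partial>lborel)"
      using borel_measurable_integrable[OF k(1)] k(2)
      by (subst emeasure_density) (auto intro!: nn_integral_cong simp: indicator_def)
    also have "\<dots> = ennreal (LBINT x. indicator {a<..} x * k x)"
      using integrable_mult_indicator[OF _ k(1), of "{a<..}"] k(2) by (intro nn_integral_eq_integral) auto
    finally show ?thesis .
  qed
  have "density lborel (\<lambda>x. ennreal (p x)) = density lborel (\<lambda>x. ennreal (n x))"
  proof (rule measure_eqI_lessThan)
    fix a
    have i: "integrable lborel (\<lambda>x. indicator {a<..} x * p x)" "integrable lborel (\<lambda>x. indicator {a<..} x * n x)"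
      using integrable_mult_indicator[OF _ ip, of "{a<..}"] integrable_mult_indicator[OF _ "in", of "{a<..}"] by auto
    have "(\<lambda>x. indicator {a<..} x * r x) = (\<lambda>x. indicator {a<..} x * p x - indicator {a<..} x * n x)"
      by (auto simp: p_def n_def indicator_def fun_eq_iff)
    then have "(LBINT x. indicator {a<..} x * p x) - (LBINT x. indicator {a<..} x * n x)
        = (LBINT x. indicator {a<..} x * r x)"
      using i by simp
    then show "emeasure (density lborel (\<lambda>x. ennreal (p x))) {a<..} = emeasure (density lborel (\<lambda>x. ennreal (n x))) {a<..}"
      using z[of a] by (simp add: em[OF ip p0] em[OF "in" n0])
    show "emeasure (density lborel (\<lambda>x. ennreal (p x))) {a<..} < \<infinity>"
      by (subst em[OF ip p0]) simp
  qed simp_all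
  then have "AE x in lborel. ennreal (p x) = ennreal (n x)"
    by (subst (asm) sigma_finite_measure.density_unique_iff[OF sigma_finite_lborel]) auto
  then show ?thesis by eventually_elim (auto simp: p_def n_def max_def split: if_splits)
qed

text \<open>Differences of ever steeper smooth steps converge to the indicator of a half-open
  interval, so all integrals of \<open>d\<close> over such intervals vanish. The real and imaginary
  parts of truncations of \<open>d\<close> are then covered by
  \<open>AE_zero_if_integrals_zero\<close>.\<close>

theorem fundamental_lemma:
  fixes d :: "real \<Rightarrow> complex"
  assumes d: "\<And>s t. set_integrable lborel {s..t} d"
    and z: "\<And>\<psi>. test_function \<psi> \<Longrightarrow> (LBINT x. d x * \<psi> x) = 0"
  shows "AE x in lborel. d x = 0"
proof -
  obtain \<eta> where \<eta>: "smooth (\<lambda>x. of_real (\<eta> x))" "\<And>x. 0 \<le> \<eta> x" "\<And>x. x \<notin> {0..1} \<Longrightarrow> \<eta> x = 0"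
    "continuous_on UNIV \<eta>" "integrable lborel \<eta>" "(LBINT x. \<eta> x) = 1"
    using exists_mollifier by blast
  have "set_integrable lborel {s..t} \<eta>" for s t
    unfolding set_integrable_def by (rule integrable_mult_indicator[OF _ \<eta>(5)]) simp
  then obtain S where S: "ac_deriv S \<eta>" "S 0 = 0" using ac_deriv_of_integral by blast
  have S_le: "S x = 0" if "x \<le> 0" for x
  proof -
    have "(LINT y:{x..0}|lborel. \<eta> y) = integral\<^sup>L lborel (\<lambda>y::real. 0)"
      unfolding set_lebesgue_integral_def
    proof (rule integral_cong_AE)
      show "AE y in lborel. indicator {x..0} y *\<^sub>R \<eta> y = 0"
        by (rule AE_mp[OF AE_lborel_singleton[of 0]]) (use \<eta>(3) in \<open>auto simp: indicator_def\<close>)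
      show "(\<lambda>y. indicator {x..0} y *\<^sub>R \<eta> y) \<in> borel_measurable lborel"
        using borel_measurable_continuous_onI[OF \<eta>(4)] by measurable
    qed simp
    then show ?thesis using ac_derivD(2)[OF S(1) that] S(2) by simp
  qed
  have S_ge: "S x = 1" if "1 \<le> x" for x
  proof -
    have "(LINT y:{0..x}|lborel. \<eta> y) = (LBINT x. \<eta> x)"
      unfolding set_lebesgue_integral_def using \<eta>(3) that
      by (intro Bochner_Integration.integral_cong refl) (force simp: indicator_def)
    then show ?thesis using ac_derivD(2)[OF S(1), of 0 x] S(2) that \<eta>(6) by simp
  qed
  have S01: "0 \<le> S x" "S x \<le> 1" for x
  proof -
    have mono: "S a \<le> S b" if "a \<le> b" for a b
    proof -
      have "0 \<le> (LINT y:{a..b}|lborel. \<eta> y)"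
        unfolding set_lebesgue_integral_def using \<eta>(2) by (intro integral_nonneg_AE) auto
      then show ?thesis using ac_derivD(2)[OF S(1) that] by simp
    qed
    show "0 \<le> S x" using mono[of "min x 0" x] S_le[of "min x 0"] by simp
    show "S x \<le> 1" using mono[of x "max x 1"] S_ge[of "max x 1"] by simp
  qed
  have Ssm: "smooth (\<lambda>x. of_real (S x))"
  proof (rule smooth_primitive[OF _ \<eta>(1)])
    have "(S has_real_derivative \<eta> x) (at x)" for x
      unfolding has_real_derivative_iff_has_vector_derivative
      by (rule ac_deriv_has_vector_derivative[OF S(1) \<eta>(4)])
    then show "((\<lambda>x. of_real (S x)) has_vector_derivative of_real (\<eta> x)) (at x)" for x
      by (rule has_vector_derivative_of_real)
  qed
  have ab: "(LBINT x. indicator {a<..b} x *\<^sub>R d x) = 0" if "a < b" for a b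
  proof -
    define \<theta> where "\<theta> n x = of_real (S (real (Suc n) * (x - a))) - (of_real (S (real (Suc n) * (x - b))) :: complex)" for n x
    \<comment> \<open>Since \<open>Suc n\<close> is at least 1, the support is the same for all
      \<open>n\<close>; this provides a dominating function although \<open>d\<close> is only
      locally integrable.\<close>
    have out: "\<theta> n x = 0" if x: "x \<notin> {a..b + 1}" for n x
    proof (cases "x < a")
      case True
      then show ?thesis using \<open>a < b\<close> by (simp add: \<theta>_def S_le mult_nonneg_nonpos)
    next
      case False
      then have "x - b \<ge> 1" "x - a \<ge> 1" using x \<open>a < b\<close> by auto
      then have "1 * 1 \<le> real (Suc n) * (x - b)" "1 * 1 \<le> real (Suc n) * (x - a)"
        by (intro mult_mono; simp)+
      then show ?thesis by (simp add: \<theta>_def S_ge del: of_nat_Suc)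
    qed
    have test: "test_function (\<theta> n)" for n
    proof -
      have sm: "smooth (\<lambda>x. of_real (S (real (Suc n) * x + - real (Suc n) * c)))" for c
      proof -
        have "smooth (\<lambda>x. 1 * of_real (S (real (Suc n) * x + - real (Suc n) * c)) + 0 * of_real (S x))"
          by (rule smooth_linear_combination[OF Ssm Ssm])
        then show ?thesis by simp
      qed
      have "smooth (\<lambda>x. (- 1) * of_real (S (real (Suc n) * (1 * x + 0) + - real (Suc n) * b))
           + 1 * of_real (S (real (Suc n) * x + - real (Suc n) * a)))"
        by (rule smooth_linear_combination[OF sm sm])
      moreover have "(\<lambda>x. (- 1) * of_real (S (real (Suc n) * (1 * x + 0) + - real (Suc n) * b))
           + 1 * of_real (S (real (Suc n) * x + - real (Suc n) * a))) = \<theta> n"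
        by (simp add: \<theta>_def fun_eq_iff algebra_simps)
      moreover have "\<theta> n x = 0" if "max \<bar>a\<bar> \<bar>b + 1\<bar> < \<bar>x\<bar>" for x
        by (rule out) (use that in auto)
      ultimately show ?thesis unfolding test_function_iff by metis
    qed
    have "(\<lambda>n. \<integral>x. d x * \<theta> n x \<partial>lborel) \<longlonglongrightarrow> (LBINT x. indicator {a<..b} x *\<^sub>R d x)"
    proof (rule integral_dominated_convergence[where w = "\<lambda>x. norm (indicator {a..b + 1} x *\<^sub>R d x)"])
      show "(\<lambda>x. indicator {a<..b} x *\<^sub>R d x) \<in> borel_measurable lborel"
      proof -
        have "(\<lambda>x. indicator {a<..b} x *\<^sub>R (indicator {a..b} x *\<^sub>R d x)) \<in> borel_measurable lborel"
          using d[of a b] unfolding set_integrable_def by measurable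
        moreover have "(\<lambda>x. indicator {a<..b} x *\<^sub>R (indicator {a..b} x *\<^sub>R d x)) = (\<lambda>x. indicator {a<..b} x *\<^sub>R d x)"
          by (auto simp: indicator_def fun_eq_iff)
        ultimately show ?thesis by simp
      qed
      show "(\<lambda>x. d x * \<theta> n x) \<in> borel_measurable lborel" for n
        using integrable_locally_mult_test[OF d test] by simp
      show "integrable lborel (\<lambda>x. norm (indicator {a..b + 1} x *\<^sub>R d x))"
        using d[of a "b + 1"] unfolding set_integrable_def by (rule integrable_norm)
      show "AE x in lborel. norm (d x * \<theta> n x) \<le> norm (indicator {a..b + 1} x *\<^sub>R d x)" for n
      proof (rule AE_I2)
        fix x
        have "norm (\<theta> n x) \<le> 1"
        proof -
          have "\<theta> n x = of_real (S (real (Suc n) * (x - a)) - S (real (Suc n) * (x - b)))" by (simp add: \<theta>_def)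
          then have "norm (\<theta> n x) = \<bar>S (real (Suc n) * (x - a)) - S (real (Suc n) * (x - b))\<bar>" by (simp only: norm_of_real)
          then show ?thesis using S01[of "real (Suc n) * (x - a)"] S01[of "real (Suc n) * (x - b)"] by linarith
        qed
        then show "norm (d x * \<theta> n x) \<le> norm (indicator {a..b + 1} x *\<^sub>R d x)"
          using out[of x n] by (cases "x \<in> {a..b + 1}") (auto simp: norm_mult mult_left_le)
      qed
      show "AE x in lborel. (\<lambda>n. d x * \<theta> n x) \<longlonglongrightarrow> indicator {a<..b} x *\<^sub>R d x"
      proof (rule AE_I2)
        fix x
        \<comment> \<open>The step vanishes at 0 itself, so the limit holds at every point and
          selects the interval open on the left and closed on the right.\<close>
        have lim: "(\<lambda>n. S (real (Suc n) * y)) \<longlonglongrightarrow> indicator {0<..} y" for y :: real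
        proof (cases "0 < y")
          case True
          obtain N where N: "1 < real N * y" using reals_Archimedean3[OF True] by blast
          have "S (real (Suc n) * y) = 1" if "n \<ge> N" for n
          proof (rule S_ge)
            have "real N * y \<le> real (Suc n) * y" using that True by (intro mult_right_mono) auto
            then show "1 \<le> real (Suc n) * y" using N by simp
          qed
          then show ?thesis using True by (intro tendsto_eventually) (auto simp: eventually_sequentially)
        next
          case False
          then show ?thesis by (simp add: S_le mult_nonneg_nonpos)
        qed
        have "(\<lambda>n. d x * \<theta> n x) \<longlonglongrightarrow> d x * (of_real (indicator {0<..} (x - a)) - of_real (indicator {0<..} (x - b)))"
          unfolding \<theta>_def by (intro tendsto_intros lim)
        also have "d x * (of_real (indicator {0<..} (x - a)) - of_real (indicator {0<..} (x - b))) = indicator {a<..b} x *\<^sub>R d x"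
          using \<open>a < b\<close> by (auto simp: indicator_def)
        finally show "(\<lambda>n. d x * \<theta> n x) \<longlonglongrightarrow> indicator {a<..b} x *\<^sub>R d x" .
      qed
    qed
    then show ?thesis using z[OF test] LIMSEQ_unique[OF tendsto_const] by fastforce
  qed
  have R0: "AE x in lborel. indicator {- R<..R} x *\<^sub>R d x = 0" if R: "0 < R" for R :: real
  proof -
    have i: "integrable lborel (\<lambda>x. indicator {- R<..R} x *\<^sub>R d x)"
    proof -
      have eq: "(\<lambda>x. indicator {- R<..R} x *\<^sub>R d x) = (\<lambda>x. indicator {- R<..R} x *\<^sub>R (indicator {- R..R} x *\<^sub>R d x))"
        by (auto simp: indicator_def fun_eq_iff)
      show ?thesis
        unfolding eq by (rule integrable_mult_indicator[OF _ d[of "- R" R, unfolded set_integrable_def]]) simp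
    qed
    have zr: "(LBINT x. indicator {a<..} x *\<^sub>R (indicator {- R<..R} x *\<^sub>R d x)) = 0" for a
    proof -
      have "(\<lambda>x. indicator {a<..} x *\<^sub>R (indicator {- R<..R} x *\<^sub>R d x)) =
          (\<lambda>x. indicator {max a (- R)<..R} x *\<^sub>R d x)" by (auto simp: indicator_def fun_eq_iff)
      moreover have "(LBINT x. indicator {max a (- R)<..R} x *\<^sub>R d x) = 0"
        by (cases "max a (- R) < R") (use ab in auto)
      ultimately show ?thesis by simp
    qed
    have comp: "AE x in lborel. T (indicator {- R<..R} x *\<^sub>R d x) = 0" if T: "bounded_linear T" for T :: "complex \<Rightarrow> real"
    proof (rule AE_zero_if_integrals_zero)
      interpret bounded_linear T by fact
      show "integrable lborel (\<lambda>x. T (indicator {- R<..R} x *\<^sub>R d x))" by (rule integrable_bounded_linear[OF T i])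
      fix a
      have "integrable lborel (\<lambda>x. indicator {a<..} x *\<^sub>R (indicator {- R<..R} x *\<^sub>R d x))"
        by (rule integrable_mult_indicator[OF _ i]) simp
      from integral_bounded_linear[OF T this] zr[of a]
      show "(LBINT x. indicator {a<..} x * T (indicator {- R<..R} x *\<^sub>R d x)) = 0"
        by (simp add: scaleR mult.assoc)
    qed
    have "AE x in lborel. Re (indicator {- R<..R} x *\<^sub>R d x) = 0" "AE x in lborel. Im (indicator {- R<..R} x *\<^sub>R d x) = 0"
      by (intro comp bounded_linear_Re bounded_linear_Im)+
    then show ?thesis by eventually_elim (simp add: complex_eq_iff)
  qed
  have "AE x in lborel. \<forall>n. indicator {- real (Suc n)<..real (Suc n)} x *\<^sub>R d x = 0"
    unfolding AE_all_countable by (intro allI R0) simp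
  then show ?thesis
  proof eventually_elim
    fix x assume a: "\<forall>n. indicator {- real (Suc n)<..real (Suc n)} x *\<^sub>R d x = 0"
    obtain n where "\<bar>x\<bar> < real n" using reals_Archimedean2 by blast
    then show "d x = 0" using a[rule_format, of n] by (auto simp: indicator_def split: if_splits)
  qed
qed

lemma integral_mult_vderiv_test:
  assumes w: "ac_deriv w b" and \<phi>: "test_function \<phi>"
  shows "(LBINT x. w x * vderiv \<phi> x) = - (LBINT x. b x * \<phi> x)"
proof -
  have sm: "smooth \<phi>" using \<phi> by (simp add: test_function_iff)
  obtain R where R: "\<And>x. R < \<bar>x\<bar> \<Longrightarrow> \<phi> x = 0" using \<phi> by (auto simp: test_function_iff)
  have acp: "ac_deriv \<phi> (vderiv \<phi>)"
    by (intro ac_deriv_C1 smooth_has_vector_derivative sm test_function_continuous test_function_vderiv \<phi>)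
  have i1: "integrable lborel (\<lambda>x. b x * \<phi> x)" by (rule integrable_locally_mult_test[OF ac_derivD(1)[OF w] \<phi>])
  have i2: "integrable lborel (\<lambda>x. w x * vderiv \<phi> x)"
  proof (rule integrable_locally_mult_test[OF _ test_function_vderiv[OF \<phi>]])
    show "set_integrable lborel {s..t} w" for s t
      by (rule borel_integrable_atLeastAtMost') (rule continuous_on_subset[OF ac_deriv_continuous[OF w]], simp)
  qed
  have "(LBINT x. b x * \<phi> x + w x * vderiv \<phi> x) = 0"
  proof (rule ac_deriv_integral_eq_0[OF ac_deriv_mult[OF w acp]])
    show "integrable lborel (\<lambda>x. b x * \<phi> x + w x * vderiv \<phi> x)" using i1 i2 by simp
    show "\<exists>y>R'. norm (w y * \<phi> y) + norm (w (- y) * \<phi> (- y)) < e" if "0 < e" for e R'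
      using R that by (intro exI[of _ "max (R' + 1) (\<bar>R\<bar> + 1)"]) auto
  qed
  then show ?thesis using i1 i2 by (simp add: add_eq_0_iff)
qed

text \<open>Subtracting a primitive \<open>w\<close> of \<open>b\<close> leaves a function
  \<open>d\<close> with zero distributional derivative. A test function of integral 0 is the
  derivative of a test function, and every test function acquires integral 0 when its mean times the
  mollifier is subtracted; hence \<open>d\<close> equals the constant \<open>c\<close>.\<close>

theorem du_Bois_Reymond:
  fixes a b :: "real \<Rightarrow> complex"
  assumes a: "\<And>s t. set_integrable lborel {s..t} a" and b: "\<And>s t. set_integrable lborel {s..t} b"
    and eq: "\<And>\<phi>. test_function \<phi> \<Longrightarrow> (LBINT x. a x * vderiv \<phi> x) = - (LBINT x. b x * \<phi> x)"
  obtains u where "ac_deriv u b" "AE x in lborel. u x = a x"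
proof -
  obtain w where w: "ac_deriv w b" using ac_deriv_of_integral[OF b] by blast
  obtain \<eta> where \<eta>: "smooth (\<lambda>x. of_real (\<eta> x))" "\<And>x. 0 \<le> \<eta> x" "\<And>x. x \<notin> {0..1} \<Longrightarrow> \<eta> x = 0"
    "continuous_on UNIV \<eta>" "integrable lborel \<eta>" "(LBINT x. \<eta> x) = 1"
    using exists_mollifier by blast
  have test\<eta>: "test_function (\<lambda>x. of_real (\<eta> x))"
  proof -
    have "\<eta> x = 0" if "1 < \<bar>x\<bar>" for x by (rule \<eta>(3)) (use that in auto)
    then show ?thesis unfolding test_function_iff using \<eta>(1) by (intro conjI exI[of _ 1]) auto
  qed
  have wi: "set_integrable lborel {s..t} w" for s t
    by (rule borel_integrable_atLeastAtMost') (rule continuous_on_subset[OF ac_deriv_continuous[OF w]], simp)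
  define d where "d x = a x - w x" for x
  have di: "set_integrable lborel {s..t} d" for s t unfolding d_def by (intro set_integral_diff a wi)
  have d0: "(LBINT x. d x * vderiv \<phi> x) = 0" if \<phi>: "test_function \<phi>" for \<phi>
    using integrable_locally_mult_test[OF a test_function_vderiv[OF \<phi>]]
      integrable_locally_mult_test[OF wi test_function_vderiv[OF \<phi>]]
      eq[OF \<phi>] integral_mult_vderiv_test[OF w \<phi>]
    by (simp add: d_def left_diff_distrib)
  define c where "c = (LBINT x. d x * of_real (\<eta> x))"
  have ci: "set_integrable lborel {s..t} (\<lambda>x. c)" for s t :: real
    by (rule borel_integrable_atLeastAtMost') simp
  have "AE x in lborel. d x - c = 0"
  proof (rule fundamental_lemma)
    show "set_integrable lborel {s..t} (\<lambda>x. d x - c)" for s t by (intro set_integral_diff di ci)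
    fix \<psi> assume \<psi>: "test_function \<psi>"
    have one: "set_integrable lborel {s..t} (\<lambda>x. 1 :: complex)" for s t :: real
      by (rule borel_integrable_atLeastAtMost') simp
    have i\<psi>: "integrable lborel \<psi>" using integrable_locally_mult_test[OF one \<psi>] by simp
    have i\<eta>: "complex_integrable lborel (\<lambda>x. of_real (\<eta> x))" using integrable_locally_mult_test[OF one test\<eta>] by simp
    define m where "m = (LBINT x. \<psi> x)"
    define \<xi> where "\<xi> x = \<psi> x - m * of_real (\<eta> x)" for x
    obtain R where R: "\<And>x. R < \<bar>x\<bar> \<Longrightarrow> \<psi> x = 0" using \<psi> by (auto simp: test_function_iff)
    define R' where "R' = max R 1"
    have \<xi>out: "\<xi> x = 0" if "R' < \<bar>x\<bar>" for x
    proof -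
      have "\<eta> x = 0" by (rule \<eta>(3)) (use that in \<open>auto simp: R'_def\<close>)
      moreover have "\<psi> x = 0" using that by (intro R) (simp add: R'_def)
      ultimately show ?thesis by (simp add: \<xi>_def)
    qed
    have "smooth (\<lambda>x. (- m) * of_real (\<eta> (1 * x + 0)) + 1 * \<psi> x)"
      using \<psi> by (intro smooth_linear_combination[of "\<lambda>x. of_real (\<eta> x)"] \<eta>(1)) (auto simp: test_function_iff)
    then have sm\<xi>: "smooth \<xi>" unfolding \<xi>_def[abs_def] by simp
    have test\<xi>: "test_function \<xi>" unfolding test_function_iff using sm\<xi> \<xi>out by blast
    have i\<xi>: "integrable lborel \<xi>" using i\<psi> i\<eta> unfolding \<xi>_def by simp
    have "(LBINT x. \<xi> x) = 0" using i\<psi> i\<eta> \<eta>(6) unfolding \<xi>_def by (simp add: m_def)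
    have "set_integrable lborel {s..t} \<xi>" for s t
      unfolding set_integrable_def by (rule integrable_mult_indicator[OF _ i\<xi>]) simp
    then obtain \<phi>0 where \<phi>0: "ac_deriv \<phi>0 \<xi>" using ac_deriv_of_integral by blast
    \<comment> \<open>Normalised to vanish to the left of the support of \<xi>; since \<xi> has
      integral 0, it vanishes to the right as well.\<close>
    define \<phi> where "\<phi> x = \<phi>0 x - \<phi>0 (- (R' + 1))" for x
    have ac\<phi>: "ac_deriv \<phi> \<xi>" using \<phi>0 by (simp add: ac_deriv_def \<phi>_def)
    have \<xi>int: "(LINT x:{s..t}|lborel. \<xi> x) = 0" if "s \<le> t" "t < - R' \<or> R' < s \<or> s < - R' \<and> R' < t" for s t
    proof (cases "s < - R' \<and> R' < t")
      case True
      then have "(LINT x:{s..t}|lborel. \<xi> x) = (LBINT x. \<xi> x)"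
        unfolding set_lebesgue_integral_def using \<xi>out
        by (intro Bochner_Integration.integral_cong refl) (force simp: indicator_def)
      then show ?thesis using \<open>(LBINT x. \<xi> x) = 0\<close> by simp
    next
      case False
      then have "(\<lambda>x. indicator {s..t} x *\<^sub>R \<xi> x) = (\<lambda>x. 0)"
        using that \<xi>out by (force simp: indicator_def fun_eq_iff)
      then show ?thesis unfolding set_lebesgue_integral_def by simp
    qed
    have \<phi>out: "\<phi> x = 0" if "R' + 1 < \<bar>x\<bar>" for x
    proof (cases "x < 0")
      case True
      have "(LINT x:{x..- (R' + 1)}|lborel. \<xi> x) = 0" by (rule \<xi>int) (use True that in auto)
      then show ?thesis using ac_derivD(2)[OF \<phi>0, of x "- (R' + 1)"] True that by (simp add: \<phi>_def)
    next
      case False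
      have "(LINT x:{- (R' + 1)..x}|lborel. \<xi> x) = 0" by (rule \<xi>int) (use False that in \<open>auto simp: R'_def\<close>)
      then show ?thesis using ac_derivD(2)[OF \<phi>0, of "- (R' + 1)" x] False that by (simp add: \<phi>_def R'_def)
    qed
    have der: "(\<phi> has_vector_derivative \<xi> x) (at x)" for x
      by (rule ac_deriv_has_vector_derivative[OF ac\<phi> test_function_continuous[OF test\<xi>]])
    have "test_function \<phi>" unfolding test_function_iff using smooth_primitive[OF der sm\<xi>] \<phi>out by blast
    from d0[OF this] vderiv_eqI[OF der] have "(LBINT x. d x * \<xi> x) = 0" by simp
    moreover have "(LBINT x. d x * \<xi> x) = (LBINT x. d x * \<psi> x) - m * c"
      using integrable_locally_mult_test[OF di \<psi>] integrable_locally_mult_test[OF di test\<eta>]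
      by (simp add: \<xi>_def c_def right_diff_distrib mult.left_commute[of _ m])
    ultimately have "(LBINT x. d x * \<psi> x) = c * m" by (simp add: mult.commute[of c])
    then show "(LBINT x. (d x - c) * \<psi> x) = 0"
      using integrable_locally_mult_test[OF di \<psi>] i\<psi> by (simp add: left_diff_distrib m_def)
  qed
  then have "AE x in lborel. w x + c = a x" by eventually_elim (simp add: d_def algebra_simps)
  moreover have "ac_deriv (\<lambda>x. w x + c) b" using w by (simp add: ac_deriv_def)
  ultimately show ?thesis using that by blast
qed

section \<open>The free Green function\<close>

text \<open>The improper integral over the half-line, doubled by reflection. It serves the
  exponential kernel and the squared weight alike.\<close>

lemma has_bochner_integral_even:
  fixes f F :: "real \<Rightarrow> real"
  assumes nn: "\<And>x. 0 \<le> x \<Longrightarrow> 0 \<le> f x" and [measurable]: "f \<in> borel_measurable borel"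
    and der: "\<And>x. 0 \<le> x \<Longrightarrow> DERIV F x :> f x" and lim: "(F \<longlongrightarrow> T) at_top"
  shows "has_bochner_integral lborel (\<lambda>x. f \<bar>x\<bar>) (2 * (T - F 0))"
proof -
  have half: "(\<integral>\<^sup>+x. ennreal (f x) * indicator {0..} x \<partial>lborel) = ennreal (T - F 0)"
    by (rule nn_integral_FTC_atLeast[OF _ der nn lim]) auto
  have mono: "F 0 \<le> F x" if "0 \<le> x" for x
    using that der nn by (intro DERIV_nonneg_imp_nondecreasing[of 0 x F]) (auto intro!: exI)
  have T0: "F 0 \<le> T"
    by (rule tendsto_lowerbound[OF lim]) (auto intro!: eventually_mono[OF eventually_ge_at_top[of 0]] mono)
  have "(\<integral>\<^sup>+x. ennreal (f \<bar>x\<bar>) \<partial>lborel) =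
      (\<integral>\<^sup>+x. ennreal (f x) * indicator {0..} x + ennreal (f (- x)) * indicator {0..} (- x) \<partial>lborel)"
    by (rule nn_integral_cong_AE, rule AE_mp[OF AE_lborel_singleton[of 0]])
       (auto simp: indicator_def)
  also have "\<dots> = (\<integral>\<^sup>+x. ennreal (f x) * indicator {0..} x \<partial>lborel) +
      (\<integral>\<^sup>+x. ennreal (f (- x)) * indicator {0..} (- x) \<partial>lborel)"
    by (rule nn_integral_add) auto
  also have "(\<integral>\<^sup>+x. ennreal (f (- x)) * indicator {0..} (- x) \<partial>lborel) = (\<integral>\<^sup>+x. ennreal (f x) * indicator {0..} x \<partial>lborel)"
    using nn_integral_real_affine[of "\<lambda>x. ennreal (f x) * indicator {0..} x" "- 1" 0] by simp
  finally have "(\<integral>\<^sup>+x. ennreal (f \<bar>x\<bar>) \<partial>lborel) = ennreal (2 * (T - F 0))"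
    using T0 by (simp add: half flip: ennreal_plus)
  then show ?thesis
    using T0 nn by (intro has_bochner_integral_nn_integral) auto
qed

lemma exp_minus_abs_integral:
  fixes \<alpha> :: real
  assumes "0 < \<alpha>"
  shows "integrable lborel (\<lambda>x. exp (- \<alpha> * \<bar>x - y\<bar>))" "(LBINT x. exp (- \<alpha> * \<bar>x - y\<bar>)) = 2 / \<alpha>"
    "integrable lborel (\<lambda>x. exp (- \<alpha> * \<bar>y - x\<bar>))" "(LBINT x. exp (- \<alpha> * \<bar>y - x\<bar>)) = 2 / \<alpha>"
proof -
  have *: "has_bochner_integral lborel (\<lambda>x. exp (- \<alpha> * \<bar>x\<bar>)) (2 * (0 - (- exp (- \<alpha> * 0) / \<alpha>)))"
  proof (rule has_bochner_integral_even[where f = "\<lambda>x. exp (- \<alpha> * x)"])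
    show "DERIV (\<lambda>x. - exp (- \<alpha> * x) / \<alpha>) x :> exp (- \<alpha> * x)" for x
      using assms by (auto intro!: derivative_eq_intros)
    show "((\<lambda>x. - exp (- \<alpha> * x) / \<alpha>) \<longlongrightarrow> 0) at_top"
    proof -
      have "filterlim (\<lambda>x. - \<alpha> * x) at_bot at_top"
        using assms by (intro filterlim_tendsto_neg_mult_at_bot[OF tendsto_const] filterlim_ident) auto
      then have "((\<lambda>x. exp (- \<alpha> * x)) \<longlongrightarrow> 0) at_top" by (rule filterlim_compose[OF exp_at_bot])
      then show ?thesis using tendsto_divide[OF tendsto_minus tendsto_const, of _ 0 at_top \<alpha>] assms by fastforce
    qed
  qed auto
  then have i: "integrable lborel (\<lambda>x. exp (- \<alpha> * \<bar>x\<bar>))" and v: "(LBINT x. exp (- \<alpha> * \<bar>x\<bar>)) = 2 / \<alpha>"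
    by (auto simp: has_bochner_integral_iff)
  show "integrable lborel (\<lambda>x. exp (- \<alpha> * \<bar>x - y\<bar>))"
    using lborel_integrable_real_affine[OF i, of 1 "- y"] by simp
  show "(LBINT x. exp (- \<alpha> * \<bar>x - y\<bar>)) = 2 / \<alpha>"
    using lborel_integral_real_affine[of 1 "\<lambda>x. exp (- \<alpha> * \<bar>x\<bar>)" "- y"] v by simp
  show "integrable lborel (\<lambda>x. exp (- \<alpha> * \<bar>y - x\<bar>))"
    using lborel_integrable_real_affine[OF i, of "- 1" y] by simp
  show "(LBINT x. exp (- \<alpha> * \<bar>y - x\<bar>)) = 2 / \<alpha>"
    using lborel_integral_real_affine[of "- 1" "\<lambda>x. exp (- \<alpha> * \<bar>x\<bar>)" y] v by simp
qed

text \<open>The Green function is \<open>ker a / (2 h\<^sup>2 a)\<close>. Its derivative \<open>kerd\<close> jumps at \<open>0\<close>, where it is set to \<open>0\<close>.\<close>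

definition ker :: "complex \<Rightarrow> real \<Rightarrow> complex" where
  "ker a t = exp (- a * of_real \<bar>t\<bar>)"

definition kerd :: "complex \<Rightarrow> real \<Rightarrow> complex" where
  "kerd a t = - a * of_real (sgn t) * ker a t"

lemma norm_ker: "norm (ker a t) = exp (- Re a * \<bar>t\<bar>)"
  by (simp add: ker_def)

lemma norm_kerd_le: "norm (kerd a t) \<le> norm a * exp (- Re a * \<bar>t\<bar>)"
  by (simp add: kerd_def norm_mult norm_ker sgn_if)

lemma measurable_ker [measurable]: "ker a \<in> borel_measurable borel"
  unfolding ker_def by (intro borel_measurable_continuous_onI continuous_intros)

lemma measurable_kerd [measurable]: "kerd a \<in> borel_measurable borel"
  unfolding kerd_def[abs_def] by measurable

text \<open>The exceptional point \<open>c\<close> will be the diagonal of the Green function, where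
  a kernel is continuous without being differentiable.\<close>

lemma ac_deriv_piecewise:
  fixes u q :: "real \<Rightarrow> complex"
  assumes cont: "continuous_on UNIV u" and der: "\<And>x. x \<noteq> c \<Longrightarrow> (u has_vector_derivative q x) (at x)"
    and [measurable]: "q \<in> borel_measurable borel" and bd: "\<And>x. norm (q x) \<le> B"
  shows "ac_deriv u q"
  unfolding ac_deriv_def
proof (intro conjI allI impI)
  have int: "set_integrable lborel {s..t} q" for s t
    unfolding set_integrable_def
  proof (rule Bochner_Integration.integrable_bound[of _ "\<lambda>x. indicator {s..t} x * B"])
    show "integrable lborel (\<lambda>x. indicator {s..t} x * B)"
      by (intro integrable_mult_left integrable_real_indicator) (auto simp: emeasure_lborel_Icc_eq)
    show "AE x in lborel. norm (indicator {s..t} x *\<^sub>R q x) \<le> norm (indicator {s..t} x * B)"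
      using bd by (intro AE_I2) (auto simp: indicator_def intro: order_trans[OF _ abs_ge_self])
  qed simp
  then show "set_integrable lborel {s..t} q" for s t .
  fix s t :: real assume "s \<le> t"
  have "(q has_integral (u t - u s)) {s..t}"
    by (rule fundamental_theorem_of_calculus_interior_strong[of "{c}"])
       (use \<open>s \<le> t\<close> der continuous_on_subset[OF cont] in auto)
  then show "(LINT x:{s..t}|lborel. q x) = u t - u s"
    using set_borel_integral_eq_integral(2)[OF int] by (simp add: integral_unique)
qed

lemma ker_derivatives:
  assumes "t \<noteq> 0"
  shows "(ker a has_vector_derivative kerd a t) (at t)" "(kerd a has_vector_derivative a\<^sup>2 * ker a t) (at t)"
proof -
  have *: "((\<lambda>t. k * exp (c * of_real t)) has_vector_derivative k * c * exp (c * of_real t)) (at t)" for k c :: complex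
  proof -
    have "((\<lambda>z. k * exp (c * z)) has_field_derivative k * c * exp (c * of_real t)) (at (of_real t))"
      by (auto intro!: derivative_eq_intros)
    then show ?thesis by (rule has_vector_derivative_real_field)
  qed
  define S where "S = (if t > 0 then {0<..} else {..<0::real})"
  define \<sigma> where "\<sigma> = (if t > 0 then 1 else - 1 :: real)"
  have S: "open S" "t \<in> S" using assms by (auto simp: S_def)
  have eq: "1 * exp (- a * of_real \<sigma> * of_real x) = ker a x" "(- a * of_real \<sigma>) * exp (- a * of_real \<sigma> * of_real x) = kerd a x" if "x \<in> S" for x
    using that by (auto simp: S_def \<sigma>_def ker_def kerd_def split: if_splits)
  have "(ker a has_vector_derivative 1 * (- a * of_real \<sigma>) * exp (- a * of_real \<sigma> * of_real t)) (at t)"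
    by (rule has_vector_derivative_transform_within_open[OF * S eq(1)])
  then show "(ker a has_vector_derivative kerd a t) (at t)" using eq(2)[OF S(2)] by simp
  have "(kerd a has_vector_derivative (- a * of_real \<sigma>) * (- a * of_real \<sigma>) * exp (- a * of_real \<sigma> * of_real t)) (at t)"
    by (rule has_vector_derivative_transform_within_open[OF * S eq(2)])
  then show "(kerd a has_vector_derivative a\<^sup>2 * ker a t) (at t)"
    using eq(1)[OF S(2)] by (auto simp: power2_eq_square \<sigma>_def split: if_splits)
qed

lemma has_vector_derivative_shift:
  fixes f :: "real \<Rightarrow> complex"
  assumes "(f has_vector_derivative f') (at (x - y))"
  shows "((\<lambda>x. f (x - y)) has_vector_derivative f') (at x)"
proof -
  have "((\<lambda>x. x - y) has_vector_derivative 1) (at x)" by (auto intro!: derivative_eq_intros)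
  from vector_diff_chain_at[OF this] assms show ?thesis by (fastforce simp: o_def)
qed

lemma ac_deriv_ker:
  assumes "0 < Re a"
  shows "ac_deriv (\<lambda>x. ker a (x - y)) (\<lambda>x. kerd a (x - y))"
proof (rule ac_deriv_piecewise[of _ y _ "norm a"])
  show "continuous_on UNIV (\<lambda>x. ker a (x - y))" unfolding ker_def by (intro continuous_intros)
  show "((\<lambda>x. ker a (x - y)) has_vector_derivative kerd a (x - y)) (at x)" if "x \<noteq> y" for x
    using that by (intro has_vector_derivative_shift ker_derivatives) auto
  show "norm (kerd a (x - y)) \<le> norm a" for x
    using assms by (intro order_trans[OF norm_kerd_le] mult_left_le) auto
qed simp

text \<open>Adding a step removes the jump of \<open>kerd\<close> at the diagonal.\<close>

lemma ac_deriv_kerd: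
  assumes "0 < Re a"
  shows "ac_deriv (\<lambda>x. kerd a (x - y) + a * of_real (sgn (x - y))) (\<lambda>x. a\<^sup>2 * ker a (x - y))"
proof (rule ac_deriv_piecewise[of _ y _ "(norm a)\<^sup>2"])
  \<comment> \<open>The mean value inequality for \<open>exp\<close> on the left half-plane, where
    the derivative has norm at most 1, yields continuity at the diagonal.\<close>
  have bound: "norm (kerd a t + a * of_real (sgn t)) \<le> norm a * (norm a * \<bar>t\<bar>)" for t
  proof -
    have "norm (ker a t - 1) \<le> norm a * \<bar>t\<bar>"
    proof -
      have "norm (exp (- a * of_real \<bar>t\<bar>) - exp 0) \<le> 1 * norm (- a * of_real \<bar>t\<bar> - 0)"
      proof (rule field_differentiable_bound[of "{w. Re w \<le> 0}"])
        show "convex {w. Re w \<le> 0}" by (rule convex_halfspace_Re_le)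
        show "(exp has_field_derivative exp w) (at w within {w. Re w \<le> 0})" for w :: complex
          by (rule DERIV_subset[OF DERIV_exp]) simp
      qed (use assms in auto)
      then show ?thesis by (simp add: ker_def norm_mult)
    qed
    moreover have "kerd a t + a * of_real (sgn t) = - a * of_real (sgn t) * (ker a t - 1)"
      by (simp add: kerd_def algebra_simps)
    moreover have "\<bar>sgn t\<bar> \<le> 1" by (simp add: sgn_if)
    ultimately have "norm a * (\<bar>sgn t\<bar> * norm (ker a t - 1)) \<le> norm a * (1 * (norm a * \<bar>t\<bar>))"
      by (intro mult_left_mono mult_mono) auto
    moreover have "norm (- a * of_real (sgn t) * (ker a t - 1)) = norm a * (\<bar>sgn t\<bar> * norm (ker a t - 1))"
      by (simp only: norm_mult norm_of_real norm_minus_cancel mult.assoc)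
    ultimately show ?thesis
      using \<open>kerd a t + a * of_real (sgn t) = - a * of_real (sgn t) * (ker a t - 1)\<close> by simp
  qed
  have "isCont (\<lambda>x. kerd a (x - y) + a * of_real (sgn (x - y))) x" for x
  proof (cases "x = y")
    case True
    have "((\<lambda>x. kerd a (x - y) + a * of_real (sgn (x - y))) \<longlongrightarrow> 0) (at y)"
    proof (rule Lim_null_comparison)
      show "\<forall>\<^sub>F x in at y. norm (kerd a (x - y) + a * of_real (sgn (x - y))) \<le> norm a * (norm a * \<bar>x - y\<bar>)"
        by (intro always_eventually allI bound)
      have "((\<lambda>x. norm a * (norm a * \<bar>x - y\<bar>)) \<longlongrightarrow> norm a * (norm a * \<bar>y - y\<bar>)) (at y)"
        by (intro tendsto_intros)
      then show "((\<lambda>x. norm a * (norm a * \<bar>x - y\<bar>)) \<longlongrightarrow> 0) (at y)" by simp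
    qed
    then show ?thesis using True by (simp add: isCont_def kerd_def)
  next
    case False
    have k: "isCont (\<lambda>x. kerd a (x - y)) x"
      using has_vector_derivative_shift[OF ker_derivatives(2)[of "x - y" a]] False
      by (meson has_vector_derivative_continuous right_minus_eq)
    have s: "isCont (\<lambda>x. sgn (x - y)) x" using False by (intro isCont_sgn continuous_intros) auto
    show ?thesis by (intro continuous_intros k s)
  qed
  then show "continuous_on UNIV (\<lambda>x. kerd a (x - y) + a * of_real (sgn (x - y)))"
    by (simp add: continuous_at_imp_continuous_on)
  show "((\<lambda>x. kerd a (x - y) + a * of_real (sgn (x - y))) has_vector_derivative a\<^sup>2 * ker a (x - y)) (at x)"
    if xy: "x \<noteq> y" for x
  proof -
    have o: "open (if x > y then {y<..} else {..<y})" by simp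
    have "((\<lambda>x. a * of_real (sgn (x - y))) has_vector_derivative 0) (at x)"
      by (rule has_vector_derivative_transform_within_open[OF has_vector_derivative_const[of "a * of_real (sgn (x - y))"] o])
         (use xy in \<open>auto split: if_splits\<close>)
    then show ?thesis
      using has_vector_derivative_add[OF has_vector_derivative_shift[OF ker_derivatives(2)[of "x - y" a]]] xy
      by fastforce
  qed
  show "norm (a\<^sup>2 * ker a (x - y)) \<le> (norm a)\<^sup>2" for x
    using assms by (simp add: norm_mult norm_power norm_ker mult_left_le)
qed simp

text \<open>A common hypothesis for three kinds of sources: bounded functions against a finite
  measure, and L1 or L2 functions against Lebesgue measure. The bound \<open>C\<close>, uniform in
  \<open>x\<close>, justifies the exchanges of integrals and bounds \<open>pot\<close> at the same
  time.\<close>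

definition admissible :: "complex \<Rightarrow> real measure \<Rightarrow> (real \<Rightarrow> complex) \<Rightarrow> real \<Rightarrow> bool" where
  "admissible a m b C \<longleftrightarrow> 0 < Re a \<and> sets m = sets borel \<and> sigma_finite_measure m \<and> b \<in> borel_measurable borel \<and>
     (\<forall>x. integrable m (\<lambda>y. exp (- Re a * \<bar>x - y\<bar>) * norm (b y)) \<and>
          (\<integral>y. exp (- Re a * \<bar>x - y\<bar>) * norm (b y) \<partial>m) \<le> C)"

text \<open>The potential of the measure \<open>b m\<close>, without the normalising factor
  \<open>1 / (2 h^2 a)\<close> of the Green function, which is added later as
  \<open>g0\<close>.\<close>

definition pot :: "complex \<Rightarrow> real measure \<Rightarrow> (real \<Rightarrow> complex) \<Rightarrow> real \<Rightarrow> complex" where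
  "pot a m b x = (\<integral>y. ker a (x - y) * b y \<partial>m)"

definition potd :: "complex \<Rightarrow> real measure \<Rightarrow> (real \<Rightarrow> complex) \<Rightarrow> real \<Rightarrow> complex" where
  "potd a m b x = (\<integral>y. kerd a (x - y) * b y \<partial>m)"

lemma admissible_integrable:
  assumes adm: "admissible a m b C" and [measurable]: "K \<in> borel_measurable borel"
    and K: "\<And>t. norm (K t) \<le> c * exp (- Re a * \<bar>t\<bar>)"
  shows "integrable m (\<lambda>y. K (x - y) * b y :: complex)"
    "norm (\<integral>y. K (x - y) * b y \<partial>m) \<le> c * (\<integral>y. exp (- Re a * \<bar>x - y\<bar>) * norm (b y) \<partial>m)"
    "(\<lambda>x. \<integral>y. K (x - y) * b y \<partial>m) \<in> borel_measurable borel"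
proof -
  have st: "sets m = sets borel" and [measurable]: "b \<in> borel_measurable borel"
    and i: "integrable m (\<lambda>y. exp (- Re a * \<bar>x - y\<bar>) * norm (b y))"
    and sf: "sigma_finite_measure m" for x
    using adm by (auto simp: admissible_def)
  note [measurable_cong] = st
  have le: "norm (K (x - y) * b y) \<le> c * (exp (- Re a * \<bar>x - y\<bar>) * norm (b y))" for x y
    using mult_right_mono[OF K[of "x - y"], of "norm (b y)"] by (simp add: norm_mult mult.assoc)
  show int: "integrable m (\<lambda>y. K (x - y) * b y)" for x
    by (rule Bochner_Integration.integrable_bound[OF integrable_mult_right[OF i[of x], of c]])
       (use le order_trans[OF le abs_ge_self] in \<open>auto simp del: abs_mult\<close>)
  show "norm (\<integral>y. K (x - y) * b y \<partial>m) \<le> c * (\<integral>y. exp (- Re a * \<bar>x - y\<bar>) * norm (b y) \<partial>m)"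
  proof -
    have "norm (\<integral>y. K (x - y) * b y \<partial>m) \<le> (\<integral>y. norm (K (x - y) * b y) \<partial>m)" by (rule integral_norm_bound)
    also have "\<dots> \<le> (\<integral>y. c * (exp (- Re a * \<bar>x - y\<bar>) * norm (b y)) \<partial>m)"
      by (rule integral_mono[OF integrable_norm[OF int] integrable_mult_right[OF i] le])
    finally show ?thesis by simp
  qed
  show "(\<lambda>x. \<integral>y. K (x - y) * b y \<partial>m) \<in> borel_measurable borel"
  proof (rule sigma_finite_measure.borel_measurable_lebesgue_integral[OF sf])
    have "(\<lambda>(x, y). K (x - y) * b y) \<in> borel_measurable (borel \<Otimes>\<^sub>M borel)" by measurable
    then show "(\<lambda>(x, y). K (x - y) * b y) \<in> borel_measurable (borel \<Otimes>\<^sub>M m)"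
      by (simp only: measurable_cong_sets[OF sets_pair_measure_cong[OF refl st] refl])
  qed
qed

text \<open>The uniform bound \<open>C\<close> makes the double integral absolutely convergent for
  every integrable \<psi>. A test function as \<psi> moves derivatives to the kernel; an indicator
  gives absolute continuity of the potential.\<close>

lemma admissible_Fubini:
  assumes adm: "admissible a m b C" and [measurable]: "K \<in> borel_measurable borel"
    and K: "\<And>t. norm (K t) \<le> c * exp (- Re a * \<bar>t\<bar>)" and \<psi>: "integrable lborel (\<psi> :: real \<Rightarrow> complex)"
  shows "integrable m (\<lambda>y. (LBINT x. K (x - y) * \<psi> x) * b y)"
    "(LBINT x. (\<integral>y. K (x - y) * b y \<partial>m) * \<psi> x) = (\<integral>y. (LBINT x. K (x - y) * \<psi> x) * b y \<partial>m)"
    "integrable lborel (\<lambda>x. (\<integral>y. K (x - y) * b y \<partial>m) * \<psi> x)"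
proof -
  have st: "sets m = sets borel" and [measurable]: "b \<in> borel_measurable borel"
    and i: "integrable m (\<lambda>y. exp (- Re a * \<bar>x - y\<bar>) * norm (b y))"
    and C: "(\<integral>y. exp (- Re a * \<bar>x - y\<bar>) * norm (b y) \<partial>m) \<le> C"
    and sf: "sigma_finite_measure m" for x
    using adm by (auto simp: admissible_def)
  note [measurable_cong] = st
  have [measurable]: "\<psi> \<in> borel_measurable borel" using \<psi> by simp
  interpret m: sigma_finite_measure m by (rule sf)
  interpret P: pair_sigma_finite lborel m by standard
  have c0: "0 \<le> c" using K[of 0] by (simp add: order_trans[OF norm_ge_zero])
  have le: "norm (K (x - y) * b y) \<le> c * (exp (- Re a * \<bar>x - y\<bar>) * norm (b y))" for x y
    using mult_right_mono[OF K[of "x - y"], of "norm (b y)"] by (simp add: norm_mult mult.assoc)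
  note int = admissible_integrable(1)[OF adm _ K]
  have F: "integrable (lborel \<Otimes>\<^sub>M m) (\<lambda>(x, y). K (x - y) * b y * \<psi> x)"
  proof (rule P.Fubini_integrable)
    show "integrable lborel (\<lambda>x. \<integral>y. norm ((\<lambda>(x, y). K (x - y) * b y * \<psi> x) (x, y)) \<partial>m)"
    proof (rule Bochner_Integration.integrable_bound[OF integrable_mult_right[OF integrable_norm[OF \<psi>], of "c * C"]])
      show "AE x in lborel. norm (\<integral>y. norm ((\<lambda>(x, y). K (x - y) * b y * \<psi> x) (x, y)) \<partial>m) \<le> norm (c * C * norm (\<psi> x))"
      proof (rule AE_I2)
        fix x
        have "(\<integral>y. norm (K (x - y) * b y) \<partial>m) \<le> (\<integral>y. c * (exp (- Re a * \<bar>x - y\<bar>) * norm (b y)) \<partial>m)"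
          by (rule integral_mono[OF integrable_norm[OF int] integrable_mult_right[OF i] le]) simp
        also have "\<dots> \<le> c * C" using C[of x] c0 by (simp add: mult_left_mono)
        finally have "(\<integral>y. norm (K (x - y) * b y) \<partial>m) * norm (\<psi> x) \<le> c * C * norm (\<psi> x)"
          by (rule mult_right_mono) simp
        moreover have "(\<integral>y. norm ((\<lambda>(x, y). K (x - y) * b y * \<psi> x) (x, y)) \<partial>m)
            = (\<integral>y. norm (K (x - y) * b y) \<partial>m) * norm (\<psi> x)"
          by (simp add: norm_mult)
        moreover have "0 \<le> (\<integral>y. norm (K (x - y) * b y) \<partial>m) * norm (\<psi> x)" by simp
        ultimately show "norm (\<integral>y. norm ((\<lambda>(x, y). K (x - y) * b y * \<psi> x) (x, y)) \<partial>m) \<le> norm (c * C * norm (\<psi> x))"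
          unfolding real_norm_def by linarith
      qed
    qed simp
    show "AE x in lborel. integrable m (\<lambda>y. (\<lambda>(x, y). K (x - y) * b y * \<psi> x) (x, y))"
      using int by (intro AE_I2) simp
  qed simp
  have e1: "(\<integral>y. K (x - y) * b y * \<psi> x \<partial>m) = (\<integral>y. K (x - y) * b y \<partial>m) * \<psi> x" for x by simp
  have e2: "(LBINT x. K (x - y) * b y * \<psi> x) = (LBINT x. K (x - y) * \<psi> x) * b y" for y
    by (subst integral_mult_left_zero[symmetric]) (simp add: mult_ac)
  show "integrable m (\<lambda>y. (LBINT x. K (x - y) * \<psi> x) * b y)"
    using P.integrable_snd[OF F] by (simp add: e2)
  show "integrable lborel (\<lambda>x. (\<integral>y. K (x - y) * b y \<partial>m) * \<psi> x)"
    using P.integrable_fst'[OF F] by (simp add: e1)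
  show "(LBINT x. (\<integral>y. K (x - y) * b y \<partial>m) * \<psi> x) = (\<integral>y. (LBINT x. K (x - y) * \<psi> x) * b y \<partial>m)"
    using P.Fubini_integral[OF F] by (simp add: e1 e2)
qed

lemma ker_bound: "norm (ker a t) \<le> 1 * exp (- Re a * \<bar>t\<bar>)" by (simp add: norm_ker)

lemma
  assumes adm: "admissible a m b C"
  shows norm_pot_le: "norm (pot a m b x) \<le> (\<integral>y. exp (- Re a * \<bar>x - y\<bar>) * norm (b y) \<partial>m)"
    and norm_potd_le: "norm (potd a m b x) \<le> norm a * (\<integral>y. exp (- Re a * \<bar>x - y\<bar>) * norm (b y) \<partial>m)"
    and norm_pot_le_const: "norm (pot a m b x) \<le> C"
    and norm_potd_le_const: "norm (potd a m b x) \<le> norm a * C"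
    and measurable_pot: "pot a m b \<in> borel_measurable borel"
    and measurable_potd: "potd a m b \<in> borel_measurable borel"
proof -
  show 1: "norm (pot a m b x) \<le> (\<integral>y. exp (- Re a * \<bar>x - y\<bar>) * norm (b y) \<partial>m)"
    using admissible_integrable(2)[OF adm measurable_ker ker_bound] by (simp add: pot_def)
  show 2: "norm (potd a m b x) \<le> norm a * (\<integral>y. exp (- Re a * \<bar>x - y\<bar>) * norm (b y) \<partial>m)"
    using admissible_integrable(2)[OF adm measurable_kerd norm_kerd_le] by (simp add: potd_def)
  have 3: "(\<integral>y. exp (- Re a * \<bar>x - y\<bar>) * norm (b y) \<partial>m) \<le> C" using adm by (simp add: admissible_def)
  show "norm (pot a m b x) \<le> C" using 1 3 by linarith
  show "norm (potd a m b x) \<le> norm a * C" by (rule order_trans[OF 2 mult_left_mono[OF 3]]) simp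
  show "pot a m b \<in> borel_measurable borel"
    using admissible_integrable(3)[OF adm measurable_ker ker_bound] by (simp add: pot_def[abs_def])
  show "potd a m b \<in> borel_measurable borel"
    using admissible_integrable(3)[OF adm measurable_kerd norm_kerd_le] by (simp add: potd_def[abs_def])
qed

lemma integrable_indicator_complex: "complex_integrable lborel (indicator {s..t::real})"
proof -
  have "complex_integrable lborel (\<lambda>x. of_real (indicator {s..t} x))"
    by (intro integrable_of_real integrable_real_indicator) (auto simp: emeasure_lborel_Icc_eq)
  moreover have "(\<lambda>x. of_real (indicator {s..t} x)) = (indicator {s..t} :: real \<Rightarrow> complex)"
    by (auto simp: indicator_def)
  ultimately show ?thesis by simp
qed

text \<open>\<open>admissible_Fubini\<close> with the indicator of an interval reduces this to the
  fundamental theorem for the kernel, so nothing is differentiated under the integral.\<close>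

lemma ac_deriv_pot:
  assumes adm: "admissible a m b C"
  shows "ac_deriv (pot a m b) (potd a m b)"
  unfolding ac_deriv_def
proof (intro conjI allI impI)
  fix s t :: real
  have a: "0 < Re a" using adm by (simp add: admissible_def)
  have swap: "indicator {s..t} x *\<^sub>R potd a m b x = (\<integral>y. kerd a (x - y) * b y \<partial>m) * indicator {s..t} x" for x
    by (simp add: potd_def indicator_def)
  note F = admissible_Fubini[OF adm measurable_kerd norm_kerd_le integrable_indicator_complex[of s t]]
  show "set_integrable lborel {s..t} (potd a m b)"
    using F(3) unfolding set_integrable_def swap .
  assume st: "s \<le> t"
  have "indicator {s..t} x *\<^sub>R w = w * indicator {s..t} x" for x and w :: complex
    by (simp add: indicator_def)
  then have "(LBINT x. kerd a (x - y) * indicator {s..t} x) = ker a (t - y) - ker a (s - y)" for y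
    using ac_derivD(2)[OF ac_deriv_ker[OF a] st, of y] by (simp add: set_lebesgue_integral_def)
  then have "(LINT x:{s..t}|lborel. potd a m b x) = (\<integral>y. (ker a (t - y) - ker a (s - y)) * b y \<partial>m)"
    using F(2) unfolding set_lebesgue_integral_def swap by simp
  also have "\<dots> = pot a m b t - pot a m b s"
    using admissible_integrable(1)[OF adm measurable_ker ker_bound]
    by (simp add: pot_def left_diff_distrib)
  finally show "(LINT x:{s..t}|lborel. potd a m b x) = pot a m b t - pot a m b s" .
qed

lemma test_function_integrable:
  assumes "test_function \<phi>"
  shows "integrable lborel \<phi>"
proof -
  have "set_integrable lborel {s..t} (\<lambda>x. 1 :: complex)" for s t :: real
    by (rule borel_integrable_atLeastAtMost') simp
  from integrable_locally_mult_test[OF this assms] show ?thesis by simp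
qed

text \<open>The weak form of \<open>kerd' = a^2 ker - 2 a delta\<close>. The continuous function
  \<open>kerd + a sgn\<close> is integrated by parts, and the step alone contributes
  \<open>- 2 * \<phi> y\<close>.\<close>

lemma kerd_mult_vderiv_test:
  assumes a: "0 < Re a" and \<phi>: "test_function \<phi>"
  shows "(LBINT x. kerd a (x - y) * vderiv \<phi> x) = 2 * a * \<phi> y - a\<^sup>2 * (LBINT x. ker a (x - y) * \<phi> x)"
proof -
  note \<phi>' = test_function_vderiv[OF \<phi>]
  have sm: "smooth \<phi>" using \<phi> by (simp add: test_function_iff)
  obtain R where R: "\<And>x. R < \<bar>x\<bar> \<Longrightarrow> \<phi> x = 0" using \<phi> by (auto simp: test_function_iff)
  obtain R' where R': "\<And>x. R' < \<bar>x\<bar> \<Longrightarrow> vderiv \<phi> x = 0" using \<phi>' by (auto simp: test_function_iff)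
  \<comment> \<open>Beyond both supports and beyond \<open>y\<close>, so that the step splits into
    two intervals whose outer boundary values vanish.\<close>
  define r where "r = max \<bar>R\<bar> \<bar>R'\<bar> + \<bar>y\<bar> + 1"
  have r: "\<phi> x = 0" "vderiv \<phi> x = 0" if "r \<le> \<bar>x\<bar>" for x using R[of x] R'[of x] that by (auto simp: r_def)
  have i': "integrable lborel (vderiv \<phi>)" by (rule test_function_integrable[OF \<phi>'])
  have [measurable]: "vderiv \<phi> \<in> borel_measurable borel" using i' by simp
  have acp: "ac_deriv \<phi> (vderiv \<phi>)"
    by (intro ac_deriv_C1 smooth_has_vector_derivative sm test_function_continuous \<phi>')
  have "(LBINT x. of_real (sgn (x - y)) * vderiv \<phi> x) =
      (LBINT x. indicator {y..r} x *\<^sub>R vderiv \<phi> x - indicator {- r..y} x *\<^sub>R vderiv \<phi> x)"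
  proof (rule integral_cong_AE)
    show "AE x in lborel. of_real (sgn (x - y)) * vderiv \<phi> x =
        indicator {y..r} x *\<^sub>R vderiv \<phi> x - indicator {- r..y} x *\<^sub>R vderiv \<phi> x"
    proof (rule AE_mp[OF AE_lborel_singleton[of y] AE_I2], rule impI)
      fix x assume "x \<noteq> y"
      then show "of_real (sgn (x - y)) * vderiv \<phi> x =
        indicator {y..r} x *\<^sub>R vderiv \<phi> x - indicator {- r..y} x *\<^sub>R vderiv \<phi> x"
        using r(2)[of x] by (cases "r \<le> \<bar>x\<bar>") (auto simp: indicator_def sgn_if)
    qed
  qed auto
  also have "\<dots> = (LINT x:{y..r}|lborel. vderiv \<phi> x) - (LINT x:{- r..y}|lborel. vderiv \<phi> x)"
    unfolding set_lebesgue_integral_def using i'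
    by (intro Bochner_Integration.integral_diff integrable_mult_indicator) auto
  also have "\<dots> = - 2 * \<phi> y"
    using ac_derivD(2)[OF acp, of y r] ac_derivD(2)[OF acp, of "- r" y] r(1)[of r] r(1)[of "- r"]
    by (simp add: r_def)
  finally have sg: "(LBINT x. of_real (sgn (x - y)) * vderiv \<phi> x) = - 2 * \<phi> y" .
  have isg: "integrable lborel (\<lambda>x. of_real (sgn (x - y)) * vderiv \<phi> x)"
    by (rule Bochner_Integration.integrable_bound[OF i']) (auto simp: norm_mult sgn_if)
  have "integrable lborel (\<lambda>x. norm a *\<^sub>R vderiv \<phi> x)" using i' by simp
  then have ik: "integrable lborel (\<lambda>x. kerd a (x - y) * vderiv \<phi> x)"
  proof (rule Bochner_Integration.integrable_bound)
    have "norm (kerd a t) \<le> norm a" for t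
      using a by (intro order_trans[OF norm_kerd_le] mult_left_le) auto
    then show "AE x in lborel. norm (kerd a (x - y) * vderiv \<phi> x) \<le> norm (norm a *\<^sub>R vderiv \<phi> x)"
      by (intro AE_I2) (auto simp: norm_mult mult_right_mono)
  qed simp
  have "(LBINT x. (kerd a (x - y) + a * of_real (sgn (x - y))) * vderiv \<phi> x) =
      - (LBINT x. a\<^sup>2 * ker a (x - y) * \<phi> x)"
    by (rule integral_mult_vderiv_test[OF ac_deriv_kerd[OF a] \<phi>])
  also have "(LBINT x. (kerd a (x - y) + a * of_real (sgn (x - y))) * vderiv \<phi> x) =
      (LBINT x. kerd a (x - y) * vderiv \<phi> x) + a * (LBINT x. of_real (sgn (x - y)) * vderiv \<phi> x)"
    using ik isg by (simp add: distrib_right mult.assoc)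
  also have "(LBINT x. a\<^sup>2 * ker a (x - y) * \<phi> x) = a\<^sup>2 * (LBINT x. ker a (x - y) * \<phi> x)"
    by (simp add: mult.assoc)
  finally show ?thesis unfolding sg by (simp add: algebra_simps)
qed

text \<open>The distributional equation \<open>pot'' - a^2 pot = - 2 a b m\<close>, obtained by
  integrating the identity for the kernel against \<open>b m\<close>.\<close>

theorem pot_second_derivative_test:
  assumes adm: "admissible a m b C" and \<phi>: "test_function \<phi>"
  shows "integrable m (\<lambda>y. b y * \<phi> y)"
    "(LBINT x. pot a m b x * vderiv (vderiv \<phi>) x) =
       a\<^sup>2 * (LBINT x. pot a m b x * \<phi> x) - 2 * a * (\<integral>y. b y * \<phi> y \<partial>m)"
proof -
  have a: "0 < Re a" using adm by (simp add: admissible_def)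
  then have a0: "a \<noteq> 0" by auto
  note \<phi>' = test_function_vderiv[OF \<phi>]
  note F1 = admissible_Fubini[OF adm measurable_kerd norm_kerd_le test_function_integrable[OF \<phi>']]
  note F2 = admissible_Fubini[OF adm measurable_ker ker_bound test_function_integrable[OF \<phi>]]
  \<comment> \<open>\<open>b \<phi>\<close> is recovered as a combination of two integrands already
    known to be integrable, which works for infinite \<open>m\<close> too.\<close>
  have "integrable m (\<lambda>y. (1 / (2 * a)) * ((2 * a * \<phi> y - a\<^sup>2 * (LBINT x. ker a (x - y) * \<phi> x)) * b y
      + a\<^sup>2 * ((LBINT x. ker a (x - y) * \<phi> x) * b y)))"
    using F1(1) F2(1) unfolding kerd_mult_vderiv_test[OF a \<phi>]
    by (intro integrable_mult_right Bochner_Integration.integrable_add)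
  moreover have "(1 / (2 * a)) * ((2 * a * \<phi> y - a\<^sup>2 * I) * b y + a\<^sup>2 * (I * b y)) = b y * \<phi> y" for y I
    using a0 by (simp add: field_simps)
  ultimately show ib: "integrable m (\<lambda>y. b y * \<phi> y)" by simp
  have "(LBINT x. pot a m b x * vderiv (vderiv \<phi>) x) = - (LBINT x. potd a m b x * vderiv \<phi> x)"
    by (rule integral_mult_vderiv_test[OF ac_deriv_pot[OF adm] \<phi>'])
  also have "(LBINT x. potd a m b x * vderiv \<phi> x) =
      (\<integral>y. (2 * a * \<phi> y - a\<^sup>2 * (LBINT x. ker a (x - y) * \<phi> x)) * b y \<partial>m)"
    using F1(2) unfolding kerd_mult_vderiv_test[OF a \<phi>] by (simp add: potd_def)
  also have "\<dots> = (\<integral>y. 2 * a * (b y * \<phi> y) - a\<^sup>2 * ((LBINT x. ker a (x - y) * \<phi> x) * b y) \<partial>m)"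
    by (simp add: algebra_simps)
  also have "\<dots> = 2 * a * (\<integral>y. b y * \<phi> y \<partial>m) - a\<^sup>2 * (\<integral>y. (LBINT x. ker a (x - y) * \<phi> x) * b y \<partial>m)"
    using ib F2(1) by simp
  also have "(\<integral>y. (LBINT x. ker a (x - y) * \<phi> x) * b y \<partial>m) = (LBINT x. pot a m b x * \<phi> x)"
    using F2(2) by (simp add: pot_def)
  finally show "(LBINT x. pot a m b x * vderiv (vderiv \<phi>) x) =
       a\<^sup>2 * (LBINT x. pot a m b x * \<phi> x) - 2 * a * (\<integral>y. b y * \<phi> y \<partial>m)" by simp
qed

text \<open>When \<open>b\<close> is a density with respect to Lebesgue measure, the second
  derivative of the potential is a function, so \<open>potd\<close> has an absolutely continuous
  version. At this point an integral equation with a mollified potential turns into an ODE.\<close>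

lemma ac_deriv_potd_lborel:
  assumes adm: "admissible a lborel b C" and b: "\<And>s t. set_integrable lborel {s..t} b"
  obtains q where "ac_deriv q (\<lambda>x. a\<^sup>2 * pot a lborel b x - 2 * a * b x)" "AE x in lborel. q x = potd a lborel b x"
proof (rule du_Bois_Reymond)
  show "set_integrable lborel {s..t} (potd a lborel b)" for s t by (rule ac_derivD(1)[OF ac_deriv_pot[OF adm]])
  have pc: "set_integrable lborel {s..t} (pot a lborel b)" for s t
    by (rule borel_integrable_atLeastAtMost') (rule continuous_on_subset[OF ac_deriv_continuous[OF ac_deriv_pot[OF adm]]], simp)
  show "set_integrable lborel {s..t} (\<lambda>x. a\<^sup>2 * pot a lborel b x - 2 * a * b x)" for s t
    by (intro set_integral_diff set_integrable_mult_right pc b)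
  fix \<phi> assume \<phi>: "test_function \<phi>"
  have "(LBINT x. potd a lborel b x * vderiv \<phi> x) = - (LBINT x. pot a lborel b x * vderiv (vderiv \<phi>) x)"
    using integral_mult_vderiv_test[OF ac_deriv_pot[OF adm] test_function_vderiv[OF \<phi>]] by simp
  also have "\<dots> = - (LBINT x. (a\<^sup>2 * pot a lborel b x - 2 * a * b x) * \<phi> x)"
    using pot_second_derivative_test[OF adm \<phi>] integrable_locally_mult_test[OF pc \<phi>]
    by (simp add: left_diff_distrib mult.assoc)
  finally show "(LBINT x. potd a lborel b x * vderiv \<phi> x) = - (LBINT x. (a\<^sup>2 * pot a lborel b x - 2 * a * b x) * \<phi> x)" .
qed (use that in blast)

lemma integrable_conv_exp:
  fixes m :: "real measure" and g :: "real \<Rightarrow> real"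
  assumes st: "sets m = sets borel" and sf: "sigma_finite_measure m" and \<alpha>: "0 < \<alpha>"
    and g: "integrable m g" "\<And>y. 0 \<le> g y"
  shows "integrable lborel (\<lambda>x. \<integral>y. exp (- \<alpha> * \<bar>x - y\<bar>) * g y \<partial>m)"
    "(LBINT x. (\<integral>y. exp (- \<alpha> * \<bar>x - y\<bar>) * g y \<partial>m)) = 2 / \<alpha> * (\<integral>y. g y \<partial>m)"
proof -
  note [measurable_cong] = st
  interpret m: sigma_finite_measure m by (rule sf)
  interpret P: pair_sigma_finite m lborel by standard
  interpret Q: pair_sigma_finite lborel m by standard
  have [measurable]: "g \<in> borel_measurable m" using g by simp
  have F: "integrable (m \<Otimes>\<^sub>M lborel) (\<lambda>(y, x). exp (- \<alpha> * \<bar>x - y\<bar>) * g y)"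
    using g exp_minus_abs_integral[OF \<alpha>] by (intro P.Fubini_integrable) (auto simp: abs_mult)
  show "integrable lborel (\<lambda>x. \<integral>y. exp (- \<alpha> * \<bar>x - y\<bar>) * g y \<partial>m)"
    using P.integrable_snd[OF F] by simp
  show "(LBINT x. (\<integral>y. exp (- \<alpha> * \<bar>x - y\<bar>) * g y \<partial>m)) = 2 / \<alpha> * (\<integral>y. g y \<partial>m)"
    using P.Fubini_integral[OF F] exp_minus_abs_integral[OF \<alpha>] by simp
qed

lemma admissible_finite:
  assumes "0 < Re a" "sets m = sets borel" "finite_measure m" "b \<in> borel_measurable borel" "\<And>y. norm (b y) \<le> \<beta>"
  shows "admissible a m b (\<beta> * measure m UNIV)"
  unfolding admissible_def
proof (intro conjI allI)
  note [measurable_cong] = assms(2)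
  interpret m: finite_measure m by fact
  have [measurable]: "b \<in> borel_measurable borel" by fact
  show "sigma_finite_measure m" by standard
  have le: "exp (- Re a * \<bar>x - y\<bar>) * norm (b y) \<le> \<beta>" for x y
  proof -
    have "exp (- Re a * \<bar>x - y\<bar>) * norm (b y) \<le> 1 * \<beta>"
      using assms by (intro mult_mono) auto
    then show ?thesis by simp
  qed
  show int: "integrable m (\<lambda>y. exp (- Re a * \<bar>x - y\<bar>) * norm (b y))" for x
    by (rule m.integrable_const_bound[where B = \<beta>]) (use le in \<open>auto simp: abs_mult\<close>)
  have sp: "space m = UNIV" using sets_eq_imp_space_eq[OF assms(2)] by simp
  show "(\<integral>y. exp (- Re a * \<bar>x - y\<bar>) * norm (b y) \<partial>m) \<le> \<beta> * measure m UNIV" for x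
  proof -
    have "(\<integral>y. exp (- Re a * \<bar>x - y\<bar>) * norm (b y) \<partial>m) \<le> (\<integral>y. \<beta> \<partial>m)"
      by (rule integral_mono[OF int _ le]) simp
    then show ?thesis by (simp add: sp mult.commute)
  qed
qed (use assms in auto)

lemma admissible_L1:
  assumes "0 < Re a" "integrable lborel b"
  shows "admissible a lborel b (LBINT y. norm (b y))"
  unfolding admissible_def
proof (intro conjI allI)
  have [measurable]: "b \<in> borel_measurable borel" using assms(2) by simp
  have le: "exp (- Re a * \<bar>x - y\<bar>) * norm (b y) \<le> norm (b y)" for x y
    using assms by (intro mult_left_le_one_le) auto
  show int: "integrable lborel (\<lambda>y. exp (- Re a * \<bar>x - y\<bar>) * norm (b y))" for x
    by (rule Bochner_Integration.integrable_bound[OF integrable_norm[OF assms(2)]]) (use le in auto)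
  show "(LBINT y. exp (- Re a * \<bar>x - y\<bar>) * norm (b y)) \<le> (LBINT y. norm (b y))" for x
    by (rule integral_mono[OF int integrable_norm[OF assms(2)] le])
qed (use assms sigma_finite_lborel in auto)

text \<open>AM-GM splits the integrand into \<open>exp (- 2 Re a |x - y|)\<close>, of integral
  \<open>1 / Re a\<close>, and the squared norm of \<open>b\<close>.\<close>

lemma admissible_L2:
  assumes a: "0 < Re a" and [measurable]: "b \<in> borel_measurable borel"
    and b: "integrable lborel (\<lambda>y. (norm (b y))\<^sup>2)"
  shows "admissible a lborel b (1 / Re a + (LBINT y. (norm (b y))\<^sup>2))"
  unfolding admissible_def
proof (intro conjI allI)
  have le: "exp (- Re a * \<bar>x - y\<bar>) * norm (b y) \<le> exp (- (2 * Re a) * \<bar>x - y\<bar>) + (norm (b y))\<^sup>2" for x y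
  proof -
    have "0 \<le> exp (- Re a * \<bar>x - y\<bar>) * norm (b y)" by simp
    moreover have "exp (- (2 * Re a) * \<bar>x - y\<bar>) = (exp (- Re a * \<bar>x - y\<bar>))\<^sup>2"
      by (simp add: exp_double[symmetric] power2_eq_square flip: exp_add)
    ultimately show ?thesis
      using sum_squares_bound[of "exp (- Re a * \<bar>x - y\<bar>)" "norm (b y)"] by linarith
  qed
  have i: "integrable lborel (\<lambda>y. exp (- (2 * Re a) * \<bar>x - y\<bar>) + (norm (b y))\<^sup>2)" for x
    using exp_minus_abs_integral(3)[of "2 * Re a"] a b by (intro Bochner_Integration.integrable_add) auto
  show int: "integrable lborel (\<lambda>y. exp (- Re a * \<bar>x - y\<bar>) * norm (b y))" for x
    by (rule Bochner_Integration.integrable_bound[OF i[of x]])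
       (use order_trans[OF le abs_ge_self] in auto)
  have "(LBINT y. exp (- Re a * \<bar>x - y\<bar>) * norm (b y))
      \<le> (LBINT y. exp (- (2 * Re a) * \<bar>x - y\<bar>) + (norm (b y))\<^sup>2)" for x
    by (rule integral_mono[OF int i le])
  also have "(LBINT y. exp (- (2 * Re a) * \<bar>x - y\<bar>) + (norm (b y))\<^sup>2) = 1 / Re a + (LBINT y. (norm (b y))\<^sup>2)" for x
    using exp_minus_abs_integral(3,4)[of "2 * Re a" x] a b by (subst Bochner_Integration.integral_add) auto
  finally show "(LBINT y. exp (- Re a * \<bar>x - y\<bar>) * norm (b y)) \<le> 1 / Re a + (LBINT y. (norm (b y))\<^sup>2)" for x .
qed (use a sigma_finite_lborel in auto)

lemma pot_add:
  assumes "admissible a m b C" "admissible a m c D"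
  shows "pot a m (\<lambda>y. b y + c y) x = pot a m b x + pot a m c x"
  using admissible_integrable(1)[OF assms(1) measurable_ker ker_bound]
    admissible_integrable(1)[OF assms(2) measurable_ker ker_bound]
  by (simp add: pot_def distrib_left)

lemma pot_diff:
  assumes "admissible a m b C" "admissible a m c D"
  shows "pot a m (\<lambda>y. b y - c y) x = pot a m b x - pot a m c x"
  using admissible_integrable(1)[OF assms(1) measurable_ker ker_bound]
    admissible_integrable(1)[OF assms(2) measurable_ker ker_bound]
  by (simp add: pot_def right_diff_distrib)

lemma pot_cmult: "pot a m (\<lambda>y. k * b y) x = k * pot a m b x"
proof -
  have eq: "ker a (x - y) * (k * b y) = k * (ker a (x - y) * b y)" for y by simp
  show ?thesis unfolding pot_def eq by (rule integral_mult_right_zero)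
qed

text \<open>Interpolation between the uniform bound and the L1 bound of the convolution
  \<open>k\<close>: \<open>k^2 <= C k\<close>.\<close>

lemma pot_square_integrable_L1:
  assumes adm: "admissible a m b C" and b: "integrable m b"
  shows "integrable lborel (\<lambda>x. (norm (pot a m b x))\<^sup>2)" "integrable lborel (\<lambda>x. (norm (potd a m b x))\<^sup>2)"
    "(LBINT x. (norm (pot a m b x))\<^sup>2) \<le> C * (2 / Re a * (\<integral>y. norm (b y) \<partial>m))"
proof -
  define k where "k x = (\<integral>y. exp (- Re a * \<bar>x - y\<bar>) * norm (b y) \<partial>m)" for x
  have a: "0 < Re a" and st: "sets m = sets borel" and sf: "sigma_finite_measure m" and kC: "k x \<le> C" for x
    using adm by (auto simp: admissible_def k_def)
  note [measurable] = measurable_pot[OF adm] measurable_potd[OF adm]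
  have k: "integrable lborel k" "(LBINT x. k x) = 2 / Re a * (\<integral>y. norm (b y) \<partial>m)"
    using integrable_conv_exp[OF st sf a, of "\<lambda>y. norm (b y)"] b unfolding k_def by auto
  have k0: "0 \<le> k x" for x unfolding k_def by simp
  have p: "norm (pot a m b x) \<le> k x" and d: "norm (potd a m b x) \<le> norm a * k x" for x
    unfolding k_def by (rule norm_pot_le[OF adm] norm_potd_le[OF adm])+
  have kk: "k x * k x \<le> C * k x" for x by (intro mult_right_mono kC k0)
  have p2: "(norm (pot a m b x))\<^sup>2 \<le> C * k x" for x
    using power_mono[OF p[of x], of 2] kk[of x] by (simp add: power2_eq_square)
  show i: "integrable lborel (\<lambda>x. (norm (pot a m b x))\<^sup>2)"
    by (rule Bochner_Integration.integrable_bound[OF integrable_mult_right[OF k(1), of C]])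
       (use order_trans[OF p2 abs_ge_self] in auto)
  have d2: "(norm (potd a m b x))\<^sup>2 \<le> (norm a)\<^sup>2 * C * k x" for x
  proof -
    have "(norm (potd a m b x))\<^sup>2 \<le> (norm a)\<^sup>2 * (k x * k x)"
      using power_mono[OF d[of x], of 2] by (simp add: power2_eq_square mult_ac)
    also have "\<dots> \<le> (norm a)\<^sup>2 * (C * k x)" by (rule mult_left_mono[OF kk]) simp
    finally show ?thesis by simp
  qed
  show "integrable lborel (\<lambda>x. (norm (potd a m b x))\<^sup>2)"
    by (rule Bochner_Integration.integrable_bound[OF integrable_mult_right[OF k(1), of "(norm a)\<^sup>2 * C"]])
       (use order_trans[OF d2 abs_ge_self] in auto)
  have "(LBINT x. (norm (pot a m b x))\<^sup>2) \<le> (LBINT x. C * k x)"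
    by (rule integral_mono[OF i _ p2]) (use k in simp)
  then show "(LBINT x. (norm (pot a m b x))\<^sup>2) \<le> C * (2 / Re a * (\<integral>y. norm (b y) \<partial>m))"
    using k by simp
qed

text \<open>Cauchy-Schwarz with the exponential as weight gives \<open>k^2 <= (2 / Re a) P\<close>,
  and the integral of \<open>P\<close> is \<open>2 / Re a\<close> times that of the squared norm of
  \<open>b\<close>.\<close>

lemma pot_square_integrable_L2:
  assumes a: "0 < Re a" and [measurable]: "b \<in> borel_measurable borel"
    and b: "integrable lborel (\<lambda>y. (norm (b y))\<^sup>2)"
  shows "integrable lborel (\<lambda>x. (norm (pot a lborel b x))\<^sup>2)" "integrable lborel (\<lambda>x. (norm (potd a lborel b x))\<^sup>2)"
    "(LBINT x. (norm (pot a lborel b x))\<^sup>2) \<le> (2 / Re a)\<^sup>2 * (LBINT y. (norm (b y))\<^sup>2)"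
    "(norm (pot a lborel b x))\<^sup>2 \<le> 2 / Re a * (LBINT y. (norm (b y))\<^sup>2)"
proof -
  note adm = admissible_L2[OF a _ b, simplified]
  define k where "k x = (LBINT y. exp (- Re a * \<bar>x - y\<bar>) * norm (b y))" for x
  define P where "P x = (LBINT y. exp (- Re a * \<bar>x - y\<bar>) * (norm (b y))\<^sup>2)" for x
  have ik: "integrable lborel (\<lambda>y. exp (- Re a * \<bar>x - y\<bar>) * norm (b y))" for x
    using adm by (auto simp: admissible_def)
  have iP: "integrable lborel (\<lambda>y. exp (- Re a * \<bar>x - y\<bar>) * (norm (b y))\<^sup>2)" for x
    by (rule Bochner_Integration.integrable_bound[OF b])
       (use a in \<open>auto simp: abs_mult intro!: mult_left_le_one_le\<close>)
  note [measurable] = measurable_pot[OF adm] measurable_potd[OF adm]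
  have P: "integrable lborel P" "(LBINT x. P x) = 2 / Re a * (LBINT y. (norm (b y))\<^sup>2)"
    using integrable_conv_exp[OF sets_lborel sigma_finite_lborel a b] unfolding P_def by auto
  have k0: "0 \<le> k x" and P0: "0 \<le> P x" for x unfolding k_def P_def by simp_all
  have kP: "(k x)\<^sup>2 \<le> 2 / Re a * P x" for x
  proof (cases "k x = 0")
    case False
    then have k: "0 < k x" using k0[of x] by simp
    \<comment> \<open>Chosen so that the first term below integrates to \<open>k x / 2\<close>,
      which is absorbed. It has to be positive, hence the separate case
      \<open>k x = 0\<close>.\<close>
    define lam where "lam = k x * Re a / 2"
    have l: "0 < lam" using k a by (simp add: lam_def)
    have "exp (- Re a * \<bar>x - y\<bar>) * norm (b y) \<le>
        lam / 2 * exp (- Re a * \<bar>x - y\<bar>) + 1 / (2 * lam) * (exp (- Re a * \<bar>x - y\<bar>) * (norm (b y))\<^sup>2)" for y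
    proof -
      have "2 * lam * norm (b y) \<le> lam\<^sup>2 + (norm (b y))\<^sup>2" by (rule sum_squares_bound)
      then have "norm (b y) \<le> lam / 2 + 1 / (2 * lam) * (norm (b y))\<^sup>2"
        using l by (simp add: field_simps power2_eq_square)
      then have "exp (- Re a * \<bar>x - y\<bar>) * norm (b y) \<le>
          exp (- Re a * \<bar>x - y\<bar>) * (lam / 2 + 1 / (2 * lam) * (norm (b y))\<^sup>2)" by (rule mult_left_mono) simp
      then show ?thesis by (simp add: algebra_simps)
    qed
    then have "k x \<le> (LBINT y. lam / 2 * exp (- Re a * \<bar>x - y\<bar>) + 1 / (2 * lam) * (exp (- Re a * \<bar>x - y\<bar>) * (norm (b y))\<^sup>2))"
      unfolding k_def using exp_minus_abs_integral(3)[OF a, of x] iP[of x]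
      by (intro integral_mono[OF ik]) auto
    also have "\<dots> = lam / 2 * (2 / Re a) + 1 / (2 * lam) * P x"
      using exp_minus_abs_integral(3,4)[OF a, of x] iP[of x] by (simp add: P_def)
    also have "lam / 2 * (2 / Re a) = k x / 2" using a by (simp add: lam_def)
    finally have "k x / 2 \<le> 1 / (2 * lam) * P x" by linarith
    then have "k x / 2 \<le> P x / (k x * Re a)" by (simp add: lam_def)
    then show ?thesis using k a by (simp add: field_simps power2_eq_square)
  qed (use P0 a in simp)
  have p: "norm (pot a lborel b x) \<le> k x" and d: "norm (potd a lborel b x) \<le> norm a * k x" for x
    unfolding k_def by (rule norm_pot_le[OF adm] norm_potd_le[OF adm])+
  have p2: "(norm (pot a lborel b x))\<^sup>2 \<le> 2 / Re a * P x" for x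
    using power_mono[OF p[of x], of 2] kP[of x] by simp
  show i: "integrable lborel (\<lambda>x. (norm (pot a lborel b x))\<^sup>2)"
    by (rule Bochner_Integration.integrable_bound[OF integrable_mult_right[OF P(1), of "2 / Re a"]])
       (use order_trans[OF p2 abs_ge_self] in auto)
  have d2: "(norm (potd a lborel b x))\<^sup>2 \<le> (norm a)\<^sup>2 * (2 / Re a) * P x" for x
  proof -
    have "(norm (potd a lborel b x))\<^sup>2 \<le> (norm a)\<^sup>2 * (k x)\<^sup>2"
      using power_mono[OF d[of x], of 2] by (simp add: power_mult_distrib)
    also have "\<dots> \<le> (norm a)\<^sup>2 * (2 / Re a * P x)" by (rule mult_left_mono[OF kP]) simp
    finally show ?thesis by (simp add: mult.assoc)
  qed
  show "integrable lborel (\<lambda>x. (norm (potd a lborel b x))\<^sup>2)"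
    by (rule Bochner_Integration.integrable_bound[OF integrable_mult_right[OF P(1), of "(norm a)\<^sup>2 * (2 / Re a)"]])
       (use order_trans[OF d2 abs_ge_self] in auto)
  have "(LBINT x. (norm (pot a lborel b x))\<^sup>2) \<le> (LBINT x. 2 / Re a * P x)"
    by (rule integral_mono[OF i _ p2]) (use P in simp)
  also have "\<dots> = (2 / Re a)\<^sup>2 * (LBINT y. (norm (b y))\<^sup>2)" using P by (simp add: power2_eq_square)
  finally show "(LBINT x. (norm (pot a lborel b x))\<^sup>2) \<le> (2 / Re a)\<^sup>2 * (LBINT y. (norm (b y))\<^sup>2)" .
  have "P x \<le> (LBINT y. (norm (b y))\<^sup>2)"
    unfolding P_def using a by (intro integral_mono[OF iP b] mult_left_le_one_le) auto
  then have "2 / Re a * P x \<le> 2 / Re a * (LBINT y. (norm (b y))\<^sup>2)" using a by (intro mult_left_mono) auto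
  then show "(norm (pot a lborel b x))\<^sup>2 \<le> 2 / Re a * (LBINT y. (norm (b y))\<^sup>2)" using p2[of x] by linarith
qed

lemma AE_open_imp_all:
  fixes S :: "real set"
  assumes "open S" "AE x in lborel. x \<notin> S"
  shows "S = {}"
proof (rule ccontr)
  assume "S \<noteq> {}"
  then obtain x e where e: "0 < e" "ball x e \<subseteq> S" using assms(1) open_contains_ball by blast
  then have "{x<..<x + e} \<subseteq> S" by (auto simp: subset_iff dist_real_def)
  moreover have "emeasure lborel S = 0"
    using assms(2) by (subst (asm) AE_iff_measurable[of S]) (use assms(1) in auto)
  ultimately have "emeasure lborel {x<..<x + e} = 0"
    using emeasure_mono[of "{x<..<x + e}" S lborel] assms(1) by simp
  then show False using e by simp
qed

lemma continuous_AE_eq_imp_eq: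
  fixes f g :: "real \<Rightarrow> complex"
  assumes "continuous_on UNIV f" "continuous_on UNIV g" "AE x in lborel. f x = g x"
  shows "f = g"
proof -
  have "open {x. f x \<noteq> g x}" using assms(1,2) by (rule open_Collect_neq)
  then have "{x. f x \<noteq> g x} = {}" by (rule AE_open_imp_all) (use assms(3) in simp)
  then show ?thesis by auto
qed

lemma continuous_AE_norm_le:
  fixes f :: "real \<Rightarrow> complex"
  assumes "continuous_on UNIV f" "AE x in lborel. norm (f x) \<le> B"
  shows "norm (f x) \<le> B"
proof -
  have "open {x. B < norm (f x)}" by (intro open_Collect_less continuous_intros assms(1))
  then have "{x. B < norm (f x)} = {}" by (rule AE_open_imp_all) (use assms(2) in \<open>simp add: not_less\<close>)
  then show ?thesis by (auto simp: not_less)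
qed

section \<open>Mollification of the potential\<close>

text \<open>The mollifier has the form \<open>ker\<close>, so that the facts on \<open>pot\<close> apply to the mollified measure.\<close>

definition mollified :: "real measure \<Rightarrow> nat \<Rightarrow> real \<Rightarrow> real" where
  "mollified m n x = real (Suc n) / 2 * (\<integral>y. exp (- real (Suc n) * \<bar>x - y\<bar>) \<partial>m)"

text \<open>Up to a factor the mollification is \<open>pot\<close> of the constant 1 with
  \<open>a = Suc n\<close>. The factor \<open>Suc n / 2\<close> is the inverse of the integral of
  the kernel, so total mass is preserved; this keeps the a priori constants independent of
  \<open>n\<close>.\<close>

lemma
  assumes st: "sets m = sets borel" and fm: "finite_measure m"
  shows continuous_mollified: "continuous_on UNIV (mollified m n)"
    and integrable_mollified: "integrable lborel (mollified m n)"
    and integral_mollified: "(LBINT x. mollified m n x) = measure m UNIV"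
    and mollified_nonneg: "0 \<le> mollified m n x"
proof -
  interpret m: finite_measure m by fact
  have sp: "space m = UNIV" using sets_eq_imp_space_eq[OF st] by simp
  have adm: "admissible (of_real (real (Suc n))) m (\<lambda>_. 1) (1 * measure m UNIV)"
    by (rule admissible_finite) (use st fm in auto)
  have eq: "mollified m n x = real (Suc n) / 2 * Re (pot (of_real (real (Suc n))) m (\<lambda>_. 1) x)" for x
  proof -
    have "pot (of_real (real (Suc n))) m (\<lambda>_. 1) x = (\<integral>y. of_real (exp (- real (Suc n) * \<bar>x - y\<bar>)) \<partial>m)"
      unfolding pot_def ker_def by (intro Bochner_Integration.integral_cong refl) (simp flip: exp_of_real)
    then show ?thesis by (simp add: mollified_def)
  qed
  show "continuous_on UNIV (mollified m n)"
    unfolding eq[abs_def] by (intro continuous_intros ac_deriv_continuous[OF ac_deriv_pot[OF adm]])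
  have "integrable lborel (\<lambda>x. \<integral>y. exp (- real (Suc n) * \<bar>x - y\<bar>) * 1 \<partial>m)"
    "(LBINT x. (\<integral>y. exp (- real (Suc n) * \<bar>x - y\<bar>) * 1 \<partial>m)) = 2 / real (Suc n) * (\<integral>y. 1 \<partial>m)"
    by (rule integrable_conv_exp[OF st m.sigma_finite_measure_axioms]; simp)+
  then show "integrable lborel (mollified m n)" "(LBINT x. mollified m n x) = measure m UNIV"
    unfolding mollified_def by (auto simp: sp simp del: of_nat_Suc)
  show "0 \<le> mollified m n x" unfolding mollified_def by simp
qed

text \<open>Again the mean value inequality for \<open>exp\<close> on the left half-plane. The
  constant is the same everywhere, which makes the mollification error uniform in
  \<open>x\<close>.\<close>

lemma ker_lipschitz:
  assumes "0 < Re a"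
  shows "norm (ker a s - ker a t) \<le> norm a * \<bar>s - t\<bar>"
proof -
  have "norm (exp (- a * of_real \<bar>s\<bar>) - exp (- a * of_real \<bar>t\<bar>)) \<le> 1 * norm (- a * of_real \<bar>s\<bar> - (- a * of_real \<bar>t\<bar>))"
  proof (rule field_differentiable_bound[of "{w. Re w \<le> 0}"])
    show "convex {w. Re w \<le> 0}" by (rule convex_halfspace_Re_le)
    show "(exp has_field_derivative exp w) (at w within {w. Re w \<le> 0})" for w :: complex
      by (rule DERIV_subset[OF DERIV_exp]) simp
  qed (use assms in auto)
  also have "- a * of_real \<bar>s\<bar> - (- a * of_real \<bar>t\<bar>) = - a * of_real (\<bar>s\<bar> - \<bar>t\<bar>)" by (simp add: algebra_simps)
  also have "1 * norm (- a * of_real (\<bar>s\<bar> - \<bar>t\<bar>)) = norm a * \<bar>\<bar>s\<bar> - \<bar>t\<bar>\<bar>"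
    by (simp only: norm_mult norm_minus_cancel norm_of_real mult_1)
  also have "\<dots> \<le> norm a * \<bar>s - t\<bar>" by (intro mult_left_mono) auto
  finally show ?thesis by (simp add: ker_def)
qed

text \<open>The bound \<open>t exp (- t) <= exp (- t / 2)\<close> reduces the moment to an
  exponential integral of order \<open>1 / k\<close>.\<close>

lemma mollified_first_moment:
  fixes k y :: real
  assumes "0 < k"
  shows "integrable lborel (\<lambda>s. exp (- k * \<bar>s - y\<bar>) * \<bar>s - y\<bar>)"
    "k / 2 * (LBINT s. exp (- k * \<bar>s - y\<bar>) * \<bar>s - y\<bar>) \<le> 2 / k"
proof -
  have le: "exp (- k * \<bar>s - y\<bar>) * \<bar>s - y\<bar> \<le> 1 / k * exp (- (k / 2) * \<bar>s - y\<bar>)" for s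
  proof -
    define t where "t = k * \<bar>s - y\<bar>"
    have t0: "0 \<le> t" using assms by (simp add: t_def)
    \<comment> \<open>The difference of the two sides is \<open>((t - 2)^2 + 4) / 8\<close>.\<close>
    have "t \<le> 1 + t / 2 + (t / 2)\<^sup>2 / 2"
      using zero_le_power2[of "t - 2"] by (simp add: power2_eq_square field_simps)
    also have "\<dots> \<le> exp (t / 2)" using t0 by (intro exp_lower_Taylor_quadratic) auto
    finally have "exp (- t) * t \<le> exp (- t) * exp (t / 2)" by (intro mult_left_mono) auto
    also have "\<dots> = exp (- t / 2)" by (simp flip: exp_add)
    finally show ?thesis using assms by (simp add: t_def field_simps)
  qed
  have i: "integrable lborel (\<lambda>s. 1 / k * exp (- (k / 2) * \<bar>s - y\<bar>))"
    using exp_minus_abs_integral(1)[of "k / 2" y] assms by (intro integrable_mult_right) auto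
  show int: "integrable lborel (\<lambda>s. exp (- k * \<bar>s - y\<bar>) * \<bar>s - y\<bar>)"
    by (rule Bochner_Integration.integrable_bound[OF i]) (use order_trans[OF le abs_ge_self] in auto)
  have "(LBINT s. exp (- k * \<bar>s - y\<bar>) * \<bar>s - y\<bar>) \<le> (LBINT s. 1 / k * exp (- (k / 2) * \<bar>s - y\<bar>))"
    by (rule integral_mono[OF int i le])
  also have "\<dots> = 1 / k * (2 / (k / 2))"
    using exp_minus_abs_integral(2)[of "k / 2" y] assms by simp
  finally have "k / 2 * (LBINT s. exp (- k * \<bar>s - y\<bar>) * \<bar>s - y\<bar>) \<le> k / 2 * (1 / k * (2 / (k / 2)))"
    using assms by (intro mult_left_mono) auto
  then show "k / 2 * (LBINT s. exp (- k * \<bar>s - y\<bar>) * \<bar>s - y\<bar>) \<le> 2 / k" using assms by simp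
qed

text \<open>By Fubini the mollifier acts on \<open>\<psi> s = ker a (x - s) * u s\<close> instead of
  \<open>m\<close>. The oscillation of the kernel is controlled by the first moment. The oscillation
  of \<open>u\<close> gives \<open>j n y\<close>, which does not involve \<open>x\<close>; it tends
  to 0 for each \<open>y\<close>, and its integral over the finite measure \<open>m\<close> tends to
  0 by dominated convergence. So the error is uniform in \<open>x\<close>.\<close>

theorem pot_mollified_tendsto:
  fixes u :: "real \<Rightarrow> complex"
  assumes a: "0 < Re a" and st: "sets m = sets borel" and fm: "finite_measure m"
    and cu: "continuous_on UNIV u" and bu: "\<And>x. norm (u x) \<le> B"
  shows "\<exists>e. e \<longlonglongrightarrow> 0 \<and>
    (\<forall>n x. norm (pot a lborel (\<lambda>s. of_real (mollified m n s) * u s) x - pot a m u x) \<le> e n)"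
proof -
  interpret m: finite_measure m by fact
  note [measurable_cong] = st
  have sp: "space m = UNIV" using sets_eq_imp_space_eq[OF st] by simp
  have [measurable]: "u \<in> borel_measurable borel" by (rule borel_measurable_continuous_onI[OF cu])
  have B0: "0 \<le> B" using bu[of 0] norm_ge_zero order_trans by blast
  define \<rho> where "\<rho> n s = real (Suc n) / 2 * exp (- real (Suc n) * \<bar>s\<bar>)" for n s
  have [measurable]: "\<rho> n \<in> borel_measurable borel" for n unfolding \<rho>_def by measurable
  have \<rho>0: "0 \<le> \<rho> n s" for n s by (simp add: \<rho>_def)
  have i\<rho>: "integrable lborel (\<lambda>s. \<rho> n (s - y))" and v\<rho>: "(LBINT s. \<rho> n (s - y)) = 1" for n y
    using exp_minus_abs_integral(1,2)[of "real (Suc n)" y] by (auto simp: \<rho>_def simp del: of_nat_Suc)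
  define j where "j n y = (LBINT s. \<rho> n (s - y) * norm (u s - u y))" for n y
  have uu: "norm (u s - u y) \<le> 2 * B" for s y
    using norm_triangle_ineq4[of "u s" "u y"] bu[of s] bu[of y] by linarith
  have ij: "integrable lborel (\<lambda>s. \<rho> n (s - y) * norm (u s - u y))" for n y
  proof (rule Bochner_Integration.integrable_bound[OF integrable_mult_left[OF i\<rho>, of _ _ "2 * B"]])
    show "AE s in lborel. norm (\<rho> n (s - y) * norm (u s - u y)) \<le> norm (\<rho> n (s - y) * (2 * B))"
      using \<rho>0 uu B0 by (intro AE_I2) (auto simp: abs_mult intro!: mult_left_mono)
  qed measurable
  have mj [measurable]: "j n \<in> borel_measurable borel" for n
    unfolding j_def by measurable
  have j0: "0 \<le> j n y" for n y unfolding j_def using \<rho>0 by simp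
  have jB: "j n y \<le> 2 * B" for n y
  proof -
    have "j n y \<le> (LBINT s. \<rho> n (s - y) * (2 * B))"
      unfolding j_def by (intro integral_mono[OF ij] integrable_mult_left i\<rho> mult_left_mono uu \<rho>0)
    then show ?thesis by (simp add: v\<rho>)
  qed
  have jint: "integrable m (j n)" for n
    by (rule m.integrable_const_bound[where B = "2 * B"]) (use jB j0 in auto)
  have jlim: "(\<lambda>n. j n y) \<longlonglongrightarrow> 0" for y
  proof -
    \<comment> \<open>The substitution \<open>s = y + r / (n + 1)\<close> freezes the mollifier, and
      only the argument of \<open>u\<close> still depends on \<open>n\<close>.\<close>
    have eq: "j n y = (LBINT r. 1 / 2 * exp (- 1 * \<bar>r - 0\<bar>) * norm (u (y + r / real (Suc n)) - u y))" for n
    proof -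
      have "j n y = \<bar>1 / real (Suc n)\<bar> *\<^sub>R (LBINT r. \<rho> n (y + 1 / real (Suc n) * r - y) * norm (u (y + 1 / real (Suc n) * r) - u y))"
        unfolding j_def by (rule lborel_integral_real_affine) simp
      also have "\<dots> = (LBINT r. \<bar>1 / real (Suc n)\<bar> *\<^sub>R (\<rho> n (y + 1 / real (Suc n) * r - y) * norm (u (y + 1 / real (Suc n) * r) - u y)))"
        by (rule integral_scaleR_right[symmetric])
      also have "\<dots> = (LBINT r. 1 / 2 * exp (- 1 * \<bar>r - 0\<bar>) * norm (u (y + r / real (Suc n)) - u y))"
        by (intro Bochner_Integration.integral_cong refl) (simp add: \<rho>_def abs_mult del: of_nat_Suc)
      finally show ?thesis .
    qed
    have "(\<lambda>n. \<integral>r. 1 / 2 * exp (- 1 * \<bar>r - 0\<bar>) * norm (u (y + r / real (Suc n)) - u y) \<partial>lborel) \<longlonglongrightarrow> (\<integral>r. 0 \<partial>(lborel :: real measure))"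
    proof (rule integral_dominated_convergence[where w = "\<lambda>r. exp (- 1 * \<bar>r - 0\<bar>) * B"])
      show "integrable lborel (\<lambda>r. exp (- 1 * \<bar>r - 0\<bar>) * B)"
        by (intro integrable_mult_left exp_minus_abs_integral) auto
      show "AE r in lborel. norm (1 / 2 * exp (- 1 * \<bar>r - 0\<bar>) * norm (u (y + r / real (Suc n)) - u y)) \<le> exp (- 1 * \<bar>r - 0\<bar>) * B" for n
      proof (rule AE_I2)
        fix r
        have "exp (- 1 * \<bar>r - 0\<bar>) * norm (u (y + r / real (Suc n)) - u y) \<le> exp (- 1 * \<bar>r - 0\<bar>) * (2 * B)"
          by (rule mult_left_mono[OF uu]) simp
        then show "norm (1 / 2 * exp (- 1 * \<bar>r - 0\<bar>) * norm (u (y + r / real (Suc n)) - u y)) \<le> exp (- 1 * \<bar>r - 0\<bar>) * B"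
          by simp
      qed
      show "AE r in lborel. (\<lambda>n. 1 / 2 * exp (- 1 * \<bar>r - 0\<bar>) * norm (u (y + r / real (Suc n)) - u y)) \<longlonglongrightarrow> 0"
      proof (rule AE_I2)
        fix r
        have "(\<lambda>n. y + r * inverse (real (Suc n))) \<longlonglongrightarrow> y + r * 0"
          by (intro tendsto_intros LIMSEQ_inverse_real_of_nat)
        then have "(\<lambda>n. y + r / real (Suc n)) \<longlonglongrightarrow> y" by (simp add: divide_inverse)
        moreover have "isCont u y" using cu by (simp add: continuous_on_eq_continuous_at)
        ultimately have "(\<lambda>n. u (y + r / real (Suc n))) \<longlonglongrightarrow> u y" by (rule isCont_tendsto_compose[rotated])
        then have "(\<lambda>n. 1 / 2 * exp (- 1 * \<bar>r - 0\<bar>) * norm (u (y + r / real (Suc n)) - u y)) \<longlonglongrightarrow> 1 / 2 * exp (- 1 * \<bar>r - 0\<bar>) * norm (u y - u y)"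
          by (intro tendsto_intros)
        then show "(\<lambda>n. 1 / 2 * exp (- 1 * \<bar>r - 0\<bar>) * norm (u (y + r / real (Suc n)) - u y)) \<longlonglongrightarrow> 0" by simp
      qed
    qed auto
    then show ?thesis unfolding eq by simp
  qed
  have Jlim: "(\<lambda>n. \<integral>y. j n y \<partial>m) \<longlonglongrightarrow> (\<integral>y. 0 \<partial>m)"
    by (rule integral_dominated_convergence[where w = "\<lambda>_. 2 * B"]) (use jlim jB j0 in auto)
  define e where "e n = measure m UNIV * (norm a * B * (2 / real (Suc n))) + (\<integral>y. j n y \<partial>m)" for n
  have "(\<lambda>n. measure m UNIV * (norm a * B * (2 * inverse (real (Suc n)))) + (\<integral>y. j n y \<partial>m)) \<longlonglongrightarrow>
      measure m UNIV * (norm a * B * (2 * 0)) + (\<integral>y. 0 \<partial>m)"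
    by (intro tendsto_intros LIMSEQ_inverse_real_of_nat Jlim)
  then have elim: "e \<longlonglongrightarrow> 0" by (simp add: e_def[abs_def] divide_inverse)
  have main: "norm (pot a lborel (\<lambda>s. of_real (mollified m n s) * u s) x - pot a m u x) \<le> e n" for n x
  proof -
    define k where "k = real (Suc n)"
    have k: "0 < k" by (simp add: k_def)
    define \<psi> where "\<psi> s = ker a (x - s) * u s" for s
    have [measurable]: "\<psi> \<in> borel_measurable borel" unfolding \<psi>_def by measurable
    have i\<psi>: "integrable lborel \<psi>"
    proof (rule Bochner_Integration.integrable_bound[OF integrable_mult_left[OF exp_minus_abs_integral(3)[OF a, of x], of B]])
      show "AE s in lborel. norm (\<psi> s) \<le> norm (exp (- Re a * \<bar>x - s\<bar>) * B)"
        using bu B0 by (intro AE_I2) (auto simp: \<psi>_def norm_mult norm_ker abs_mult intro!: mult_left_mono)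
    qed simp
    have \<psi>B: "norm (\<psi> s) \<le> B" for s
    proof -
      have "norm (\<psi> s) \<le> 1 * B"
        unfolding \<psi>_def norm_mult norm_ker using a bu by (intro mult_mono) auto
      then show ?thesis by simp
    qed
    have adm: "admissible (of_real k) m (\<lambda>_. 1) (1 * measure m UNIV)"
      by (rule admissible_finite) (use st fm k in auto)
    define K where "K t = (of_real (\<rho> n t) :: complex)" for t
    have [measurable]: "K \<in> borel_measurable borel" unfolding K_def by measurable
    have K: "norm (K t) \<le> k / 2 * exp (- Re (of_real k) * \<bar>t\<bar>)" for t
      using \<rho>0[of n t] unfolding K_def norm_of_real by (simp add: \<rho>_def k_def)
    note F = admissible_Fubini[OF adm _ K i\<psi>]
    have mol: "(\<integral>y. K (s - y) * 1 \<partial>m) = of_real (mollified m n s)" for s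
      by (simp add: K_def \<rho>_def mollified_def)
    have "pot a lborel (\<lambda>s. of_real (mollified m n s) * u s) x = (LBINT s. (\<integral>y. K (s - y) * 1 \<partial>m) * \<psi> s)"
      unfolding pot_def mol \<psi>_def by (simp add: mult_ac)
    also have "\<dots> = (\<integral>y. (LBINT s. K (s - y) * \<psi> s) * 1 \<partial>m)" by (rule F(2)) simp
    finally have e1: "pot a lborel (\<lambda>s. of_real (mollified m n s) * u s) x = (\<integral>y. (LBINT s. K (s - y) * \<psi> s) \<partial>m)" by simp
    have i1: "integrable m (\<lambda>y. \<integral>s. K (s - y) * \<psi> s \<partial>lborel)" using F(1) by simp
    have i2: "integrable m \<psi>"
      by (rule m.integrable_const_bound[where B = B]) (use \<psi>B in auto)
    have "norm ((LBINT s. K (s - y) * \<psi> s) - \<psi> y) \<le> norm a * B * (2 / k) + j n y" for y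
    proof -
      have iK: "integrable lborel (\<lambda>s. K (s - y))" unfolding K_def using i\<rho> by (rule integrable_of_real)
      have iK\<psi>: "integrable lborel (\<lambda>s. K (s - y) * \<psi> s)"
      proof (rule Bochner_Integration.integrable_bound[OF integrable_mult_left[OF i\<rho>[of n y], of B]])
        show "AE s in lborel. norm (K (s - y) * \<psi> s) \<le> norm (\<rho> n (s - y) * B)"
          using \<psi>B \<rho>0 B0 by (intro AE_I2) (auto simp: K_def norm_mult abs_mult intro!: mult_left_mono)
      qed simp
      have "(LBINT s. K (s - y) * \<psi> y) = \<psi> y"
      proof -
        have "(LBINT s. K (s - y)) = 1" unfolding K_def using v\<rho>[of n y] by simp
        then show ?thesis by simp
      qed
      then have "(LBINT s. K (s - y) * \<psi> s) - \<psi> y = (LBINT s. K (s - y) * \<psi> s - K (s - y) * \<psi> y)"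
        using iK\<psi> iK by simp
      also have "norm \<dots> \<le> (LBINT s. norm (K (s - y) * \<psi> s - K (s - y) * \<psi> y))" by (rule integral_norm_bound)
      also have "\<dots> \<le> (LBINT s. norm a * B * (k / 2 * (exp (- k * \<bar>s - y\<bar>) * \<bar>s - y\<bar>)) + \<rho> n (s - y) * norm (u s - u y))"
      proof (rule integral_mono)
        show "integrable lborel (\<lambda>s. norm (K (s - y) * \<psi> s - K (s - y) * \<psi> y))" using iK\<psi> iK by simp
        show "integrable lborel (\<lambda>s. norm a * B * (k / 2 * (exp (- k * \<bar>s - y\<bar>) * \<bar>s - y\<bar>)) + \<rho> n (s - y) * norm (u s - u y))"
          by (intro Bochner_Integration.integrable_add integrable_mult_right mollified_first_moment(1) k ij)
        fix s
        \<comment> \<open>Split so that the kernel difference meets the bounded value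
          \<open>u y\<close>, and the difference of \<open>u\<close> meets a kernel value of norm at
          most 1.\<close>
        have "\<psi> s - \<psi> y = (ker a (x - s) - ker a (x - y)) * u y + ker a (x - s) * (u s - u y)"
          by (simp add: \<psi>_def algebra_simps)
        then have "norm (\<psi> s - \<psi> y) \<le> norm (ker a (x - s) - ker a (x - y)) * norm (u y) + norm (ker a (x - s)) * norm (u s - u y)"
          by (metis norm_mult norm_triangle_ineq)
        also have "\<dots> \<le> norm a * \<bar>s - y\<bar> * B + 1 * norm (u s - u y)"
        proof (intro add_mono mult_mono)
          show "norm (ker a (x - s) - ker a (x - y)) \<le> norm a * \<bar>s - y\<bar>"
            using ker_lipschitz[OF a, of "x - s" "x - y"] by (simp add: abs_minus_commute)
        qed (use bu a in \<open>auto simp: norm_ker\<close>)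
        finally have "\<rho> n (s - y) * norm (\<psi> s - \<psi> y) \<le> \<rho> n (s - y) * (norm a * \<bar>s - y\<bar> * B + 1 * norm (u s - u y))"
          by (rule mult_left_mono) (rule \<rho>0)
        moreover have "norm (K (s - y) * \<psi> s - K (s - y) * \<psi> y) = \<rho> n (s - y) * norm (\<psi> s - \<psi> y)"
        proof -
          have "K (s - y) * \<psi> s - K (s - y) * \<psi> y = K (s - y) * (\<psi> s - \<psi> y)" by (simp add: algebra_simps)
          then show ?thesis using \<rho>0 by (simp add: norm_mult K_def)
        qed
        moreover have "\<rho> n (s - y) * (norm a * \<bar>s - y\<bar> * B + 1 * norm (u s - u y)) =
            norm a * B * (k / 2 * (exp (- k * \<bar>s - y\<bar>) * \<bar>s - y\<bar>)) + \<rho> n (s - y) * norm (u s - u y)"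
          by (simp add: \<rho>_def k_def distrib_left mult_ac del: of_nat_Suc)
        ultimately show "norm (K (s - y) * \<psi> s - K (s - y) * \<psi> y) \<le>
            norm a * B * (k / 2 * (exp (- k * \<bar>s - y\<bar>) * \<bar>s - y\<bar>)) + \<rho> n (s - y) * norm (u s - u y)"
          by linarith
      qed
      also have "\<dots> = norm a * B * (k / 2 * (LBINT s. exp (- k * \<bar>s - y\<bar>) * \<bar>s - y\<bar>)) + j n y"
        unfolding j_def using mollified_first_moment(1)[OF k, of y] ij[of n y] by simp
      also have "\<dots> \<le> norm a * B * (2 / k) + j n y"
        using mollified_first_moment(2)[OF k, of y] B0 by (intro add_right_mono mult_left_mono) auto
      finally show ?thesis .
    qed
    then have "norm (\<integral>y. (LBINT s. K (s - y) * \<psi> s) - \<psi> y \<partial>m) \<le> (\<integral>y. norm a * B * (2 / k) + j n y \<partial>m)"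
      using i1 i2 jint by (intro order_trans[OF integral_norm_bound integral_mono]) auto
    also have "\<dots> = e n" using jint by (simp add: e_def sp k_def)
    moreover have "pot a m u x = (\<integral>y. \<psi> y \<partial>m)" by (simp add: pot_def \<psi>_def)
    ultimately show ?thesis unfolding e1 using Bochner_Integration.integral_diff[OF i1 i2] by simp
  qed
  show ?thesis using elim main by blast
qed

section \<open>The method of continuity\<close>

text \<open>The parameter advances in steps of \<open>1 / n\<close> with \<open>2 k L < n\<close>.
  If the equation is solvable at \<open>t\<close>, the a priori bound makes its solution operator
  \<open>S\<close> Lipschitz with constant \<open>k\<close>, and the equation at
  \<open>t + 1 / n\<close> becomes a fixed point problem for a contraction with factor
  \<open>1 / 2\<close>. As \<open>k\<close> does not depend on \<open>t\<close>, the step length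
  stays the same up to 1.\<close>

theorem method_of_continuity:
  fixes A :: "'a::{real_normed_vector, complete_space} \<Rightarrow> 'a"
  assumes A: "bounded_linear A"
    and bound: "\<And>t x. 0 \<le> t \<Longrightarrow> t \<le> 1 \<Longrightarrow> norm x \<le> K * norm (x + t *\<^sub>R A x)"
  shows "\<exists>x. x + A x = y"
proof -
  interpret A: bounded_linear A by fact
  define k where "k = \<bar>K\<bar> + 1"
  have k: "0 < k" "norm x \<le> k * norm (x + t *\<^sub>R A x)" if "0 \<le> t" "t \<le> 1" for t x
  proof -
    have "K * norm (x + t *\<^sub>R A x) \<le> k * norm (x + t *\<^sub>R A x)" by (intro mult_right_mono) (auto simp: k_def)
    then show "norm x \<le> k * norm (x + t *\<^sub>R A x)" using bound[OF that, of x] by linarith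
  qed (simp add: k_def)
  obtain L where L: "0 < L" "\<And>x. norm (A x) \<le> norm x * L" using A.pos_bounded by blast
  have kp: "0 < k" by (simp add: k_def)
  obtain n :: nat where n: "2 * k * L < real n" using reals_Archimedean2 by blast
  then have n0: "0 < real n" using kp L(1) by (meson less_trans mult_pos_pos zero_less_numeral)
  have "\<forall>y. \<exists>x. x + (real i / real n) *\<^sub>R A x = y" if "i \<le> n" for i
    using that
  proof (induction i)
    case (Suc i)
    define t where "t = real i / real n"
    have t: "0 \<le> t" "t \<le> 1" using Suc.prems n0 by (auto simp: t_def field_simps)
    have "\<forall>y. \<exists>x. x + t *\<^sub>R A x = y" using Suc by (simp add: t_def)
    then obtain S where S: "\<And>y. S y + t *\<^sub>R A (S y) = y" by metis
    have Sd: "norm (S y - S y') \<le> k * norm (y - y')" for y y'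
    proof -
      have "(S y - S y') + t *\<^sub>R A (S y - S y') = (S y + t *\<^sub>R A (S y)) - (S y' + t *\<^sub>R A (S y'))"
        by (simp add: A.diff algebra_simps)
      also have "\<dots> = y - y'" by (simp only: S)
      finally show ?thesis using k(2)[OF t, of "S y - S y'"] by simp
    qed
    show ?case
    proof
      fix y
      define \<Phi> where "\<Phi> x = S (y - (1 / real n) *\<^sub>R A x)" for x
      have "\<exists>!x. \<Phi> x = x"
      proof (rule banach_fix_type[of "1/2"])
        show "\<forall>x x'. dist (\<Phi> x) (\<Phi> x') \<le> 1 / 2 * dist x x'"
        proof (intro allI)
          fix x x'
          have "norm (\<Phi> x - \<Phi> x') \<le> k * norm ((y - (1 / real n) *\<^sub>R A x) - (y - (1 / real n) *\<^sub>R A x'))"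
            unfolding \<Phi>_def by (rule Sd)
          also have "(y - (1 / real n) *\<^sub>R A x) - (y - (1 / real n) *\<^sub>R A x') = - ((1 / real n) *\<^sub>R A (x - x'))"
            by (simp add: A.diff algebra_simps)
          also have "k * norm (- ((1 / real n) *\<^sub>R A (x - x'))) = k / real n * norm (A (x - x'))" using n0 by simp
          also have "\<dots> \<le> k / real n * (norm (x - x') * L)" using L(2) kp n0 by (intro mult_left_mono) auto
          also have "\<dots> = (k * L / real n) * norm (x - x')" by simp
          also have "\<dots> \<le> 1 / 2 * norm (x - x')"
            using n n0 by (intro mult_right_mono) (auto simp: field_simps)
          finally show "dist (\<Phi> x) (\<Phi> x') \<le> 1 / 2 * dist x x'" by (simp add: dist_norm)
        qed
      qed auto
      then obtain x where "S (y - (1 / real n) *\<^sub>R A x) = x" by (auto simp: \<Phi>_def)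
      then have "x + t *\<^sub>R A x = y - (1 / real n) *\<^sub>R A x" using S by metis
      then have "x + (t + 1 / real n) *\<^sub>R A x = y" by (simp add: scaleR_add_left algebra_simps)
      moreover have "t + 1 / real n = real (Suc i) / real n" by (simp add: t_def add_divide_distrib)
      ultimately show "\<exists>x. x + (real (Suc i) / real n) *\<^sub>R A x = y" by auto
    qed
  qed auto
  from this[of n] n0 show ?thesis by auto
qed

section \<open>The Schroedinger equation as an integral equation\<close>

text \<open>\<open>M\<close> and \<open>N\<close> stand for the positive and the negative part of
  \<open>V\<close>. The sign of \<open>Im z\<close> is left open to serve both signs in the
  resolvent.\<close>

locale schroedinger_resolvent =
  fixes h E :: real and z a :: complex and M N :: "real measure"
  assumes h: "0 < h" and E: "0 < E" and z: "Re z = E" "Im z \<noteq> 0" "\<bar>Im z\<bar> \<le> 1"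
    and a: "0 < Re a" "of_real (h\<^sup>2) * a\<^sup>2 = - z"
    and M: "sets M = sets borel" "finite_measure M" and N: "sets N = sets borel" "finite_measure N"
begin

text \<open>Turns \<open>ker a\<close> into the Green function of \<open>- h^2 d^2 - z\<close>: the
  source coefficient in \<open>pot_second_derivative_test\<close> is \<open>2 a\<close>, and
  \<open>h^2 * 2 * a * g0 = 1\<close>.\<close>

definition "g0 = 1 / (2 * of_real (h\<^sup>2) * a)"

definition "T = measure M UNIV + measure N UNIV"

lemma a0: "a \<noteq> 0" using a(1) by auto

lemma g0: "g0 * a\<^sup>2 = - (z / of_real (h\<^sup>2)) * g0" "2 * a * g0 = 1 / of_real (h\<^sup>2)"
proof -
  have "a\<^sup>2 = - (z / of_real (h\<^sup>2))" using a(2) h by (simp add: field_simps)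
  then show "g0 * a\<^sup>2 = - (z / of_real (h\<^sup>2)) * g0" by simp
  show "2 * a * g0 = 1 / of_real (h\<^sup>2)" using a0 h by (simp add: g0_def field_simps)
qed

lemma adm_MN:
  assumes "u \<in> borel_measurable borel" "\<And>y. norm (u y) \<le> B"
  shows "admissible a M u (B * measure M UNIV)" "admissible a N u (B * measure N UNIV)"
  by (rule admissible_finite[OF a(1) M assms] admissible_finite[OF a(1) N assms])+

text \<open>The stable form of \<open>a_priori_bound\<close>. The exact potential \<open>w\<close>
  is regular, and with \<open>e = u - w\<close> it solves the equation with source
  \<open>f - v e\<close>, of L1 norm at most that of \<open>f\<close> plus
  \<open>T * \<eta>\<close>; returning from \<open>w\<close> to \<open>u\<close> costs one more
  \<eta>.\<close>

lemma a_priori_L1: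
  fixes u f :: "real \<Rightarrow> complex" and v :: "real \<Rightarrow> real"
  assumes cu: "continuous_on UNIV u" and bu: "\<And>x. norm (u x) \<le> Bu"
    and v: "continuous_on UNIV v" "integrable lborel v" "(LBINT x. \<bar>v x\<bar>) \<le> T"
    and f: "integrable lborel f"
    and near: "\<And>x. norm (u x - g0 * pot a lborel (\<lambda>y. f y - of_real (v y) * u y) x) \<le> \<eta>"
  shows "norm (u x) \<le> (1 + apriori_const h E T * T) * \<eta> + apriori_const h E T * (LBINT y. norm (f y))"
proof -
  have K0: "0 \<le> apriori_const h E T" using h E by (simp add: apriori_const_def add_nonneg_nonneg)
  note [measurable] = borel_measurable_continuous_onI[OF cu] borel_measurable_continuous_onI[OF v(1)]
  have vi: "integrable lborel (\<lambda>x. \<bar>v x\<bar>)" using v(2) by simp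
  define F where "F y = f y - of_real (v y) * u y" for y
  define w where "w x = g0 * pot a lborel F x" for x
  define e where "e x = u x - w x" for x
  have e: "norm (e x) \<le> \<eta>" for x using near[of x] by (simp add: e_def w_def F_def[abs_def])
  have eta: "0 \<le> \<eta>" using e[of 0] norm_ge_zero order_trans by blast
  have vk: "integrable lborel (\<lambda>x. of_real (v x) * k x)"
    if k: "k \<in> borel_measurable borel" "\<And>x. norm (k x) \<le> B" for k :: "real \<Rightarrow> complex" and B
  proof (rule Bochner_Integration.integrable_bound[OF integrable_mult_left[OF vi, of B]])
    have "\<bar>v x\<bar> * norm (k x) \<le> norm (\<bar>v x\<bar> * B)" for x
      using mult_left_mono[OF order_trans[OF k(2) abs_ge_self], of "\<bar>v x\<bar>" x] by (simp add: abs_mult)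
    then show "AE x in lborel. norm (of_real (v x) * k x) \<le> norm (\<bar>v x\<bar> * B)"
      by (intro AE_I2) (simp add: norm_mult)
    show "(\<lambda>x. of_real (v x) * k x) \<in> borel_measurable lborel" using k(1) by measurable
  qed
  have iF: "integrable lborel F" unfolding F_def using f vk[of u Bu] bu by simp
  have locF: "set_integrable lborel {s..t} F" for s t
    unfolding set_integrable_def by (rule integrable_mult_indicator[OF _ iF]) simp
  note adm = admissible_L1[OF a(1) iF]
  \<comment> \<open>\<open>a_priori_bound\<close> asks for an absolutely continuous derivative, and
    \<open>potd\<close> is known to be one only up to a null set.\<close>
  obtain q0 where q0: "ac_deriv q0 (\<lambda>x. a\<^sup>2 * pot a lborel F x - 2 * a * F x)"
    "AE x in lborel. q0 x = potd a lborel F x"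
    using ac_deriv_potd_lborel[OF adm locF] by blast
  note [measurable] = ac_deriv_measurable[OF q0(1)] measurable_potd[OF adm] measurable_pot[OF adm]
  have w_ac: "ac_deriv w (\<lambda>x. g0 * q0 x)"
  proof (rule ac_deriv_cong_AE)
    show "ac_deriv w (\<lambda>x. g0 * potd a lborel F x)"
      unfolding w_def by (rule ac_deriv_bounded_linear[OF bounded_linear_mult_right ac_deriv_pot[OF adm]])
    show "AE x in lborel. g0 * potd a lborel F x = g0 * q0 x" using q0(2) by eventually_elim simp
  qed simp
  note cw = ac_deriv_continuous[OF w_ac]
  note [measurable] = borel_measurable_continuous_onI[OF cw]
  have [measurable]: "e \<in> borel_measurable borel" unfolding e_def by measurable
  define f' where "f' x = f x - of_real (v x) * e x" for x
  have if': "integrable lborel f'" unfolding f'_def using f vk[of e \<eta>] e by simp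
  have q_ac: "ac_deriv (\<lambda>x. g0 * q0 x) (\<lambda>x. ((of_real (v x) - z) * w x - f' x) / of_real (h\<^sup>2))"
  proof -
    have "ac_deriv (\<lambda>x. g0 * q0 x) (\<lambda>x. g0 * (a\<^sup>2 * pot a lborel F x - 2 * a * F x))"
      by (rule ac_deriv_bounded_linear[OF bounded_linear_mult_right q0(1)])
    moreover have "g0 * (a\<^sup>2 * pot a lborel F x - 2 * a * F x) = ((of_real (v x) - z) * w x - f' x) / of_real (h\<^sup>2)" for x
    proof -
      have "g0 * (a\<^sup>2 * pot a lborel F x - 2 * a * F x) = (g0 * a\<^sup>2) * pot a lborel F x - (2 * a * g0) * F x"
        by (simp add: algebra_simps)
      also have "\<dots> = (- z * w x - F x) / of_real (h\<^sup>2)"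
        unfolding g0 by (simp add: w_def diff_divide_distrib)
      also have "- z * w x - F x = (of_real (v x) - z) * w x - f' x"
        by (simp add: F_def f'_def e_def algebra_simps)
      finally show ?thesis .
    qed
    ultimately show ?thesis by simp
  qed
  have w2: "integrable lborel (\<lambda>x. (norm (w x))\<^sup>2)"
    using integrable_mult_right[OF pot_square_integrable_L1(1)[OF adm iF], of "(norm g0)\<^sup>2"]
    by (simp add: w_def norm_mult power_mult_distrib)
  have q2: "integrable lborel (\<lambda>x. (norm (g0 * q0 x))\<^sup>2)"
  proof (rule integrable_cong_AE_imp)
    show "integrable lborel (\<lambda>x. (norm g0)\<^sup>2 * (norm (potd a lborel F x))\<^sup>2)"
      by (rule integrable_mult_right[OF pot_square_integrable_L1(2)[OF adm iF]])
    show "AE x in lborel. (norm g0)\<^sup>2 * (norm (potd a lborel F x))\<^sup>2 = (norm (g0 * q0 x))\<^sup>2"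
      using q0(2) by eventually_elim (simp add: norm_mult power_mult_distrib)
  qed simp
  have wb: "norm (w x) \<le> Bu + \<eta>" for x
    using norm_triangle_ineq4[of "u x" "e x"] bu[of x] e[of x] by (simp add: e_def)
  have qb: "norm (g0 * q0 x) \<le> norm g0 * (norm a * (LBINT y. norm (F y)))" for x
  proof (rule continuous_AE_norm_le)
    show "continuous_on UNIV (\<lambda>x. g0 * q0 x)" by (intro continuous_intros ac_deriv_continuous[OF q0(1)])
    show "AE x in lborel. norm (g0 * q0 x) \<le> norm g0 * (norm a * (LBINT y. norm (F y)))"
      using q0(2)
    proof eventually_elim
      fix x assume "q0 x = potd a lborel F x"
      then show "norm (g0 * q0 x) \<le> norm g0 * (norm a * (LBINT y. norm (F y)))"
        using norm_potd_le_const[OF adm, of x] by (simp add: norm_mult mult_left_mono)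
    qed
  qed
  have "norm (w x) \<le> apriori_const h E T * (LBINT y. norm (f' y))"
    by (rule a_priori_bound[OF h E z w_ac q_ac w2 q2 wb qb v if'])
  also have "\<dots> \<le> apriori_const h E T * ((LBINT y. norm (f y)) + T * \<eta>)"
  proof (rule mult_left_mono[OF _ K0])
    have "(LBINT y. norm (f' y)) \<le> (LBINT y. norm (f y) + \<bar>v y\<bar> * \<eta>)"
    proof (rule integral_mono)
      show "integrable lborel (\<lambda>y. norm (f' y))" using if' by simp
      show "integrable lborel (\<lambda>y. norm (f y) + \<bar>v y\<bar> * \<eta>)" using f vi by simp
      fix y
      have "norm (f' y) \<le> norm (f y) + \<bar>v y\<bar> * norm (e y)"
        unfolding f'_def by (rule order_trans[OF norm_triangle_ineq4]) (simp add: norm_mult)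
      also have "\<dots> \<le> norm (f y) + \<bar>v y\<bar> * \<eta>" using e by (intro add_left_mono mult_left_mono) auto
      finally show "norm (f' y) \<le> norm (f y) + \<bar>v y\<bar> * \<eta>" .
    qed
    also have "\<dots> = (LBINT y. norm (f y)) + (LBINT y. \<bar>v y\<bar>) * \<eta>" using f vi by simp
    also have "\<dots> \<le> (LBINT y. norm (f y)) + T * \<eta>" using v(3) eta by (intro add_left_mono mult_right_mono)
    finally show "(LBINT y. norm (f' y)) \<le> (LBINT y. norm (f y)) + T * \<eta>" .
  qed
  finally have "norm (w x) \<le> apriori_const h E T * ((LBINT y. norm (f y)) + T * \<eta>)" .
  moreover have "norm (u x) \<le> norm (w x) + norm (e x)"
    using norm_triangle_ineq[of "w x" "e x"] by (simp add: e_def)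
  ultimately have "norm (u x) \<le> apriori_const h E T * ((LBINT y. norm (f y)) + T * \<eta>) + \<eta>" using e[of x] by linarith
  then show ?thesis by (simp add: algebra_simps)
qed

text \<open>The term \<open>G (u V)\<close> of the integral equation, with
  \<open>V = M - N\<close>.\<close>

definition greenV :: "(real \<Rightarrow> complex) \<Rightarrow> real \<Rightarrow> complex" where
  "greenV u x = g0 * (pot a M u x - pot a N u x)"

text \<open>For this fixed \<open>u\<close>, mollifying \<open>M\<close> and \<open>N\<close> raises
  the defect by at most \<open>norm g0 * (eM n + eN n)\<close>, while the L1 norm of the potential
  stays at most \<open>T\<close>. So \<open>a_priori_L1\<close> applies for each \<open>n\<close>
  and passes to the limit. The rate depends on \<open>u\<close>, the limiting constants do
  not.\<close>

theorem a_priori_measure: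
  fixes u f :: "real \<Rightarrow> complex"
  assumes cu: "continuous_on UNIV u" and bu: "\<And>x. norm (u x) \<le> Bu"
    and t: "0 \<le> t" "t \<le> 1" and f: "integrable lborel f"
    and near: "\<And>x. norm (u x + of_real t * greenV u x - g0 * pot a lborel f x) \<le> \<eta>"
  shows "norm (u x) \<le> (1 + apriori_const h E T * T) * \<eta> + apriori_const h E T * (LBINT y. norm (f y))"
proof -
  have [measurable]: "u \<in> borel_measurable borel" by (rule borel_measurable_continuous_onI[OF cu])
  obtain eM where eM: "eM \<longlonglongrightarrow> 0"
    "\<And>n x. norm (pot a lborel (\<lambda>s. of_real (mollified M n s) * u s) x - pot a M u x) \<le> eM n"
    using pot_mollified_tendsto[OF a(1) M cu bu] by blast
  obtain eN where eN: "eN \<longlonglongrightarrow> 0"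
    "\<And>n x. norm (pot a lborel (\<lambda>s. of_real (mollified N n s) * u s) x - pot a N u x) \<le> eN n"
    using pot_mollified_tendsto[OF a(1) N cu bu] by blast
  have mu: "integrable lborel (\<lambda>s. of_real (mollified m n s) * u s)"
    if m: "sets m = sets borel" "finite_measure m" for m n
  proof (rule Bochner_Integration.integrable_bound[OF integrable_mult_left[OF integrable_mollified[OF m, of n], of Bu]])
    have [measurable]: "mollified m n \<in> borel_measurable borel"
      by (rule borel_measurable_continuous_onI[OF continuous_mollified[OF m]])
    show "(\<lambda>s. of_real (mollified m n s) * u s) \<in> borel_measurable lborel" by measurable
    have "norm (of_real (mollified m n s) * u s) \<le> mollified m n s * Bu" for s
      using mollified_nonneg[OF m, of n s] bu[of s] by (simp add: norm_mult mult_left_mono)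
    then show "AE s in lborel. norm (of_real (mollified m n s) * u s) \<le> norm (mollified m n s * Bu)"
      by (intro AE_I2) (use order_trans[OF _ abs_ge_self] in auto)
  qed
  have step: "norm (u x) \<le> (1 + apriori_const h E T * T) * (\<eta> + norm g0 * (eM n + eN n)) + apriori_const h E T * (LBINT y. norm (f y))" for n
  proof -
    define v where "v x = t * (mollified M n x - mollified N n x)" for x
    note iM = integrable_mollified[OF M, of n] and iN = integrable_mollified[OF N, of n]
    have cv: "continuous_on UNIV v"
      unfolding v_def by (intro continuous_intros continuous_mollified[OF M] continuous_mollified[OF N])
    have iv: "integrable lborel v" unfolding v_def using iM iN by simp
    have vT: "(LBINT x. \<bar>v x\<bar>) \<le> T"
    proof -
      have "(LBINT x. \<bar>v x\<bar>) \<le> (LBINT x. mollified M n x + mollified N n x)"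
      proof (rule integral_mono)
        fix x
        have "\<bar>v x\<bar> \<le> 1 * \<bar>mollified M n x - mollified N n x\<bar>"
          using t unfolding v_def abs_mult by (intro mult_right_mono) auto
        then show "\<bar>v x\<bar> \<le> mollified M n x + mollified N n x"
          using mollified_nonneg[OF M, of n x] mollified_nonneg[OF N, of n x] by auto
      qed (use iv iM iN in auto)
      then show ?thesis using iM iN integral_mollified[OF M] integral_mollified[OF N] by (simp add: T_def)
    qed
    define bM where "bM s = of_real (mollified M n s) * u s" for s
    define bN where "bN s = of_real (mollified N n s) * u s" for s
    note amM = admissible_L1[OF a(1) mu[OF M, of n], folded bM_def] and amN = admissible_L1[OF a(1) mu[OF N, of n], folded bN_def]
    have "integrable lborel (\<lambda>s. bM s - bN s)" using mu[OF M, of n] mu[OF N, of n] by (simp add: bM_def bN_def)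
    then have amd: "admissible a lborel (\<lambda>y. of_real t * (bM y - bN y)) (LBINT y. norm (of_real t * (bM y - bN y)))"
      by (intro admissible_L1 a(1)) simp
    note amf = admissible_L1[OF a(1) f]
    have pot_eq: "pot a lborel (\<lambda>y. f y - of_real (v y) * u y) x =
        pot a lborel f x - of_real t * (pot a lborel bM x - pot a lborel bN x)" for x
    proof -
      have "(\<lambda>y. f y - of_real (v y) * u y) = (\<lambda>y. f y - of_real t * (bM y - bN y))"
        by (simp add: v_def bM_def bN_def fun_eq_iff algebra_simps)
      then show ?thesis using pot_diff[OF amf amd] pot_cmult[of a lborel "of_real t" "\<lambda>y. bM y - bN y"] pot_diff[OF amM amN]
        by simp
    qed
    show ?thesis
    proof (rule a_priori_L1[OF cu bu cv iv vT f])
      fix x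
      have "u x - g0 * pot a lborel (\<lambda>y. f y - of_real (v y) * u y) x =
          (u x + of_real t * greenV u x - g0 * pot a lborel f x)
          + of_real t * (g0 * ((pot a lborel bM x - pot a M u x) - (pot a lborel bN x - pot a N u x)))"
        unfolding pot_eq greenV_def by (simp add: algebra_simps)
      also have "norm \<dots> \<le> \<eta> + norm (of_real t * (g0 * ((pot a lborel bM x - pot a M u x) - (pot a lborel bN x - pot a N u x))))"
        by (rule order_trans[OF norm_triangle_ineq add_right_mono[OF near]])
      also have "norm (of_real t * (g0 * ((pot a lborel bM x - pot a M u x) - (pot a lborel bN x - pot a N u x))))
          = t * (norm g0 * norm ((pot a lborel bM x - pot a M u x) - (pot a lborel bN x - pot a N u x)))"
        using t by (simp add: norm_mult)
      also have "\<dots> \<le> 1 * (norm g0 * (eM n + eN n))"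
      proof (intro mult_mono mult_left_mono)
        show "norm ((pot a lborel bM x - pot a M u x) - (pot a lborel bN x - pot a N u x)) \<le> eM n + eN n"
          using eM(2)[of n x] eN(2)[of n x] unfolding bM_def bN_def
          by (intro order_trans[OF norm_triangle_ineq4 add_mono])
      qed (use t in auto)
      finally show "norm (u x - g0 * pot a lborel (\<lambda>y. f y - of_real (v y) * u y) x) \<le> \<eta> + norm g0 * (eM n + eN n)" by simp
    qed
  qed
  have "(\<lambda>n. (1 + apriori_const h E T * T) * (\<eta> + norm g0 * (eM n + eN n)) + apriori_const h E T * (LBINT y. norm (f y))) \<longlonglongrightarrow>
      (1 + apriori_const h E T * T) * (\<eta> + norm g0 * (0 + 0)) + apriori_const h E T * (LBINT y. norm (f y))"
    by (intro tendsto_intros eM(1) eN(1))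
  then have "norm (u x) \<le> (1 + apriori_const h E T * T) * (\<eta> + norm g0 * (0 + 0)) + apriori_const h E T * (LBINT y. norm (f y))"
    using step by (intro LIMSEQ_le_const) auto
  then show ?thesis by simp
qed

lemma bcontfun_greenV:
  assumes "u \<in> bcontfun"
  shows "greenV u \<in> bcontfun" "\<And>B x. (\<And>y. norm (u y) \<le> B) \<Longrightarrow> norm (greenV u x) \<le> norm g0 * (B * T)"
proof -
  have cu: "continuous_on UNIV u" and "bounded (range u)" using assms by (auto simp: bcontfun_def)
  then obtain B0 where B0: "\<And>y. norm (u y) \<le> B0" by (auto simp: bounded_iff)
  note mu = borel_measurable_continuous_onI[OF cu]
  show le: "norm (greenV u x) \<le> norm g0 * (B * T)" if B: "\<And>y. norm (u y) \<le> B" for B x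
  proof -
    have "norm (pot a M u x - pot a N u x) \<le> B * measure M UNIV + B * measure N UNIV"
      by (rule order_trans[OF norm_triangle_ineq4 add_mono[OF norm_pot_le_const[OF adm_MN(1)[OF mu B]] norm_pot_le_const[OF adm_MN(2)[OF mu B]]]])
    then have "norm g0 * norm (pot a M u x - pot a N u x) \<le> norm g0 * (B * T)"
      by (intro mult_left_mono) (auto simp: T_def algebra_simps)
    then show ?thesis by (simp add: greenV_def norm_mult)
  qed
  show "greenV u \<in> bcontfun"
  proof (rule bcontfun_normI)
    show "continuous_on UNIV (greenV u)"
      unfolding greenV_def by (intro continuous_intros ac_deriv_continuous[OF ac_deriv_pot[OF adm_MN(1)[OF mu B0]]]
          ac_deriv_continuous[OF ac_deriv_pot[OF adm_MN(2)[OF mu B0]]])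
    show "norm (greenV u x) \<le> norm g0 * (B0 * T)" for x by (rule le[OF B0])
  qed
qed

lemma bcontfun_norm_bound: "norm (apply_bcontfun (u :: real \<Rightarrow>\<^sub>C complex) x) \<le> norm u"
  by (rule norm_bounded)

text \<open>The method of continuity on the Banach space of bounded continuous functions:
  \<open>a_priori_measure\<close> with \<open>f = 0\<close>, and with the norm of
  \<open>u + t A u\<close> as \<eta>, is the lower bound it asks for.\<close>

theorem integral_equation_solvable:
  assumes g: "g \<in> bcontfun"
  obtains u where "u \<in> bcontfun" "\<And>x. u x + greenV u x = g x"
proof -
  define A :: "(real \<Rightarrow>\<^sub>C complex) \<Rightarrow> (real \<Rightarrow>\<^sub>C complex)" where "A u = Bcontfun (greenV (apply_bcontfun u))" for u
  have uc: "apply_bcontfun u \<in> bcontfun" for u :: "real \<Rightarrow>\<^sub>C complex" by (rule apply_bcontfun)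
  have A: "apply_bcontfun (A u) x = greenV (apply_bcontfun u) x" for u x
    unfolding A_def by (simp add: Bcontfun_inverse bcontfun_greenV(1)[OF uc])
  note nb = bcontfun_norm_bound
  have mu: "apply_bcontfun u \<in> borel_measurable borel" for u :: "real \<Rightarrow>\<^sub>C complex"
    by (intro borel_measurable_continuous_onI) simp
  have bl: "bounded_linear A"
  proof
    show "A (u + w) = A u + A w" for u w
    proof (rule bcontfun_eqI)
      fix x
      show "apply_bcontfun (A (u + w)) x = apply_bcontfun (A u + A w) x"
        using pot_add[OF adm_MN(1)[OF mu nb] adm_MN(1)[OF mu nb], of u w x]
          pot_add[OF adm_MN(2)[OF mu nb] adm_MN(2)[OF mu nb], of u w x]
        by (simp add: A greenV_def plus_bcontfun.rep_eq[abs_def] algebra_simps)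
    qed
    show "A (r *\<^sub>R u) = r *\<^sub>R A u" for r u
    proof (rule bcontfun_eqI)
      fix x
      show "apply_bcontfun (A (r *\<^sub>R u)) x = apply_bcontfun (r *\<^sub>R A u) x"
        using pot_cmult[of a M "of_real r" "apply_bcontfun u" x] pot_cmult[of a N "of_real r" "apply_bcontfun u" x]
        by (simp add: A greenV_def scaleR_bcontfun.rep_eq[abs_def] scaleR_conv_of_real algebra_simps)
    qed
    show "\<exists>K. \<forall>u. norm (A u) \<le> norm u * K"
    proof (intro exI allI)
      fix u
      show "norm (A u) \<le> norm u * (norm g0 * T)"
      proof (rule norm_bound)
        fix x
        show "norm (apply_bcontfun (A u) x) \<le> norm u * (norm g0 * T)"
          using bcontfun_greenV(2)[OF uc nb, of u x] by (simp add: A mult_ac)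
      qed
    qed
  qed
  have "\<exists>u. u + A u = Bcontfun g"
  proof (rule method_of_continuity[OF bl, of "1 + apriori_const h E T * T"])
    fix t :: real and u :: "real \<Rightarrow>\<^sub>C complex" assume t: "0 \<le> t" "t \<le> 1"
    show "norm u \<le> (1 + apriori_const h E T * T) * norm (u + t *\<^sub>R A u)"
    proof (rule norm_bound)
      fix x
      have "norm (apply_bcontfun u x) \<le> (1 + apriori_const h E T * T) * norm (u + t *\<^sub>R A u) + apriori_const h E T * (\<integral>y. norm (0 :: complex) \<partial>(lborel :: real measure))"
      proof (rule a_priori_measure[OF _ nb t])
        fix x
        show "norm (apply_bcontfun u x + of_real t * greenV (apply_bcontfun u) x - g0 * pot a lborel (\<lambda>_. 0) x) \<le> norm (u + t *\<^sub>R A u)"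
          using nb[of "u + t *\<^sub>R A u" x]
          by (simp add: plus_bcontfun.rep_eq scaleR_bcontfun.rep_eq A pot_def scaleR_conv_of_real)
      qed auto
      then show "norm (apply_bcontfun u x) \<le> (1 + apriori_const h E T * T) * norm (u + t *\<^sub>R A u)" by simp
    qed
  qed
  then obtain u where u: "u + A u = Bcontfun g" by blast
  have "apply_bcontfun u x + greenV (apply_bcontfun u) x = g x" for x
    using arg_cong[OF u, of "\<lambda>w. apply_bcontfun w x"] g
    by (simp add: plus_bcontfun.rep_eq A Bcontfun_inverse)
  then show ?thesis using that uc by blast
qed

end

section \<open>Square integrable functions\<close>

lemma L2_iff: "u \<in> L2 \<longleftrightarrow> u \<in> borel_measurable borel \<and> integrable lborel (\<lambda>x. (norm (u x))\<^sup>2)"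
  by (simp add: L2_def)

lemma L2_add:
  assumes "u \<in> L2" "v \<in> L2"
  shows "(\<lambda>x. u x + v x) \<in> L2"
proof -
  have [measurable]: "u \<in> borel_measurable borel" "v \<in> borel_measurable borel"
    and i: "integrable lborel (\<lambda>x. 2 * (norm (u x))\<^sup>2 + 2 * (norm (v x))\<^sup>2)" using assms by (auto simp: L2_iff)
  have le: "(norm (u x + v x))\<^sup>2 \<le> 2 * (norm (u x))\<^sup>2 + 2 * (norm (v x))\<^sup>2" for x
  proof -
    have "(norm (u x + v x))\<^sup>2 \<le> (norm (u x) + norm (v x))\<^sup>2" by (intro power_mono norm_triangle_ineq) auto
    also have "\<dots> \<le> 2 * (norm (u x))\<^sup>2 + 2 * (norm (v x))\<^sup>2"
      using sum_squares_bound[of "norm (u x)" "norm (v x)"] by (simp add: power2_sum)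
    finally show ?thesis .
  qed
  have "integrable lborel (\<lambda>x. (norm (u x + v x))\<^sup>2)"
    by (rule Bochner_Integration.integrable_bound[OF i]) (use order_trans[OF le abs_ge_self] in auto)
  then show ?thesis by (simp add: L2_iff)
qed

lemma L2_bounded_mult:
  assumes "u \<in> L2" "k \<in> borel_measurable borel" "\<And>x. norm (k x) \<le> B"
  shows "(\<lambda>x. k x * u x) \<in> L2"
proof -
  have [measurable]: "u \<in> borel_measurable borel" "k \<in> borel_measurable borel"
    and i: "integrable lborel (\<lambda>x. B\<^sup>2 * (norm (u x))\<^sup>2)" using assms by (auto simp: L2_iff)
  have le: "(norm (k x * u x))\<^sup>2 \<le> B\<^sup>2 * (norm (u x))\<^sup>2" for x
    unfolding norm_mult power_mult_distrib using assms(3) by (intro mult_right_mono power_mono) auto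
  have "integrable lborel (\<lambda>x. (norm (k x * u x))\<^sup>2)"
    by (rule Bochner_Integration.integrable_bound[OF i]) (use order_trans[OF le abs_ge_self] in auto)
  then show ?thesis by (simp add: L2_iff)
qed

lemma L2_cmult: "u \<in> L2 \<Longrightarrow> (\<lambda>x. c * u x) \<in> L2"
  by (rule L2_bounded_mult[of u "\<lambda>_. c" "norm c"]) auto

lemma L2_diff: "u \<in> L2 \<Longrightarrow> v \<in> L2 \<Longrightarrow> (\<lambda>x. u x - v x) \<in> L2"
  using L2_add[OF _ L2_cmult[of v "- 1"]] by simp

lemma L2_cong_AE:
  assumes "u \<in> L2" "v \<in> borel_measurable borel" "AE x in lborel. u x = v x"
  shows "v \<in> L2"
proof -
  have "integrable lborel (\<lambda>x. (norm (v x))\<^sup>2)"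
    by (rule integrable_cong_AE_imp[of _ "\<lambda>x. (norm (u x))\<^sup>2"])
       (use assms in \<open>auto simp: L2_iff elim: eventually_mono\<close>)
  then show ?thesis using assms(2) by (simp add: L2_iff)
qed

lemma L2_locally_integrable:
  assumes "u \<in> L2"
  shows "set_integrable lborel {s..t} u"
  unfolding set_integrable_def
proof (rule Bochner_Integration.integrable_bound)
  have [measurable]: "u \<in> borel_measurable borel" and i: "integrable lborel (\<lambda>x. (norm (u x))\<^sup>2)"
    using assms by (auto simp: L2_iff)
  show "integrable lborel (\<lambda>x. indicator {s..t} x + (norm (u x))\<^sup>2)"
    by (intro Bochner_Integration.integrable_add i integrable_real_indicator) (auto simp: emeasure_lborel_Icc_eq)
  have "norm (u x) \<le> 1 + (norm (u x))\<^sup>2" for x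
    using sum_squares_bound[of 1 "norm (u x)", unfolded power_one mult_1_right] norm_ge_zero[of "u x"] by linarith
  then show "AE x in lborel. norm (indicator {s..t} x *\<^sub>R u x) \<le> norm (indicator {s..t} x + (norm (u x))\<^sup>2)"
    by (intro AE_I2) (auto simp: indicator_def)
  show "(\<lambda>x. indicator {s..t} x *\<^sub>R u x) \<in> borel_measurable lborel" by measurable
qed

lemma continuous_locally_integrable:
  fixes u :: "real \<Rightarrow> complex"
  assumes "continuous_on UNIV u"
  shows "set_integrable lborel {s..t} u"
  by (rule borel_integrable_atLeastAtMost') (rule continuous_on_subset[OF assms], simp)

lemma integral_cong_AE_mult:
  fixes u v \<phi> :: "real \<Rightarrow> complex"
  assumes "AE x in lborel. u x = v x" "u \<in> borel_measurable borel" "v \<in> borel_measurable borel" "\<phi> \<in> borel_measurable borel"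
  shows "(LBINT x. u x * \<phi> x) = (LBINT x. v x * \<phi> x)"
proof (rule integral_cong_AE)
  show "AE x in lborel. u x * \<phi> x = v x * \<phi> x" using assms(1) by eventually_elim simp
qed (use assms in auto)

lemma L2_norm_le:
  assumes "u \<in> borel_measurable borel" "0 \<le> C" and g: "integrable lborel g" "(LBINT x. g x) \<le> C\<^sup>2"
    and le: "AE x in lborel. (norm (u x))\<^sup>2 \<le> g x"
  shows "u \<in> L2" "L2_norm u \<le> C"
proof -
  have [measurable]: "u \<in> borel_measurable borel" by fact
  have i: "integrable lborel (\<lambda>x. (norm (u x))\<^sup>2)"
    by (rule Bochner_Integration.integrable_bound[OF g(1)])
       (use le in \<open>auto elim!: eventually_mono intro: order_trans[OF _ abs_ge_self]\<close>)
  then show "u \<in> L2" by (simp add: L2_iff)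
  have "(LBINT x. (norm (u x))\<^sup>2) \<le> (LBINT x. g x)" by (rule integral_mono_AE[OF i g(1) le])
  then have "sqrt (LBINT x. (norm (u x))\<^sup>2) \<le> sqrt (C\<^sup>2)" using g(2) by (intro real_sqrt_le_mono) linarith
  then show "L2_norm u \<le> C" using assms(2) by (simp add: L2_norm_def)
qed

lemma L2_norm_le_1D: "L2_norm f \<le> 1 \<Longrightarrow> (LBINT x. (norm (f x))\<^sup>2) \<le> 1"
  by (simp add: L2_norm_def)

lemma L2_opnorm_le:
  assumes "\<And>f. f \<in> L2 \<Longrightarrow> L2_norm f \<le> 1 \<Longrightarrow> T f \<in> L2 \<and> L2_norm (T f) \<le> C"
  shows "L2_opnorm T \<le> ereal C"
  unfolding L2_opnorm_def using assms by (intro SUP_least) auto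

lemma cont_rep_eqI:
  assumes "continuous_on UNIV v" "bounded (range v)" "AE x in lborel. v x = u x"
  shows "cont_rep u = v"
  unfolding cont_rep_def
proof (rule the_equality)
  fix w assume w: "continuous_on UNIV w \<and> bounded (range w) \<and> (AE x in lborel. w x = u x)"
  then have "AE x in lborel. w x = u x" by blast
  with assms(3) have "AE x in lborel. w x = v x" by eventually_elim simp
  then show "w = v" using w assms(1) by (intro continuous_AE_eq_imp_eq) auto
qed (use assms in blast)

text \<open>\<open>du_Bois_Reymond\<close> supplies a continuous representative and
  \<open>norm_square_le_integral\<close> bounds it, so it is the function that
  \<open>cont_rep\<close> describes.\<close>

lemma H1_cont_rep:
  assumes u: "u \<in> L2" and q: "q \<in> L2" and w: "weak_derivative u q"
  shows "cont_rep u \<in> bcontfun" "AE x in lborel. cont_rep u x = u x" "ac_deriv (cont_rep u) q"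
proof -
  have qm: "q \<in> borel_measurable borel" and q2: "integrable lborel (\<lambda>x. (norm (q x))\<^sup>2)" using q by (auto simp: L2_iff)
  obtain v where v: "ac_deriv v q" "AE x in lborel. v x = u x"
    using du_Bois_Reymond[OF L2_locally_integrable[OF u] L2_locally_integrable[OF q]] w
    unfolding weak_derivative_def by blast
  have "AE x in lborel. u x = v x" using v(2) by eventually_elim simp
  then have "v \<in> L2" by (rule L2_cong_AE[OF u ac_deriv_measurable[OF v(1)]])
  then have v2: "integrable lborel (\<lambda>x. (norm (v x))\<^sup>2)" by (simp add: L2_iff)
  have vb: "norm (v x) \<le> sqrt (LBINT y. norm (v y) * norm (q y))" for x
    by (rule real_le_rsqrt[OF norm_square_le_integral[OF v(1) qm v2 q2]])
  have vc: "v \<in> bcontfun" by (rule bcontfun_normI[OF ac_deriv_continuous[OF v(1)] vb])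
  then have "cont_rep u = v" using v(2) by (intro cont_rep_eqI) (auto simp: bcontfun_def)
  then show "cont_rep u \<in> bcontfun" "AE x in lborel. cont_rep u x = u x" "ac_deriv (cont_rep u) q"
    using v vc by auto
qed

context schroedinger_resolvent
begin

lemma admf:
  assumes "f \<in> L2"
  shows "admissible a lborel f (1 / Re a + (LBINT y. (norm (f y))\<^sup>2))"
  using assms by (intro admissible_L2 a(1)) (auto simp: L2_iff)

text \<open>Stated for an arbitrary bounded continuous \<open>u\<close> because it is used in two
  ways. If \<open>u\<close> solves the integral equation, then \<open>U = u\<close> and
  \<open>u\<close> lies in the domain; if \<open>u\<close> solves the differential equation, then
  \<open>u\<close> is compared with \<open>U\<close>.\<close>

lemma potential_properties:
  assumes uc: "u \<in> bcontfun" and f: "f \<in> L2"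
  defines "U \<equiv> \<lambda>x. g0 * pot a lborel f x - greenV u x"
    and "Q \<equiv> \<lambda>x. g0 * (potd a lborel f x - (potd a M u x - potd a N u x))"
  shows "ac_deriv U Q" "U \<in> L2" "Q \<in> L2" "Q \<in> Linf"
    and "\<And>\<phi>. test_function \<phi> \<Longrightarrow> - (complex_of_real h)\<^sup>2 * (LBINT x. U x * vderiv (vderiv \<phi>) x)
       + ((\<integral>x. u x * \<phi> x \<partial>M) - (\<integral>x. u x * \<phi> x \<partial>N)) = (LBINT x. (f x + z * U x) * \<phi> x)"
proof -
  have cu: "continuous_on UNIV u" and "bounded (range u)" using uc by (auto simp: bcontfun_def)
  then obtain B where B: "\<And>y. norm (u y) \<le> B" by (auto simp: bounded_iff)
  note mu = borel_measurable_continuous_onI[OF cu]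
  have [measurable]: "u \<in> borel_measurable borel" by (rule mu)
  note adf = admf[OF f] and aM = adm_MN(1)[OF mu B] and aN = adm_MN(2)[OF mu B]
  have [measurable]: "f \<in> borel_measurable borel" and f2: "integrable lborel (\<lambda>x. (norm (f x))\<^sup>2)" using f by (auto simp: L2_iff)
  note [measurable] = measurable_pot[OF adf] measurable_pot[OF aM] measurable_pot[OF aN]
    measurable_potd[OF adf] measurable_potd[OF aM] measurable_potd[OF aN]
  have ac: "ac_deriv (\<lambda>x. g0 * (pot a lborel f x + - (pot a M u x + - pot a N u x)))
      (\<lambda>x. g0 * (potd a lborel f x + - (potd a M u x + - potd a N u x)))"
    by (intro ac_deriv_bounded_linear[OF bounded_linear_mult_right] ac_deriv_add ac_deriv_uminus
        ac_deriv_pot[OF adf] ac_deriv_pot[OF aM] ac_deriv_pot[OF aN])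
  have U_eq: "U = (\<lambda>x. g0 * (pot a lborel f x - (pot a M u x - pot a N u x)))"
    by (simp add: U_def greenV_def fun_eq_iff algebra_simps)
  show acU: "ac_deriv U Q" using ac by (simp only: U_eq Q_def diff_conv_add_uminus)
  have int: "integrable m u" if "sets m = sets borel" "finite_measure m" for m
  proof -
    note [measurable_cong] = that(1)
    show ?thesis by (rule finite_measure.integrable_const_bound[OF that(2), where B = B]) (use B in auto)
  qed
  have L: "pot a lborel f \<in> L2" "potd a lborel f \<in> L2" "pot a M u \<in> L2" "potd a M u \<in> L2" "pot a N u \<in> L2" "potd a N u \<in> L2"
    using pot_square_integrable_L2[OF a(1) _ f2] pot_square_integrable_L1[OF aM int[OF M]]
      pot_square_integrable_L1[OF aN int[OF N]] by (auto simp: L2_iff)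
  show "U \<in> L2" "Q \<in> L2" unfolding U_eq Q_def by (intro L2_cmult L2_diff L)+
  show "Q \<in> Linf"
  proof -
    have "norm (Q x) \<le> norm g0 * (norm a * (1 / Re a + (LBINT y. (norm (f y))\<^sup>2)) +
        (norm a * (B * measure M UNIV) + norm a * (B * measure N UNIV)))" for x
      unfolding Q_def norm_mult
      by (intro mult_left_mono order_trans[OF norm_triangle_ineq4] add_mono norm_potd_le_const[OF adf]
          norm_potd_le_const[OF aM] norm_potd_le_const[OF aN]) auto
    moreover have "Q \<in> borel_measurable borel" unfolding Q_def by measurable
    ultimately show ?thesis unfolding Linf_def by auto
  qed
  fix \<phi> assume \<phi>: "test_function \<phi>"
  note \<phi>2 = test_function_vderiv[OF test_function_vderiv[OF \<phi>]]
  define W where "W = (\<integral>x. u x * \<phi> x \<partial>M) - (\<integral>x. u x * \<phi> x \<partial>N)"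
  have I: "integrable lborel (\<lambda>x. pot a m b x * \<psi> x)" if "admissible a m b C" "test_function \<psi>" for m b C \<psi>
    by (rule integrable_locally_mult_test[OF continuous_locally_integrable[OF ac_deriv_continuous[OF ac_deriv_pot[OF that(1)]]] that(2)])
  have split: "(LBINT x. U x * \<psi> x) = g0 * ((LBINT x. pot a lborel f x * \<psi> x) -
      ((LBINT x. pot a M u x * \<psi> x) - (LBINT x. pot a N u x * \<psi> x)))" if "test_function \<psi>" for \<psi>
    using I[OF adf that] I[OF aM that] I[OF aN that] unfolding U_eq
    by (simp add: left_diff_distrib mult.assoc)
  have "(LBINT x. U x * vderiv (vderiv \<phi>) x) =
      (g0 * a\<^sup>2) * ((LBINT x. pot a lborel f x * \<phi> x) -
      ((LBINT x. pot a M u x * \<phi> x) - (LBINT x. pot a N u x * \<phi> x))) - (2 * a * g0) * ((LBINT x. f x * \<phi> x) - W)"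
    unfolding split[OF \<phi>2] pot_second_derivative_test(2)[OF adf \<phi>] pot_second_derivative_test(2)[OF aM \<phi>]
      pot_second_derivative_test(2)[OF aN \<phi>] W_def by (simp add: algebra_simps)
  also have "\<dots> = - (z / of_real (h\<^sup>2)) * (LBINT x. U x * \<phi> x) - 1 / of_real (h\<^sup>2) * ((LBINT x. f x * \<phi> x) - W)"
    unfolding g0 split[OF \<phi>] by simp
  finally have e: "- (complex_of_real h)\<^sup>2 * (LBINT x. U x * vderiv (vderiv \<phi>) x) =
      z * (LBINT x. U x * \<phi> x) + ((LBINT x. f x * \<phi> x) - W)"
    using h by (simp add: field_simps)
  have "(LBINT x. (f x + z * U x) * \<phi> x) = (LBINT x. f x * \<phi> x) + z * (LBINT x. U x * \<phi> x)"
    using integrable_locally_mult_test[OF L2_locally_integrable[OF f] \<phi>]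
      integrable_locally_mult_test[OF continuous_locally_integrable[OF ac_deriv_continuous[OF acU]] \<phi>]
    by (simp add: distrib_right mult.assoc)
  then show "- (complex_of_real h)\<^sup>2 * (LBINT x. U x * vderiv (vderiv \<phi>) x)
       + ((\<integral>x. u x * \<phi> x \<partial>M) - (\<integral>x. u x * \<phi> x \<partial>N)) = (LBINT x. (f x + z * U x) * \<phi> x)"
    using e by (simp add: W_def)
qed

text \<open>The potential term is the same for \<open>u\<close> and \<open>U\<close>, so it cancels
  in \<open>r = u - U\<close>. Hence \<open>- h^2 r'' = z r\<close>, with \<open>r\<close> and its
  derivative in L2, and the a priori bound with zero potential and zero source gives
  \<open>r = 0\<close>.\<close>

theorem distributional_solution_imp_integral_equation:
  assumes uc: "u \<in> bcontfun" and u: "u \<in> L2" and q: "q \<in> L2" and uq: "ac_deriv u q" and f: "f \<in> L2"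
    and eq: "\<And>\<phi>. test_function \<phi> \<Longrightarrow> - (complex_of_real h)\<^sup>2 * (LBINT x. u x * vderiv (vderiv \<phi>) x)
       + ((\<integral>x. u x * \<phi> x \<partial>M) - (\<integral>x. u x * \<phi> x \<partial>N)) = (LBINT x. (f x + z * u x) * \<phi> x)"
  shows "u x + greenV u x = g0 * pot a lborel f x"
proof -
  define U where "U = (\<lambda>x. g0 * pot a lborel f x - greenV u x)"
  define Q where "Q = (\<lambda>x. g0 * (potd a lborel f x - (potd a M u x - potd a N u x)))"
  note P = potential_properties(1-4)[OF uc f, folded U_def Q_def]
  define r where "r x = u x - U x" for x
  define p where "p x = q x - Q x" for x
  have rp: "ac_deriv r p" using ac_deriv_add[OF uq ac_deriv_uminus[OF P(1)]] by (simp add: r_def[abs_def] p_def[abs_def])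
  have rL: "r \<in> L2" and pL: "p \<in> L2" unfolding r_def p_def by (intro L2_diff u q P)+
  note cu = continuous_locally_integrable[OF ac_deriv_continuous[OF uq]]
    and cU = continuous_locally_integrable[OF ac_deriv_continuous[OF P(1)]]
    and cr = continuous_locally_integrable[OF ac_deriv_continuous[OF rp]]
  define b where "b x = - (z / of_real (h\<^sup>2)) * r x" for x
  have bL: "b \<in> L2" unfolding b_def by (rule L2_cmult[OF rL])
  have test: "(LBINT x. p x * vderiv \<phi> x) = - (LBINT x. b x * \<phi> x)" if \<phi>: "test_function \<phi>" for \<phi>
  proof -
    note \<phi>1 = test_function_vderiv[OF \<phi>] and \<phi>2 = test_function_vderiv[OF test_function_vderiv[OF \<phi>]]
    note iu = integrable_locally_mult_test[OF cu] and iU = integrable_locally_mult_test[OF cU]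
      and if' = integrable_locally_mult_test[OF L2_locally_integrable[OF f]]
    have "- (complex_of_real h)\<^sup>2 * (LBINT x. r x * vderiv (vderiv \<phi>) x) =
        - (complex_of_real h)\<^sup>2 * (LBINT x. u x * vderiv (vderiv \<phi>) x) -
        - (complex_of_real h)\<^sup>2 * (LBINT x. U x * vderiv (vderiv \<phi>) x)"
      using iu[OF \<phi>2] iU[OF \<phi>2] by (simp add: r_def left_diff_distrib right_diff_distrib)
    also have "\<dots> = (LBINT x. (f x + z * u x) * \<phi> x) - (LBINT x. (f x + z * U x) * \<phi> x)"
    proof -
      have "- (complex_of_real h)\<^sup>2 * (LBINT x. U x * vderiv (vderiv \<phi>) x)
         + ((\<integral>x. u x * \<phi> x \<partial>M) - (\<integral>x. u x * \<phi> x \<partial>N)) = (LBINT x. (f x + z * U x) * \<phi> x)"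
        unfolding U_def by (rule potential_properties(5)[OF uc f \<phi>])
      moreover have "X - Y = P - P'" if "X + W = P" "Y + W = P'" for X Y W P P' :: complex
        using that by auto
      ultimately show ?thesis using eq[OF \<phi>] by blast
    qed
    also have "\<dots> = z * (LBINT x. r x * \<phi> x)"
      using iu[OF \<phi>] iU[OF \<phi>] if'[OF \<phi>]
      by (simp add: r_def distrib_right mult.assoc left_diff_distrib right_diff_distrib)
    finally have e: "- (complex_of_real h)\<^sup>2 * (LBINT x. r x * vderiv (vderiv \<phi>) x) = z * (LBINT x. r x * \<phi> x)" .
    have "(LBINT x. r x * vderiv (vderiv \<phi>) x) = - (LBINT x. p x * vderiv \<phi> x)"
      by (rule integral_mult_vderiv_test[OF rp \<phi>1])
    with e have "(complex_of_real h)\<^sup>2 * (LBINT x. p x * vderiv \<phi> x) = z * (LBINT x. r x * \<phi> x)" by simp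
    then have "(LBINT x. p x * vderiv \<phi> x) = z / of_real (h\<^sup>2) * (LBINT x. r x * \<phi> x)"
      using h by (simp add: field_simps)
    also have "\<dots> = - (LBINT x. b x * \<phi> x)" unfolding b_def mult.assoc integral_mult_right_zero by simp
    finally show ?thesis .
  qed
  \<comment> \<open>The equation for \<open>r\<close> is so far only weak; \<open>p1\<close> is the
    absolutely continuous version of its derivative that the a priori bound asks for.\<close>
  obtain p1 where p1: "ac_deriv p1 b" "AE x in lborel. p1 x = p x"
    using du_Bois_Reymond[OF L2_locally_integrable[OF pL] L2_locally_integrable[OF bL] test] by blast
  have pp: "AE x in lborel. p x = p1 x" using p1(2) by eventually_elim simp
  have p1L: "p1 \<in> L2" by (rule L2_cong_AE[OF pL ac_deriv_measurable[OF p1(1)] pp])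
  have rp1: "ac_deriv r p1" by (rule ac_deriv_cong_AE[OF rp pp ac_deriv_measurable[OF p1(1)]])
  have L: "integrable lborel (\<lambda>x. (norm (r x))\<^sup>2)" "integrable lborel (\<lambda>x. (norm (p1 x))\<^sup>2)" "integrable lborel (\<lambda>x. (norm (b x))\<^sup>2)"
    "p1 \<in> borel_measurable borel" "b \<in> borel_measurable borel"
    using rL p1L bL by (auto simp: L2_iff)
  have "norm (r x) \<le> apriori_const h E 0 * (\<integral>y. norm (0 :: complex) \<partial>(lborel :: real measure))"
  proof (rule a_priori_bound[OF h E z rp1 _ L(1,2)])
    show "ac_deriv p1 (\<lambda>x. ((of_real 0 - z) * r x - 0) / of_real (h\<^sup>2))" using p1(1) by (simp add: b_def[abs_def])
    show "norm (r x) \<le> sqrt (LBINT y. norm (r y) * norm (p1 y))" for x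
      by (rule real_le_rsqrt[OF norm_square_le_integral[OF rp1 L(4,1,2)]])
    show "norm (p1 x) \<le> sqrt (LBINT y. norm (p1 y) * norm (b y))" for x
      by (rule real_le_rsqrt[OF norm_square_le_integral[OF p1(1) L(5,2,3)]])
  qed auto
  then have "r x = 0" by simp
  then show ?thesis by (simp add: r_def U_def)
qed

lemma bcontfun_pot_L2:
  assumes "f \<in> L2"
  shows "(\<lambda>x. g0 * pot a lborel f x) \<in> bcontfun"
proof (rule bcontfun_normI)
  show "continuous_on UNIV (\<lambda>x. g0 * pot a lborel f x)"
    by (intro continuous_intros ac_deriv_continuous[OF ac_deriv_pot[OF admf[OF assms]]])
  show "norm (g0 * pot a lborel f x) \<le> norm g0 * (1 / Re a + (LBINT y. (norm (f y))\<^sup>2))" for x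
    unfolding norm_mult by (intro mult_left_mono norm_pot_le_const[OF admf[OF assms]]) auto
qed

lemma solution_bound_L1:
  assumes uc: "u \<in> bcontfun" and f: "integrable lborel f"
    and eq: "\<And>x. u x + greenV u x = g0 * pot a lborel f x"
  shows "norm (u x) \<le> apriori_const h E T * (LBINT y. norm (f y))"
proof -
  have cu: "continuous_on UNIV u" and "bounded (range u)" using uc by (auto simp: bcontfun_def)
  then obtain B where B: "\<And>y. norm (u y) \<le> B" by (auto simp: bounded_iff)
  have "norm (u x) \<le> (1 + apriori_const h E T * T) * 0 + apriori_const h E T * (LBINT y. norm (f y))"
    by (rule a_priori_measure[OF cu B, of 1]) (use f eq in auto)
  then show ?thesis by simp
qed

text \<open>Complements \<open>solution_bound_L1\<close> for sources in L2, whose potential is still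
  bounded. It yields injectivity and the boundedness of the inverse.\<close>

lemma solution_bound_sup:
  assumes uc: "u \<in> bcontfun" and le: "\<And>x. norm (u x + greenV u x) \<le> \<eta>"
  shows "norm (u x) \<le> (1 + apriori_const h E T * T) * \<eta>"
proof -
  have cu: "continuous_on UNIV u" and "bounded (range u)" using uc by (auto simp: bcontfun_def)
  then obtain B where B: "\<And>y. norm (u y) \<le> B" by (auto simp: bounded_iff)
  have "norm (u x) \<le> (1 + apriori_const h E T * T) * \<eta> + apriori_const h E T * (\<integral>y. norm (0 :: complex) \<partial>(lborel :: real measure))"
    by (rule a_priori_measure[OF cu B, of 1]) (use le in \<open>auto simp: pot_def\<close>)
  then show ?thesis by simp
qed

text \<open>A bounded function times a finite measure has a square integrable potential; this
  converts a uniform bound of the solution into an L2 bound.\<close>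

lemma greenV_L2_bound:
  assumes uc: "u \<in> bcontfun" and B: "\<And>y. norm (u y) \<le> B"
  shows "integrable lborel (\<lambda>x. (norm (greenV u x))\<^sup>2)"
    "(LBINT x. (norm (greenV u x))\<^sup>2) \<le> (norm g0)\<^sup>2 * (2 * ((B * measure M UNIV)\<^sup>2 * (2 / Re a) + (B * measure N UNIV)\<^sup>2 * (2 / Re a)))"
proof -
  have cu: "continuous_on UNIV u" using uc by (auto simp: bcontfun_def)
  have B0: "0 \<le> B" using B[of 0] norm_ge_zero order_trans by blast
  note mu = borel_measurable_continuous_onI[OF cu]
  note aM = adm_MN(1)[OF mu B] and aN = adm_MN(2)[OF mu B]
  note [measurable] = measurable_pot[OF aM] measurable_pot[OF aN]
  have one: "integrable lborel (\<lambda>x. (norm (pot a m u x))\<^sup>2)"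
    "(LBINT x. (norm (pot a m u x))\<^sup>2) \<le> (B * measure m UNIV)\<^sup>2 * (2 / Re a)"
    if m: "sets m = sets borel" "finite_measure m" and adm: "admissible a m u (B * measure m UNIV)" for m
  proof -
    note [measurable_cong] = m(1)
    have [measurable]: "u \<in> borel_measurable borel" by (rule mu)
    interpret m: finite_measure m by (rule m(2))
    have sp: "space m = UNIV" using sets_eq_imp_space_eq[OF m(1)] by simp
    have iu: "integrable m u" by (rule m.integrable_const_bound[where B = B]) (use B in auto)
    show "integrable lborel (\<lambda>x. (norm (pot a m u x))\<^sup>2)" by (rule pot_square_integrable_L1(1)[OF adm iu])
    have "(\<integral>y. norm (u y) \<partial>m) \<le> (\<integral>y. B \<partial>m)" using iu B by (intro integral_mono) auto
    then have "(\<integral>y. norm (u y) \<partial>m) \<le> B * measure m UNIV" by (simp add: sp mult.commute)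
    then have "B * measure m UNIV * (2 / Re a * (\<integral>y. norm (u y) \<partial>m)) \<le> B * measure m UNIV * (2 / Re a * (B * measure m UNIV))"
      using B0 a(1) by (intro mult_left_mono) auto
    then show "(LBINT x. (norm (pot a m u x))\<^sup>2) \<le> (B * measure m UNIV)\<^sup>2 * (2 / Re a)"
      using pot_square_integrable_L1(3)[OF adm iu] by (simp add: power2_eq_square mult_ac)
  qed
  note oM = one[OF M aM] and oN = one[OF N aN]
  have le: "(norm (greenV u x))\<^sup>2 \<le> (norm g0)\<^sup>2 * (2 * ((norm (pot a M u x))\<^sup>2 + (norm (pot a N u x))\<^sup>2))" for x
  proof -
    have "(norm (pot a M u x - pot a N u x))\<^sup>2 \<le> (norm (pot a M u x) + norm (pot a N u x))\<^sup>2"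
      by (intro power_mono norm_triangle_ineq4) auto
    also have "\<dots> \<le> 2 * ((norm (pot a M u x))\<^sup>2 + (norm (pot a N u x))\<^sup>2)"
      using sum_squares_bound[of "norm (pot a M u x)" "norm (pot a N u x)"] by (simp add: power2_sum)
    finally show ?thesis unfolding greenV_def norm_mult power_mult_distrib by (intro mult_left_mono) auto
  qed
  have i: "integrable lborel (\<lambda>x. (norm g0)\<^sup>2 * (2 * ((norm (pot a M u x))\<^sup>2 + (norm (pot a N u x))\<^sup>2)))"
    using oM(1) oN(1) by (intro integrable_mult_right Bochner_Integration.integrable_add)
  show ii: "integrable lborel (\<lambda>x. (norm (greenV u x))\<^sup>2)"
  proof (rule Bochner_Integration.integrable_bound[OF i])
    show "(\<lambda>x. (norm (greenV u x))\<^sup>2) \<in> borel_measurable lborel" unfolding greenV_def by measurable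
  qed (use order_trans[OF le abs_ge_self] in auto)
  have "(LBINT x. (norm (greenV u x))\<^sup>2) \<le> (LBINT x. (norm g0)\<^sup>2 * (2 * ((norm (pot a M u x))\<^sup>2 + (norm (pot a N u x))\<^sup>2)))"
    by (rule integral_mono[OF ii i le])
  also have "\<dots> = (norm g0)\<^sup>2 * (2 * ((LBINT x. (norm (pot a M u x))\<^sup>2) + (LBINT x. (norm (pot a N u x))\<^sup>2)))"
    using oM(1) oN(1) by simp
  also have "\<dots> \<le> (norm g0)\<^sup>2 * (2 * ((B * measure M UNIV)\<^sup>2 * (2 / Re a) + (B * measure N UNIV)\<^sup>2 * (2 / Re a)))"
    using oM(2) oN(2) by (intro mult_left_mono add_mono) auto
  finally show "(LBINT x. (norm (greenV u x))\<^sup>2) \<le> (norm g0)\<^sup>2 * (2 * ((B * measure M UNIV)\<^sup>2 * (2 / Re a) + (B * measure N UNIV)\<^sup>2 * (2 / Re a)))" .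
qed

end

section \<open>The resolvent estimate\<close>

lemma resolvent_weight_integral:
  assumes "0 < \<delta>"
  shows "has_bochner_integral lborel (\<lambda>x. (resolvent_weight \<delta> x)\<^sup>2) (2 / \<delta>)"
proof -
  have "has_bochner_integral lborel (\<lambda>x. (max \<bar>x\<bar> 0 + 1) powr (- (1 + \<delta>))) (2 * (0 - (- ((0 + 1) powr (- \<delta>)) / \<delta>)))"
  proof (rule has_bochner_integral_even[where f = "\<lambda>x. (max x 0 + 1) powr (- (1 + \<delta>))"])
    show "DERIV (\<lambda>x. - ((x + 1) powr (- \<delta>)) / \<delta>) x :> (max x 0 + 1) powr (- (1 + \<delta>))" if "0 \<le> x" for x
    proof -
      have "DERIV (\<lambda>x. - ((x + 1) powr (- \<delta>)) / \<delta>) x :> - ((- \<delta>) * (x + 1) powr (- \<delta> - 1)) / \<delta>"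
        using that by (auto intro!: derivative_eq_intros)
      moreover have "- ((- \<delta>) * (x + 1) powr (- \<delta> - 1)) / \<delta> = (max x 0 + 1) powr (- (1 + \<delta>))"
      proof -
        have e: "(x + 1) powr (- \<delta> - 1) = (x + 1) powr (- (1 + \<delta>))" by (rule arg_cong) simp
        show ?thesis unfolding e using assms that by (simp add: max_def)
      qed
      ultimately show ?thesis by simp
    qed
    show "((\<lambda>x. - ((x + 1) powr (- \<delta>)) / \<delta>) \<longlongrightarrow> 0) at_top"
    proof -
      have "filterlim (\<lambda>x::real. 1 + x) at_top at_top"
        by (rule filterlim_tendsto_add_at_top[OF tendsto_const filterlim_ident])
      then have "((\<lambda>x. (1 + x) powr (- \<delta>)) \<longlongrightarrow> 0) at_top" using assms by (intro tendsto_neg_powr) auto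
      then have "((\<lambda>x. - ((1 + x) powr (- \<delta>)) / \<delta>) \<longlongrightarrow> - 0 / \<delta>) at_top" using assms by (intro tendsto_intros) auto
      then show ?thesis by (simp add: add.commute)
    qed
  qed auto
  moreover have "(resolvent_weight \<delta> x)\<^sup>2 = (max \<bar>x\<bar> 0 + 1) powr (- (1 + \<delta>))" for x
  proof -
    have "(resolvent_weight \<delta> x)\<^sup>2 = (\<bar>x\<bar> + 1) powr (- ((1 + \<delta>) / 2) + - ((1 + \<delta>) / 2))"
      unfolding resolvent_weight_def power2_eq_square powr_add ..
    then show ?thesis by simp
  qed
  ultimately show ?thesis by simp
qed

lemma resolvent_weight_le_1:
  assumes "0 < \<delta>"
  shows "0 \<le> resolvent_weight \<delta> x" "resolvent_weight \<delta> x \<le> 1"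
proof -
  show "0 \<le> resolvent_weight \<delta> x" by (simp add: resolvent_weight_def)
  have "(\<bar>x\<bar> + 1) powr (- ((1 + \<delta>) / 2)) \<le> (\<bar>x\<bar> + 1) powr 0" using assms by (intro powr_mono) auto
  moreover have "\<bar>x\<bar> + 1 \<noteq> 0" using abs_ge_zero[of x] by linarith
  ultimately show "resolvent_weight \<delta> x \<le> 1" by (simp add: resolvent_weight_def)
qed

lemma measurable_resolvent_weight [measurable]: "resolvent_weight \<delta> \<in> borel_measurable borel"
  unfolding resolvent_weight_def by measurable

lemma two_times_le_exp:
  fixes t :: real
  assumes "0 \<le> t"
  shows "2 * t \<le> exp t"
proof -
  have "0 \<le> (t - 1)\<^sup>2 + 1" by simp
  then have "2 * t \<le> 1 + t + t\<^sup>2 / 2" by (simp add: power2_eq_square algebra_simps)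
  also have "\<dots> \<le> exp t" by (rule exp_lower_Taylor_quadratic[OF assms])
  finally show ?thesis .
qed

text \<open>After squaring, with \<open>\<tau> = 2 / \<delta>\<close> and
  \<open>c = T / (h * sqrt E)\<close>, the exponent \<open>C1\<close> is \<open>\<tau> + c\<close>:
  the Gronwall factor contributes \<open>exp c\<close>, and \<open>2 * \<tau> <= exp \<tau>\<close>
  supplies the rest. For the middle factor, \<open>(1 + sqrt (B / E))^2 <= 2 * (1 + B / E)\<close>,
  and \<open>2 * B <= B^2\<close> because \<open>B\<close> is at least 2.\<close>

lemma apriori_const_weight_le:
  assumes h: "0 < h" and E: "0 < E" and \<delta>: "0 < \<delta>"
  shows "apriori_const h E (tv_norm V) * (2 / \<delta>) \<le> sqrt (C_const V E h \<delta> / E)"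
proof -
  define T where "T = tv_norm V"
  define B where "B = 2 + 2 * E + T\<^sup>2 / h\<^sup>2"
  define c where "c = T / (h * sqrt E)"
  define \<tau> where "\<tau> = 2 / \<delta>"
  have B2: "2 \<le> B" using E by (simp add: B_def)
  have t0: "0 \<le> \<tau>" using \<delta> by (simp add: \<tau>_def)
  have C1: "C1 V E h \<delta> = \<tau> + c"
    using E h by (simp add: C1_def \<tau>_def c_def T_def powr_minus powr_half_sqrt divide_simps)
  have sB: "(1 + sqrt (B / E))\<^sup>2 \<le> 2 * (1 + B / E)"
  proof -
    have "(1 + sqrt (B / E))\<^sup>2 = 1 + B / E + 2 * 1 * sqrt (B / E)"
      using B2 E by (simp add: power2_sum)
    also have "2 * 1 * sqrt (B / E) \<le> 1\<^sup>2 + (sqrt (B / E))\<^sup>2" by (rule sum_squares_bound)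
    finally show ?thesis using B2 E by simp
  qed
  have BB: "2 * B \<le> B\<^sup>2" using B2 by (simp add: power2_eq_square mult_right_mono)
  have "(apriori_const h E T * \<tau>)\<^sup>2 = (exp c)\<^sup>2 * (4 / (h\<^sup>2 * E)) * (1 + sqrt (B / E))\<^sup>2 * \<tau>\<^sup>2"
    using E by (simp add: apriori_const_def B_def c_def power_mult_distrib power_divide)
  also have "\<dots> \<le> (exp c)\<^sup>2 * (4 / (h\<^sup>2 * E)) * (2 * (1 + B / E)) * \<tau>\<^sup>2"
    using E by (intro mult_right_mono mult_left_mono sB) auto
  also have "\<dots> = (exp c)\<^sup>2 * ((2 / (h\<^sup>2 * E)) * (1 + B / E)) * (2 * \<tau>)\<^sup>2" by (simp add: power_mult_distrib)
  also have "\<dots> \<le> (exp c)\<^sup>2 * ((4 / h\<^sup>2 + 2 / h + 1 / (E * h\<^sup>2) * B\<^sup>2) / E) * (exp \<tau>)\<^sup>2"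
  proof (intro mult_mono mult_left_mono power_mono two_times_le_exp t0)
    have "2 * (1 + B / E) \<le> 4 + 2 * h + B\<^sup>2 / E"
    proof -
      have "2 * B / E \<le> B\<^sup>2 / E" using BB E by (intro divide_right_mono) auto
      then show ?thesis using h by simp
    qed
    then have "2 * (1 + B / E) / h\<^sup>2 / E \<le> (4 + 2 * h + B\<^sup>2 / E) / h\<^sup>2 / E" using E by (intro divide_right_mono) auto
    then show "2 / (h\<^sup>2 * E) * (1 + B / E) \<le> (4 / h\<^sup>2 + 2 / h + 1 / (E * h\<^sup>2) * B\<^sup>2) / E"
      using h E by (simp add: field_simps power2_eq_square)
  qed (use t0 h E B2 in \<open>auto intro!: divide_nonneg_pos add_nonneg_nonneg mult_nonneg_nonneg\<close>)
  also have "\<dots> = C_const V E h \<delta> / E"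
    by (simp add: C_const_def C1 exp_add B_def T_def power2_eq_square)
  finally have "apriori_const h E T * \<tau> \<le> sqrt (C_const V E h \<delta> / E)" by (rule real_le_rsqrt)
  then show ?thesis by (simp add: T_def \<tau>_def)
qed

lemma apriori_const_nonneg: "0 < h \<Longrightarrow> 0 < E \<Longrightarrow> 0 \<le> apriori_const h E T"
  by (simp add: apriori_const_def add_nonneg_nonneg)

text \<open>The bound found for the unweighted inverse involves \<open>Re a\<close> and hence
  \<open>Im z\<close>. The weighted one passes through L1 and the uniform norm, where the constant
  \<open>apriori_const h E T\<close> does not see \<open>Im z\<close>.\<close>

theorem resolvent_estimate:
  assumes V: "finite_signed_borel_measure V" and h: "0 < h" and E: "0 < E" and \<delta>: "0 < \<delta>"
    and z: "Re z = E" "Im z \<noteq> 0" "\<bar>Im z\<bar> \<le> 1"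
    and A_eq: "\<And>u x. A u x = schroedinger h V u x - z * u x"
  shows "L2_boundedly_invertible (schroedinger_domain h V) A"
    and "L2_opnorm (\<lambda>f. mult_op (resolvent_weight \<delta>) (L2_inverse (schroedinger_domain h V) A (mult_op (resolvent_weight \<delta>) f)))
       \<le> ereal (sqrt (C_const V E h \<delta> / E))"
proof -
  define a where "a = csqrt (- z) / of_real h"
  \<comment> \<open>The principal root has nonnegative real part, and it is not purely imaginary
    because its square is not real.\<close>
  have "Re (csqrt (- z)) > 0"
  proof (rule ccontr)
    assume "\<not> Re (csqrt (- z)) > 0"
    then have "Re (csqrt (- z)) = 0" using csqrt_principal[of "- z"] by linarith
    then have "Im ((csqrt (- z))\<^sup>2) = 0" by (simp add: power2_eq_square)
    then show False using z(2) by simp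
  qed
  then have a: "0 < Re a" "of_real (h\<^sup>2) * a\<^sup>2 = - z"
    using h by (simp_all add: a_def power_divide)
  interpret schroedinger_resolvent h E z a "pos_part V" "neg_part V"
    by (rule schroedinger_resolvent.intro[OF h E z a sets_pos_part[OF V] finite_measure_pos_part[OF V]
          sets_neg_part[OF V] finite_measure_neg_part[OF V]])
  have T: "T = tv_norm V" by (simp add: T_def tv_norm_def total_variation_def)
  define D where "D = schroedinger_domain h V"
  have dist: "schroedinger_distribution h V u \<phi> = - (complex_of_real h)\<^sup>2 * (LBINT x. u x * vderiv (vderiv \<phi>) x)
      + ((\<integral>x. cont_rep u x * \<phi> x \<partial>pos_part V) - (\<integral>x. cont_rep u x * \<phi> x \<partial>neg_part V))" for u \<phi>
    by (simp add: schroedinger_distribution_def signed_integral_def)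
  have schr: "schroedinger h V u \<in> L2" "represented_by (schroedinger_distribution h V u) (schroedinger h V u)"
    if "u \<in> D" for u
  proof -
    have "\<exists>g. g \<in> L2 \<and> represented_by (schroedinger_distribution h V u) g"
      using that by (auto simp: D_def schroedinger_domain_def)
    from someI_ex[OF this] show "schroedinger h V u \<in> L2" "represented_by (schroedinger_distribution h V u) (schroedinger h V u)"
      by (auto simp: schroedinger_def)
  qed
  have DL2: "u \<in> L2" if "u \<in> D" for u using that by (auto simp: D_def schroedinger_domain_def H1_def)
  have test_meas: "\<phi> \<in> borel_measurable borel" if "test_function \<phi>" for \<phi>
    by (rule borel_measurable_continuous_onI[OF test_function_continuous[OF that]])
  have AL2: "A u \<in> L2" if "u \<in> D" for u
  proof -
    have "(\<lambda>x. schroedinger h V u x - z * u x) \<in> L2" by (intro L2_diff L2_cmult schr(1) DL2 that)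
    then show ?thesis by (simp add: A_eq[abs_def])
  qed

  \<comment> \<open>From the operator equation to the integral equation\<close>
  have eqn: "cont_rep u \<in> bcontfun" "AE x in lborel. cont_rep u x = u x"
    "\<And>x. cont_rep u x + greenV (cont_rep u) x = g0 * pot a lborel f x"
    if u: "u \<in> D" and f: "f \<in> L2" and Au: "AE x in lborel. A u x = f x" for u f
  proof -
    obtain q where q: "q \<in> L2" "weak_derivative u q"
      using u by (auto simp: D_def schroedinger_domain_def H1_def)
    note cr = H1_cont_rep[OF DL2[OF u] q]
    show "cont_rep u \<in> bcontfun" "AE x in lborel. cont_rep u x = u x" by (rule cr)+
    have uc: "AE x in lborel. u x = cont_rep u x" using cr(2) by eventually_elim simp
    have mc: "cont_rep u \<in> borel_measurable borel" by (rule ac_deriv_measurable[OF cr(3)])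
    have m: "u \<in> borel_measurable borel" "f \<in> borel_measurable borel" "schroedinger h V u \<in> borel_measurable borel"
      using DL2[OF u] f schr(1)[OF u] by (auto simp: L2_iff)
    show "cont_rep u x + greenV (cont_rep u) x = g0 * pot a lborel f x" for x
    proof (rule distributional_solution_imp_integral_equation[OF cr(1) L2_cong_AE[OF DL2[OF u] mc uc] q(1) cr(3) f])
      fix \<phi> assume \<phi>: "test_function \<phi>"
      note m2 = test_meas[OF test_function_vderiv[OF test_function_vderiv[OF \<phi>]]]
      have "(LBINT x. u x * vderiv (vderiv \<phi>) x) = (LBINT x. cont_rep u x * vderiv (vderiv \<phi>) x)"
        by (rule integral_cong_AE_mult[OF uc m(1) mc m2])
      moreover have "(LBINT x. schroedinger h V u x * \<phi> x) = (LBINT x. (f x + z * cont_rep u x) * \<phi> x)"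
      proof (rule integral_cong_AE_mult[OF _ m(3) _ test_meas[OF \<phi>]])
        show "AE x in lborel. schroedinger h V u x = f x + z * cont_rep u x"
          using Au uc by eventually_elim (simp add: A_eq algebra_simps)
        show "(\<lambda>x. f x + z * cont_rep u x) \<in> borel_measurable borel" using m mc by measurable
      qed
      moreover have "schroedinger_distribution h V u \<phi> = (LBINT x. schroedinger h V u x * \<phi> x)"
        using schr(2)[OF u] \<phi> by (simp add: represented_by_def)
      ultimately show "- (complex_of_real h)\<^sup>2 * (LBINT x. cont_rep u x * vderiv (vderiv \<phi>) x)
       + ((\<integral>x. cont_rep u x * \<phi> x \<partial>pos_part V) - (\<integral>x. cont_rep u x * \<phi> x \<partial>neg_part V))
       = (LBINT x. (f x + z * cont_rep u x) * \<phi> x)"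
        by (simp add: dist)
    qed
  qed

  \<comment> \<open>Surjectivity\<close>
  have exist: "\<exists>u \<in> D. AE x in lborel. A u x = f x" if f: "f \<in> L2" for f
  proof -
    obtain u where u: "u \<in> bcontfun" "\<And>x. u x + greenV u x = g0 * pot a lborel f x"
      using integral_equation_solvable[OF bcontfun_pot_L2[OF f]] by blast
    \<comment> \<open>The integral equation says that \<open>u\<close> is its own \<open>U\<close>,
      so \<open>potential_properties\<close> becomes a statement about \<open>u\<close>.\<close>
    have U: "(\<lambda>x. g0 * pot a lborel f x - greenV u x) = u"
      using u(2) by (metis (no_types, lifting) add_diff_cancel_right' ext)
    note P = potential_properties[OF u(1) f, unfolded U]
    define Q where "Q = (\<lambda>x. g0 * (potd a lborel f x - (potd a (pos_part V) u x - potd a (neg_part V) u x)))"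
    note P' = P(1-4)[folded Q_def]
    have wd: "weak_derivative u Q"
      unfolding weak_derivative_def using integral_mult_vderiv_test[OF P'(1)] by blast
    have cr: "cont_rep u = u" using u(1) by (intro cont_rep_eqI) (auto simp: bcontfun_def)
    define g where "g x = f x + z * u x" for x
    have gL: "g \<in> L2" unfolding g_def by (intro L2_add L2_cmult f P'(2))
    have rep: "represented_by (schroedinger_distribution h V u) g"
    proof -
      have "schroedinger_distribution h V u \<phi> = (LBINT x. g x * \<phi> x)" if \<phi>: "test_function \<phi>" for \<phi>
      proof -
        have "- (complex_of_real h)\<^sup>2 * (LBINT x. u x * vderiv (vderiv \<phi>) x)
           + ((\<integral>x. u x * \<phi> x \<partial>pos_part V) - (\<integral>x. u x * \<phi> x \<partial>neg_part V)) = (LBINT x. (f x + z * u x) * \<phi> x)"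
          using potential_properties(5)[OF u(1) f \<phi>] unfolding fun_cong[OF U] .
        then show ?thesis unfolding dist cr g_def .
      qed
      then show ?thesis by (simp add: represented_by_def)
    qed
    have uD: "u \<in> D"
      unfolding D_def schroedinger_domain_def H1_def using P' wd gL rep by blast
    \<comment> \<open>\<open>schroedinger\<close> is an arbitrary choice among the representing
      functions; the fundamental lemma identifies it with \<open>g\<close> almost
      everywhere.\<close>
    have "AE x in lborel. schroedinger h V u x - g x = 0"
    proof (rule fundamental_lemma)
      note sL = schr(1)[OF uD]
      show "set_integrable lborel {s..t} (\<lambda>x. schroedinger h V u x - g x)" for s t
        by (rule L2_locally_integrable[OF L2_diff[OF sL gL]])
      fix \<psi> assume \<psi>: "test_function \<psi>"
      have "(LBINT x. schroedinger h V u x * \<psi> x) = (LBINT x. g x * \<psi> x)"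
        using schr(2)[OF uD] rep \<psi> by (simp add: represented_by_def)
      then show "(LBINT x. (schroedinger h V u x - g x) * \<psi> x) = 0"
        using integrable_locally_mult_test[OF L2_locally_integrable[OF sL] \<psi>]
          integrable_locally_mult_test[OF L2_locally_integrable[OF gL] \<psi>] by (simp add: left_diff_distrib)
    qed
    then have "AE x in lborel. A u x = f x"
      by eventually_elim (simp add: A_eq g_def)
    then show ?thesis using uD by blast
  qed
  define R where "R = L2_inverse D A"
  have R: "R f \<in> D" "AE x in lborel. A (R f) x = f x" if "f \<in> L2" for f
  proof -
    have "\<exists>u. u \<in> D \<and> (AE x in lborel. A u x = f x)" using exist[OF that] by blast
    from someI_ex[OF this] show "R f \<in> D" "AE x in lborel. A (R f) x = f x" by (auto simp: R_def L2_inverse_def)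
  qed

  \<comment> \<open>Injectivity\<close>
  have inj: "AE x in lborel. u x = v x" if uv: "u \<in> D" "v \<in> D" and eq: "AE x in lborel. A u x = A v x" for u v
  proof -
    have "AE x in lborel. A v x = A u x" using eq by eventually_elim simp
    note eu = eqn[OF uv(1) AL2[OF uv(1)] AE_I2[OF refl]] and ev = eqn[OF uv(2) AL2[OF uv(1)] this]
    define d where "d x = cont_rep u x - cont_rep v x" for x
    obtain Bu Bv where B: "\<And>x. norm (cont_rep u x) \<le> Bu" "\<And>x. norm (cont_rep v x) \<le> Bv"
      using eu(1) ev(1) unfolding bcontfun_def bounded_iff by blast
    have mu: "cont_rep u \<in> borel_measurable borel" "cont_rep v \<in> borel_measurable borel"
      using eu(1) ev(1) by (auto simp: bcontfun_def intro: borel_measurable_continuous_onI)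
    have dc: "d \<in> bcontfun" unfolding d_def by (rule minus_cont[OF eu(1) ev(1)])
    have gd: "greenV d x = greenV (cont_rep u) x - greenV (cont_rep v) x" for x
      unfolding greenV_def d_def[abs_def] pot_diff[OF adm_MN(1)[OF mu(1) B(1)] adm_MN(1)[OF mu(2) B(2)]]
        pot_diff[OF adm_MN(2)[OF mu(1) B(1)] adm_MN(2)[OF mu(2) B(2)]] by (simp add: algebra_simps)
    have "d x + greenV d x = (cont_rep u x + greenV (cont_rep u) x) - (cont_rep v x + greenV (cont_rep v) x)" for x
      unfolding gd d_def by simp
    then have "d x + greenV d x = 0" for x unfolding eu(3) ev(3) by simp
    then have "norm (d x) \<le> (1 + apriori_const h E T * T) * 0" for x by (intro solution_bound_sup[OF dc]) simp
    then have "cont_rep u x = cont_rep v x" for x by (simp add: d_def)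
    then show ?thesis using eu(2) ev(2) by (auto elim: eventually_elim2)
  qed

  \<comment> \<open>Boundedness of the inverse on L2\<close>
  define s where "s = (1 + apriori_const h E T * T) * (norm g0 * sqrt (2 / Re a))"
  \<comment> \<open>From \<open>(p + q)^2 <= 2 p^2 + 2 q^2\<close> for the norms of the two terms of
    \<open>g0 * pot a lborel f - greenV u\<close>, where \<open>s\<close> bounds \<open>u\<close>
    uniformly for \<open>f\<close> in the unit ball.\<close>
  define C where "C = 2 * ((norm g0)\<^sup>2 * (2 / Re a)\<^sup>2) + 2 * ((norm g0)\<^sup>2 *
      (2 * ((s * measure (pos_part V) UNIV)\<^sup>2 * (2 / Re a) + (s * measure (neg_part V) UNIV)\<^sup>2 * (2 / Re a))))"
  have C0: "0 \<le> C" unfolding C_def using a(1) by (intro add_nonneg_nonneg mult_nonneg_nonneg) auto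
  have "L2_opnorm R \<le> ereal (sqrt C)"
  proof (rule L2_opnorm_le)
    fix f assume f: "f \<in> L2" and f1: "L2_norm f \<le> 1"
    note eq = eqn[OF R(1)[OF f] f R(2)[OF f]]
    define u where "u = cont_rep (R f)"
    note eq = eq[folded u_def]
    have fm: "f \<in> borel_measurable borel" and f2: "integrable lborel (\<lambda>x. (norm (f x))\<^sup>2)" using f by (auto simp: L2_iff)
    have f1': "(LBINT x. (norm (f x))\<^sup>2) \<le> 1" by (rule L2_norm_le_1D[OF f1])
    note PL = pot_square_integrable_L2[OF a(1) fm f2]
    have us: "norm (u x) \<le> s" for x
      unfolding s_def
    proof (rule solution_bound_sup[OF eq(1)])
      fix x
      have "(norm (pot a lborel f x))\<^sup>2 \<le> 2 / Re a * 1"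
        using PL(4)[of x] f1' a(1) by (meson divide_nonneg_pos mult_left_mono order_trans zero_le_numeral)
      then have "norm (pot a lborel f x) \<le> sqrt (2 / Re a)" by (simp add: real_le_rsqrt)
      then show "norm (u x + greenV u x) \<le> norm g0 * sqrt (2 / Re a)"
        unfolding eq(3) norm_mult by (intro mult_left_mono) auto
    qed
    note GB = greenV_L2_bound[OF eq(1) us]
    show "R f \<in> L2 \<and> L2_norm (R f) \<le> sqrt C"
    proof (intro conjI)
      have Rm: "R f \<in> borel_measurable borel" using DL2[OF R(1)[OF f]] by (simp add: L2_iff)
      have i: "integrable lborel (\<lambda>x. 2 * ((norm g0)\<^sup>2 * (norm (pot a lborel f x))\<^sup>2) + 2 * (norm (greenV u x))\<^sup>2)"
        using PL(1) GB(1) by (intro Bochner_Integration.integrable_add integrable_mult_right)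
      have "(LBINT x. 2 * ((norm g0)\<^sup>2 * (norm (pot a lborel f x))\<^sup>2) + 2 * (norm (greenV u x))\<^sup>2)
          = 2 * ((norm g0)\<^sup>2 * (LBINT x. (norm (pot a lborel f x))\<^sup>2)) + 2 * (LBINT x. (norm (greenV u x))\<^sup>2)"
        using PL(1) GB(1) by simp
      also have "\<dots> \<le> C"
        unfolding C_def
      proof (intro add_mono mult_left_mono GB(2))
        show "(LBINT x. (norm (pot a lborel f x))\<^sup>2) \<le> (2 / Re a)\<^sup>2"
          using order_trans[OF PL(3) mult_left_mono[OF f1']] by simp
      qed auto
      finally have le: "(LBINT x. 2 * ((norm g0)\<^sup>2 * (norm (pot a lborel f x))\<^sup>2) + 2 * (norm (greenV u x))\<^sup>2) \<le> (sqrt C)\<^sup>2"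
        using C0 by simp
      have ae: "AE x in lborel. (norm (R f x))\<^sup>2 \<le> 2 * ((norm g0)\<^sup>2 * (norm (pot a lborel f x))\<^sup>2) + 2 * (norm (greenV u x))\<^sup>2"
        using eq(2)
      proof eventually_elim
        fix x assume "u x = R f x"
        then have "R f x = g0 * pot a lborel f x - greenV u x" using eq(3)[of x] by (simp add: algebra_simps)
        then have "norm (R f x) \<le> norm g0 * norm (pot a lborel f x) + norm (greenV u x)"
          using norm_triangle_ineq4[of "g0 * pot a lborel f x" "greenV u x"] by (simp add: norm_mult)
        then have "(norm (R f x))\<^sup>2 \<le> (norm g0 * norm (pot a lborel f x) + norm (greenV u x))\<^sup>2" by (intro power_mono) auto
        also have "\<dots> \<le> 2 * (norm g0 * norm (pot a lborel f x))\<^sup>2 + 2 * (norm (greenV u x))\<^sup>2"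
          using sum_squares_bound[of "norm g0 * norm (pot a lborel f x)" "norm (greenV u x)"] by (simp add: power2_sum)
        finally show "(norm (R f x))\<^sup>2 \<le> 2 * ((norm g0)\<^sup>2 * (norm (pot a lborel f x))\<^sup>2) + 2 * (norm (greenV u x))\<^sup>2"
          by (simp add: power_mult_distrib)
      qed
      show "R f \<in> L2" "L2_norm (R f) \<le> sqrt C" using C0 by (intro L2_norm_le[OF Rm _ i le ae]; simp)+
    qed
  qed
  then have "L2_opnorm (L2_inverse D A) < \<infinity>" unfolding R_def by (rule order_le_less_trans) simp
  then have "L2_boundedly_invertible D A"
    unfolding L2_boundedly_invertible_def using AL2 exist inj by blast
  then show "L2_boundedly_invertible (schroedinger_domain h V) A" by (simp add: D_def)

  \<comment> \<open>The weighted estimate\<close>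
  define w where "w = resolvent_weight \<delta>"
  note w01 = resolvent_weight_le_1[OF \<delta>, folded w_def]
  have [measurable]: "w \<in> borel_measurable borel" by (simp add: w_def)
  have wi: "integrable lborel (\<lambda>x. (w x)\<^sup>2)" "(LBINT x. (w x)\<^sup>2) = 2 / \<delta>"
    using resolvent_weight_integral[OF \<delta>] by (auto simp: has_bochner_integral_iff w_def)
  define k where "k = apriori_const h E T"
  have k0: "0 \<le> k" unfolding k_def by (rule apriori_const_nonneg[OF h E])
  have "L2_opnorm (\<lambda>f. mult_op w (R (mult_op w f))) \<le> ereal (k * (2 / \<delta>))"
  proof (rule L2_opnorm_le)
    fix f assume f: "f \<in> L2" and f1: "L2_norm f \<le> 1"
    have [measurable]: "f \<in> borel_measurable borel" and f2: "integrable lborel (\<lambda>x. (norm (f x))\<^sup>2)" using f by (auto simp: L2_iff)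
    have f1': "(LBINT x. (norm (f x))\<^sup>2) \<le> 1" by (rule L2_norm_le_1D[OF f1])
    define F where "F = mult_op w f"
    have FL: "F \<in> L2" unfolding F_def mult_op_def
      by (rule L2_bounded_mult[OF f, of _ 1]) (use w01 in auto)
    have [measurable]: "F \<in> borel_measurable borel" using FL by (simp add: L2_iff)
    \<comment> \<open>The L2 norm of the weight, which makes AM-GM as sharp as Cauchy-Schwarz in
      bounding the L1 norm of \<open>w f\<close>. It is paid here and again when the bounded
      solution is multiplied by \<open>w\<close>, giving \<open>k * \<sigma>^2\<close>.\<close>
    define \<sigma> where "\<sigma> = sqrt (2 / \<delta>)"
    have s: "0 < \<sigma>" "\<sigma>\<^sup>2 = 2 / \<delta>" using \<delta> by (auto simp: \<sigma>_def)
    have Fle: "norm (F x) \<le> (1 / \<sigma> * (w x)\<^sup>2 + \<sigma> * (norm (f x))\<^sup>2) / 2" for x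
    proof -
      have "2 * (w x / sqrt \<sigma>) * (sqrt \<sigma> * norm (f x)) \<le> (w x / sqrt \<sigma>)\<^sup>2 + (sqrt \<sigma> * norm (f x))\<^sup>2" by (rule sum_squares_bound)
      then have "2 * (w x * norm (f x)) \<le> 1 / \<sigma> * (w x)\<^sup>2 + \<sigma> * (norm (f x))\<^sup>2"
        using s(1) by (simp add: power_mult_distrib power_divide)
      then show ?thesis using w01 by (simp add: F_def mult_op_def norm_mult)
    qed
    have i: "integrable lborel (\<lambda>x. (1 / \<sigma> * (w x)\<^sup>2 + \<sigma> * (norm (f x))\<^sup>2) / 2)" using wi f2 by simp
    have FI: "integrable lborel F"
      by (rule Bochner_Integration.integrable_bound[OF i]) (use order_trans[OF Fle abs_ge_self] in auto)
    have "(LBINT x. norm (F x)) \<le> (LBINT x. (1 / \<sigma> * (w x)\<^sup>2 + \<sigma> * (norm (f x))\<^sup>2) / 2)"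
      by (rule integral_mono[OF integrable_norm[OF FI] i Fle])
    also have "\<dots> = (1 / \<sigma> * \<sigma>\<^sup>2 + \<sigma> * (LBINT x. (norm (f x))\<^sup>2)) / 2" using wi f2 s(2) by simp
    also have "\<dots> \<le> (\<sigma> + \<sigma> * 1) / 2" using s(1) f1' by (intro divide_right_mono add_mono mult_left_mono) (auto simp: power2_eq_square)
    finally have FN: "(LBINT x. norm (F x)) \<le> \<sigma>" by simp
    note eq = eqn[OF R(1)[OF FL] FL R(2)[OF FL]]
    have ub: "norm (cont_rep (R F) x) \<le> k * \<sigma>" for x
      unfolding k_def by (rule order_trans[OF solution_bound_L1[OF eq(1) FI eq(3)] mult_left_mono[OF FN apriori_const_nonneg[OF h E]]])
    have Rm: "R F \<in> borel_measurable borel" using DL2[OF R(1)[OF FL]] by (simp add: L2_iff)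
    have mm: "mult_op w (R F) \<in> borel_measurable borel" unfolding mult_op_def using Rm by measurable
    have g: "integrable lborel (\<lambda>x. (k * \<sigma>)\<^sup>2 * (w x)\<^sup>2)" using wi by simp
    have gle: "(LBINT x. (k * \<sigma>)\<^sup>2 * (w x)\<^sup>2) \<le> (k * (2 / \<delta>))\<^sup>2"
    proof -
      have "(k * \<sigma>)\<^sup>2 * (2 / \<delta>) = (k * (2 / \<delta>))\<^sup>2"
        unfolding power_mult_distrib s(2) by (simp add: power2_eq_square)
      then show ?thesis using wi by simp
    qed
    have ae: "AE x in lborel. (norm (mult_op w (R F) x))\<^sup>2 \<le> (k * \<sigma>)\<^sup>2 * (w x)\<^sup>2"
      using eq(2)
    proof eventually_elim
      fix x assume "cont_rep (R F) x = R F x"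
      then have "norm (R F x) \<le> k * \<sigma>" using ub[of x] by simp
      then have "(norm (R F x))\<^sup>2 * (w x)\<^sup>2 \<le> (k * \<sigma>)\<^sup>2 * (w x)\<^sup>2" by (intro mult_right_mono power_mono) auto
      then show "(norm (mult_op w (R F) x))\<^sup>2 \<le> (k * \<sigma>)\<^sup>2 * (w x)\<^sup>2"
        by (simp add: mult_op_def norm_mult power_mult_distrib mult.commute)
    qed
    have "0 \<le> k * (2 / \<delta>)" using k0 \<delta> by simp
    from L2_norm_le[OF mm this g gle ae]
    show "mult_op w (R (mult_op w f)) \<in> L2 \<and> L2_norm (mult_op w (R (mult_op w f))) \<le> k * (2 / \<delta>)"
      by (simp add: F_def)
  qed
  also have "ereal (k * (2 / \<delta>)) \<le> ereal (sqrt (C_const V E h \<delta> / E))"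
    using apriori_const_weight_le[OF h E \<delta>, of V] by (simp add: k_def T)
  finally show "L2_opnorm (\<lambda>f. mult_op (resolvent_weight \<delta>) (L2_inverse (schroedinger_domain h V) A (mult_op (resolvent_weight \<delta>) f)))
       \<le> ereal (sqrt (C_const V E h \<delta> / E))"
    by (simp add: w_def R_def D_def)
qed

theorem corollary1p4:
  fixes \<delta> :: real
    and V :: "real \<Rightarrow> real set \<Rightarrow> real"
    and E :: "real \<Rightarrow> real"
  assumes "\<delta> > 0"
    and "\<And>h. h > 0 \<Longrightarrow> finite_signed_borel_measure (V h)"
    and "\<And>h. h > 0 \<Longrightarrow> E h > 0"
  shows "\<forall>h::real. \<forall>\<epsilon>::real. \<forall>\<sigma>::complex.
           h > 0 \<longrightarrow> \<epsilon> \<in> {0<..1} \<longrightarrow> \<sigma> \<in> {1, -1} \<longrightarrow>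
           (let D = schroedinger_domain h (V h);
                A = (\<lambda>u x. schroedinger h (V h) u x - complex_of_real (E h) * u x
                            + \<sigma> * (\<i> * complex_of_real \<epsilon>) * u x);
                W = mult_op (resolvent_weight \<delta>)
            in L2_boundedly_invertible D A \<and>
               L2_opnorm (\<lambda>f. W (L2_inverse D A (W f)))
                 \<le> ereal (sqrt (C_const (V h) (E h) h \<delta> / E h)))"
proof (intro allI impI)
  fix h \<epsilon> :: real and \<sigma> :: complex
  assume h: "h > 0" and \<epsilon>: "\<epsilon> \<in> {0<..1}" and \<sigma>: "\<sigma> \<in> {1, -1}"
  define A where "A = (\<lambda>u x. schroedinger h (V h) u x - complex_of_real (E h) * u x
                            + \<sigma> * (\<i> * complex_of_real \<epsilon>) * u x)"
  \<comment> \<open>Chosen so that the operator \<open>A\<close> is \<open>P - z\<close>; the choice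
    of the sign only flips \<open>Im z\<close>.\<close>
  define z where "z = complex_of_real (E h) - \<sigma> * (\<i> * complex_of_real \<epsilon>)"
  have z: "Re z = E h" "Im z \<noteq> 0" "\<bar>Im z\<bar> \<le> 1" using \<epsilon> \<sigma> by (auto simp: z_def)
  have A: "A u x = schroedinger h (V h) u x - z * u x" for u x by (simp add: A_def z_def algebra_simps)
  note est = resolvent_estimate[OF assms(2)[OF h] h assms(3)[OF h] assms(1) z, of A, OF A]
  show "let D = schroedinger_domain h (V h);
                A = (\<lambda>u x. schroedinger h (V h) u x - complex_of_real (E h) * u x
                            + \<sigma> * (\<i> * complex_of_real \<epsilon>) * u x);
                W = mult_op (resolvent_weight \<delta>)
            in L2_boundedly_invertible D A \<and>
               L2_opnorm (\<lambda>f. W (L2_inverse D A (W f)))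
                 \<le> ereal (sqrt (C_const (V h) (E h) h \<delta> / E h))"
    unfolding Let_def A_def[symmetric] using est by blast
qed

end
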